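(* Let $\Phi$ be a field of characteristic $3$, let $n\ge 1$, and let $\mathcal{F}(n)$ be the Frank Lie algebra over $\Phi$, regarded as a Lie algebra in $\mathbf{Rep}(\alpha_3)$ by means of the inner derivation $d=\operatorname{ad}(e\otimes 1)$, where $e\in\mathfrak{sl}(U)$ is given by $e(u)=0$, $e(v)=u$ for a basis $u,v$ of $U$ with $\lambda(u,v)=1$. Then the semisimplification of $\mathcal{F}(n)$ with respect to $d$ (the Lie superalgebra obtained by applying the semisimplification functor $\mathbf{Rep}(\alpha_3)\to\overline{\mathbf{Rep}(\alpha_3)}\simeq$ super vector spaces) is the modular contact Lie superalgebra $K(1,1;\underline{n})$.
   Context: Building blocks. $\mathcal{O}=\mathcal{O}(1;\underline n)$ is the divided power algebra over $\Phi$ with basis $x^{(i)}$, $0\le i<3^n$, and product $x^{(i)}x^{(j)}=\binom{i+j}{i}x^{(i+j)}$ (with $x^{(k)}=0$ for $k\ge 3^n$); $1=x^{(0)}$. The derivation $\partial$ is given by $\partial(x^{(i)})=x^{(i-1)}$ for $i\ge1$ and $\partial(1)=0$. $W=W(1;\underline n)=\{f\partial: f\in\mathcal{O}\}$ with bracket $[f\partial,g\partial]=(f\partial(g)-g\partial(f))\partial$. $\mathcal{O}_{(\mathrm{div})}$ is the space $\mathcal{O}$ with the $W$-action $f\partial\cdot_{(\mathrm{div})}g=\partial(fg)$. Frank algebra. Let $U$ be a $2$-dimensional $\Phi$-vector space with non-degenerate skew-symmetric form $\lambda$, and $\phi:U\times U\to\mathfrak{sl}(U)$, $\phi(u,u')(u'')=\lambda(u,u'')u'+\lambda(u',u'')u$.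 Then $\mathcal{F}(n)=(U\otimes\mathcal{O}_{(\mathrm{div})})\oplus(\mathfrak{sl}(U)\otimes\mathcal{O})\oplus(\mathrm{Id}_U\otimes W)$ with (anti-commutative) bracket determined by $[\mathrm{Id}\otimes D,\mathrm{Id}\otimes E]=\mathrm{Id}\otimes[D,E]$, $[a\otimes f,b\otimes g]=[a,b]\otimes fg$, $[\mathrm{Id}\otimes D,a\otimes f]=a\otimes D(f)$, $[\mathrm{Id}\otimes D,u\otimes f]=u\otimes(D\cdot_{(\mathrm{div})}f)$, $[a\otimes f,u\otimes g]=a(u)\otimes fg$, and $[u\otimes f,v\otimes g]=\phi(u,v)\otimes(f\partial(g)-g\partial(f))+\mathrm{Id}\otimes\lambda(u,v)fg\,\partial$, for $D,E\in W$, $a,b\in\mathfrak{sl}(U)$, $u,v\in U$, $f,g\in\mathcal{O}$. Contact superalgebra. Let $\mathcal{O}(1,1;\underline n)=\mathcal{O}\otimes\Lambda(1)$, with $\Lambda(1)$ the Grassmann algebra on one odd generator $\theta$, and let $W(1,1;\underline n)$ be the Lie superalgebra (under supercommutator) of the superderivations $f\partial+g\partial_\theta$, $f,g\in\mathcal{O}(1,1;\underline n)$, where $\partial_\theta(f\theta^i)=if\theta^{i-1}$ for $f\in\mathcal{O}$, $i=0,1$. $K(1,1;\underline n)$ is the subalgebra of $W(1,1;\underline n)$ generated by the image of the linear map $D_K:\mathcal{O}(1,1;\underline n)\to W(1,1;\underline n)$, $D_K(x^{(i)})=\theta x^{(i-1)}\partial_\theta+2x^{(i)}\partial$, $D_K(x^{(i)}\theta)=x^{(i)}\partial_\theta+x^{(i)}\theta\partial$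 (with $x^{(-1)}=0$). Semisimplification. $\alpha_3$ is the affine group scheme $R\mapsto\{k\in R:k^3=0\}$ under addition. A representation of $\alpha_3$ is the same as a vector space with a linear endomorphism whose cube is $0$; an algebra in $\mathbf{Rep}(\alpha_3)$ is an algebra with a derivation $d$ with $d^3=0$. The indecomposables are $(a)$, $a=1,2,3$, with basis $e_1,\dots,e_a$ and $d(e_i)=e_{i+1}$ ($e_{a+1}=0$). The semisimplification $\overline{\mathbf{Rep}(\alpha_3)}$ is the quotient by negligible morphisms ($f:X\to Y$ with $\mathrm{Tr}(fg)=0$ for all $g:Y\to X$); it is identified with super vector spaces with $\overline{(1)}$ even, $\overline{(2)}$ odd, $\overline{(3)}=0$. Here $(2)$ is realized as $U=\langle u,v\rangle$ with $d(v)=u$, $d(u)=0$, and $\overline{(2)}\otimes\overline{(2)}\cong\overline{(1)}$ is the isomorphism induced by the map $(1)\to(2)\otimes(2)$, $c\mapsto c(u\otimes v-v\otimes u)$. Concretely, decomposing an algebra $L$ in $\mathbf{Rep}(\alpha_3)$ as $L=(1)\otimes L_0\oplus(2)\otimes L_1\oplus(3)\otimes L_2$, the semisimplification has even part $L_0$ and odd part $L_1$; the product of $a,b\in L_0$ is the $L_0$-component of $[1\otimes a,1\otimes b]$; the product of $a\in L_0$ and $o\in L_1$ is the $o'\in L_1$ such that the $(2)\otimes L_1$-component of $z\mapsto[1\otimes a,z\otimes o]$ is $z\mapsto z\otimes o'$ modulo negligible morphisms; and the product of $o,o'\in L_1$ is the $L_0$-component of $[u\otimes o,v\otimes o']-[v\otimes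 o,u\otimes o']$. *)

theory Defs
  imports
    "HOL-Library.Function_Algebras"
    "HOL-Library.Product_Plus"
    "HOL-Computational_Algebra.Computational_Algebra"
begin

section \<open>Linear algebra relative to carriers\<close>

text \<open>
  A vector space over a field is a subspace of an ambient type on which a scalar
  multiplication in the sense of \<^locale>\<open>vector_space\<close> is given.
\<close>

definition linmap ::
  "('k::field \<Rightarrow> 'v::ab_group_add \<Rightarrow> 'v) \<Rightarrow> 'v set \<Rightarrow> ('k \<Rightarrow> 'w::ab_group_add \<Rightarrow> 'w) \<Rightarrow> 'w set \<Rightarrow> ('v \<Rightarrow> 'w) \<Rightarrow> bool"
where
  "linmap s V t W f \<longleftrightarrow>
     (\<forall>x\<in>V. f x \<in> W) \<and>
     (\<forall>x\<in>V. \<forall>y\<in>V. f (x + y) = f x + f y) \<and>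
     (\<forall>c. \<forall>x\<in>V. f (s c x) = t c (f x))"

text \<open>The trace of an endomorphism of a finite-dimensional space, computed in some basis.\<close>

definition lin_trace :: "('k::field \<Rightarrow> 'v::ab_group_add \<Rightarrow> 'v) \<Rightarrow> 'v set \<Rightarrow> ('v \<Rightarrow> 'v) \<Rightarrow> 'k" where
  "lin_trace s V f =
     (let B = (SOME B. B \<subseteq> V \<and> \<not> module.dependent s B \<and> module.span s B = V)
      in \<Sum>b\<in>B. module.representation s B (f b) b)"

definition fun_scale :: "('k \<Rightarrow> 'v \<Rightarrow> 'v) \<Rightarrow> 'k \<Rightarrow> ('i \<Rightarrow> 'v) \<Rightarrow> 'i \<Rightarrow> 'v" where
  "fun_scale s c F = (\<lambda>i. s c (F i))"

definition prod_scale :: "('k \<Rightarrow> 'v \<Rightarrow> 'v) \<Rightarrow> ('k \<Rightarrow> 'w \<Rightarrow> 'w) \<Rightarrow> 'k \<Rightarrow> 'v \<times> 'w \<Rightarrow> 'v \<times> 'w" where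
  "prod_scale s t c = map_prod (s c) (t c)"


section \<open>Divided powers\<close>

text \<open>
  An element \<open>\<Sum>i<3^n. F\<^sub>i \<otimes> x\<^sup>(\<^sup>i\<^sup>)\<close> of \<open>V \<otimes> \<O>(1;n)\<close> is represented by its
  coefficient function \<open>F :: nat \<Rightarrow> 'v\<close>; \<open>\<O>(1;n)\<close> itself is the case \<open>V = \<Phi>\<close>.
\<close>

definition dp_space :: "nat \<Rightarrow> 'v::zero set \<Rightarrow> (nat \<Rightarrow> 'v) set" where
  "dp_space n V = {F. (\<forall>i<3^n. F i \<in> V) \<and> (\<forall>i\<ge>3^n. F i = 0)}"

definition dp_basis :: "nat \<Rightarrow> nat \<Rightarrow> 'k::zero_neq_one" where
  "dp_basis i = (\<lambda>j. if j = i then 1 else 0)"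

definition dp_tensor :: "('k \<Rightarrow> 'v \<Rightarrow> 'v) \<Rightarrow> 'v \<Rightarrow> (nat \<Rightarrow> 'k) \<Rightarrow> nat \<Rightarrow> 'v" where
  "dp_tensor s v f = (\<lambda>i. s (f i) v)"

text \<open>
  For a bilinear map \<open>m\<close> this is the map \<open>(a \<otimes> f, b \<otimes> g) \<mapsto> m a b \<otimes> f g\<close>, where
  \<open>x\<^sup>(\<^sup>i\<^sup>) x\<^sup>(\<^sup>j\<^sup>) = (i + j choose i) x\<^sup>(\<^sup>i\<^sup>+\<^sup>j\<^sup>)\<close> and \<open>x\<^sup>(\<^sup>k\<^sup>) = 0\<close> for \<open>k \<ge> 3^n\<close>;
  \<open>s\<close> is the scalar multiplication of the target of \<open>m\<close>.
\<close>

definition dp_prod ::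
  "nat \<Rightarrow> ('k::field \<Rightarrow> 'c::ab_group_add \<Rightarrow> 'c) \<Rightarrow> ('a \<Rightarrow> 'b \<Rightarrow> 'c) \<Rightarrow> (nat \<Rightarrow> 'a) \<Rightarrow> (nat \<Rightarrow> 'b) \<Rightarrow> nat \<Rightarrow> 'c"
where
  "dp_prod n s m F G =
     (\<lambda>k. if k < 3^n then \<Sum>i\<le>k. s (of_nat (k choose i)) (m (F i) (G (k - i))) else 0)"

abbreviation dp_mult :: "nat \<Rightarrow> (nat \<Rightarrow> 'k::field) \<Rightarrow> (nat \<Rightarrow> 'k) \<Rightarrow> nat \<Rightarrow> 'k" where
  "dp_mult n \<equiv> dp_prod n (*) (*)"

text \<open>The derivation \<open>\<partial>\<close>, with \<open>\<partial> x\<^sup>(\<^sup>i\<^sup>) = x\<^sup>(\<^sup>i\<^sup>-\<^sup>1\<^sup>)\<close>, shifts coefficients down.\<close>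

definition dp_deriv :: "(nat \<Rightarrow> 'v) \<Rightarrow> nat \<Rightarrow> 'v" where
  "dp_deriv F = (\<lambda>i. F (Suc i))"

lemma dp_basis_mult:
  assumes "i < 3^n" "j < 3^n"
  shows "dp_mult n (dp_basis i) (dp_basis j) =
    (if i + j < 3^n then fun_scale (*) (of_nat (i + j choose i)) (dp_basis (i + j)) else (0 :: nat \<Rightarrow> 'k::field))"
proof (rule ext)
  fix k
  have "(\<Sum>l\<le>k. of_nat (k choose l) * (dp_basis i l * dp_basis j (k - l)) :: 'k) =
        (\<Sum>l\<le>k. if l = i then (if k = i + j then of_nat (k choose i) else 0) else 0)"
    by (rule sum.cong) (auto simp: dp_basis_def)
  also have "\<dots> = (if k = i + j then of_nat (k choose i) else 0)"
    by (auto simp: sum.delta)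
  finally show "dp_mult n (dp_basis i) (dp_basis j) k =
    (if i + j < 3^n then fun_scale (*) (of_nat (i + j choose i)) (dp_basis (i + j)) else (0 :: nat \<Rightarrow> 'k)) k"
    by (auto simp: dp_prod_def fun_scale_def dp_basis_def)
qed

lemma dp_deriv_basis:
  "dp_deriv (dp_basis i) = (if i = 0 then 0 else dp_basis (i - 1) :: nat \<Rightarrow> 'k::field)"
  by (auto simp: dp_deriv_def dp_basis_def fun_eq_iff)

lemma dp_prod_tensor:
  assumes "vector_space s"
    and "\<And>a b. m (s1 a x) (s2 b y) = s (a * b) (m x y)"
  shows "dp_prod n s m (dp_tensor s1 x f) (dp_tensor s2 y g) = dp_tensor s (m x y) (dp_mult n f g)"
proof -
  interpret vector_space s by fact
  show ?thesis
    by (auto simp: fun_eq_iff dp_prod_def dp_tensor_def assms(2) scale_sum_left)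
qed


lemma sum_fun_apply: "(\<Sum>a\<in>A. F a) i = (\<Sum>a\<in>A. F a i :: 'v::comm_monoid_add)"
  by (induction A rule: infinite_finite_induct) auto

lemma dp_prod_zero:
  assumes "vector_space s"
  shows "(\<And>y. m 0 y = 0) \<Longrightarrow> dp_prod n s m 0 G = 0" "(\<And>x. m x 0 = 0) \<Longrightarrow> dp_prod n s m F 0 = 0"
proof -
  interpret vector_space s by fact
  show "(\<And>y. m 0 y = 0) \<Longrightarrow> dp_prod n s m 0 G = 0" "(\<And>x. m x 0 = 0) \<Longrightarrow> dp_prod n s m F 0 = 0"
    by (auto simp: dp_prod_def fun_eq_iff)
qed

lemma dp_deriv_tensor: "dp_deriv (dp_tensor s x f) = dp_tensor s x (dp_deriv f)"
  by (simp add: dp_deriv_def dp_tensor_def)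

lemma dp_deriv_zero: "dp_deriv 0 = 0"
  by (simp add: dp_deriv_def fun_eq_iff)

lemma vector_space_fun_scale: "vector_space s \<Longrightarrow> vector_space (fun_scale s)"
  by (auto simp: vector_space_def fun_scale_def fun_eq_iff)


section \<open>The Frank algebra\<close>

definition sl :: "('k::field \<Rightarrow> 'u::ab_group_add \<Rightarrow> 'u) \<Rightarrow> ('u \<Rightarrow> 'u) set" where
  "sl s = {a. Vector_Spaces.linear s s a \<and> lin_trace s UNIV a = 0}"

definition symplectic_plane :: "('k::field \<Rightarrow> 'u::ab_group_add \<Rightarrow> 'u) \<Rightarrow> ('u \<Rightarrow> 'u \<Rightarrow> 'k) \<Rightarrow> bool" where
  "symplectic_plane s lam \<longleftrightarrow>
     vector_space s \<and> vector_space.dim s UNIV = 2 \<and>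
     (\<forall>x. Vector_Spaces.linear s (*) (lam x)) \<and>
     (\<forall>y. Vector_Spaces.linear s (*) (\<lambda>x. lam x y)) \<and>
     (\<forall>x y. lam x y = - lam y x) \<and>
     (\<forall>x. (\<forall>y. lam x y = 0) \<longrightarrow> x = 0)"

definition frank_phi :: "('k::field \<Rightarrow> 'u::ab_group_add \<Rightarrow> 'u) \<Rightarrow> ('u \<Rightarrow> 'u \<Rightarrow> 'k) \<Rightarrow> 'u \<Rightarrow> 'u \<Rightarrow> 'u \<Rightarrow> 'u" where
  "frank_phi s lam x y = (\<lambda>z. s (lam x z) y + s (lam y z) x)"

type_synonym ('k, 'u) frank = "(nat \<Rightarrow> 'u) \<times> (nat \<Rightarrow> 'u \<Rightarrow> 'u) \<times> (nat \<Rightarrow> 'k)"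

text \<open>
  A triple \<open>(p, A, f)\<close> stands for \<open>p + A + Id \<otimes> f\<partial>\<close> with \<open>p \<in> U \<otimes> \<O>\<^bsub>(div)\<^esub>\<close>,
  \<open>A \<in> sl(U) \<otimes> \<O>\<close> and \<open>f \<in> \<O>\<close>.
\<close>

definition frank_carrier :: "nat \<Rightarrow> ('k::field \<Rightarrow> 'u::ab_group_add \<Rightarrow> 'u) \<Rightarrow> ('k, 'u) frank set" where
  "frank_carrier n s = dp_space n UNIV \<times> dp_space n (sl s) \<times> dp_space n UNIV"

definition frank_scale :: "('k::field \<Rightarrow> 'u::ab_group_add \<Rightarrow> 'u) \<Rightarrow> 'k \<Rightarrow> ('k, 'u) frank \<Rightarrow> ('k, 'u) frank" where
  "frank_scale s = prod_scale (fun_scale s) (prod_scale (fun_scale (fun_scale s)) (fun_scale (*)))"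

fun frank_bracket ::
  "nat \<Rightarrow> ('k::field \<Rightarrow> 'u::ab_group_add \<Rightarrow> 'u) \<Rightarrow> ('u \<Rightarrow> 'u \<Rightarrow> 'k) \<Rightarrow>
   ('k, 'u) frank \<Rightarrow> ('k, 'u) frank \<Rightarrow> ('k, 'u) frank"
where
  "frank_bracket n s lam (p, A, f) (q, B, g) =
     (dp_deriv (dp_prod n s s f q) - dp_deriv (dp_prod n s s g p)
        + dp_prod n s (\<lambda>a x. a x) A q - dp_prod n s (\<lambda>b x. b x) B p,
      dp_prod n (fun_scale s) (\<lambda>a b. (a \<circ> b) - (b \<circ> a)) A B
        + dp_prod n (fun_scale s) (fun_scale s) f (dp_deriv B)
        - dp_prod n (fun_scale s) (fun_scale s) g (dp_deriv A)
        + dp_prod n (fun_scale s) (frank_phi s lam) p (dp_deriv q)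
        - dp_prod n (fun_scale s) (frank_phi s lam) (dp_deriv p) q,
      dp_mult n f (dp_deriv g) - dp_mult n g (dp_deriv f) + dp_prod n (*) lam p q)"

text \<open>
  On pure tensors this gives the usual presentation; the remaining brackets follow
  by anti-commutativity.
\<close>

lemma frank_bracket_tensors:
  fixes s :: "'k::field \<Rightarrow> 'u::ab_group_add \<Rightarrow> 'u"
  assumes "symplectic_plane s lam" and "a \<in> sl s" and "b \<in> sl s"
  defines "iU \<equiv> \<lambda>x f. (dp_tensor s x f, 0, 0) :: ('k, 'u) frank"
    and "iS \<equiv> \<lambda>a f. (0, dp_tensor (fun_scale s) a f, 0) :: ('k, 'u) frank"
    and "iW \<equiv> \<lambda>f. (0, 0, f) :: ('k, 'u) frank"
  shows
    "frank_bracket n s lam (iW f) (iW g) = iW (dp_mult n f (dp_deriv g) - dp_mult n g (dp_deriv f))"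
    "frank_bracket n s lam (iS a f) (iS b g) = iS ((a \<circ> b) - (b \<circ> a)) (dp_mult n f g)"
    "frank_bracket n s lam (iW f) (iS a g) = iS a (dp_mult n f (dp_deriv g))"
    "frank_bracket n s lam (iW f) (iU x g) = iU x (dp_deriv (dp_mult n f g))"
    "frank_bracket n s lam (iS a f) (iU x g) = iU (a x) (dp_mult n f g)"
    "frank_bracket n s lam (iU x f) (iU y g) =
       iS (frank_phi s lam x y) (dp_mult n f (dp_deriv g) - dp_mult n g (dp_deriv f))
       + iW (fun_scale (*) (lam x y) (dp_mult n f g))"
proof -
  from assms(1) have vs: "vector_space s"
    and l1: "\<And>x. Vector_Spaces.linear s (*) (lam x)"
    and l2: "\<And>y. Vector_Spaces.linear s (*) (\<lambda>x. lam x y)"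
    unfolding symplectic_plane_def by blast+
  interpret vector_space s by fact
  note vs' = vector_space_fun_scale[OF vs]
  have vk: "vector_space ((*) :: 'k \<Rightarrow> 'k \<Rightarrow> 'k)"
    by unfold_locales (auto simp: algebra_simps)
  from assms(2,3) have la: "Vector_Spaces.linear s s a" and lb: "Vector_Spaces.linear s s b"
    by (auto simp: sl_def)
  interpret A: Vector_Spaces.linear s s a by fact
  interpret B: Vector_Spaces.linear s s b by fact
  have lam_simps [simp]: "lam 0 y = 0" "lam x 0 = 0" "lam (s c x) y = c * lam x y" "lam x (s c y) = c * lam x y"
    for x y c
  proof -
    interpret L1: Vector_Spaces.linear s "(*)" "lam x" by (rule l1)
    interpret L2: Vector_Spaces.linear s "(*)" "\<lambda>x. lam x y" by (rule l2)
    show "lam 0 y = 0" "lam x 0 = 0" "lam (s c x) y = c * lam x y" "lam x (s c y) = c * lam x y"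
      using L1.zero L2.zero L1.scale L2.scale by auto
  qed
  have phi_simps [simp]: "frank_phi s lam 0 y = 0" "frank_phi s lam x 0 = 0" for x y
    by (auto simp: frank_phi_def fun_eq_iff)
  have z [simp]: "dp_tensor s x 0 = 0" "dp_tensor (fun_scale s) a 0 = 0" for x a
    by (auto simp: dp_tensor_def fun_scale_def fun_eq_iff)
  have fun_scale_zero [simp]: "fun_scale s c 0 = 0" "fun_scale s 0 F = 0" for c F
    by (auto simp: fun_scale_def fun_eq_iff)
  have zeros [simp]:
    "dp_mult n 0 g = 0" "dp_mult n f 0 = 0"
    "dp_prod n s s 0 q = 0" "dp_prod n s s f 0 = 0"
    "dp_prod n (fun_scale s) (fun_scale s) 0 A = 0" "dp_prod n (fun_scale s) (fun_scale s) f 0 = 0"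
    "dp_prod n s (\<lambda>a x. a x) 0 q = 0"
    "dp_prod n (*) lam 0 q = 0" "dp_prod n (*) lam q 0 = 0"
    "dp_prod n (fun_scale s) (frank_phi s lam) 0 q = 0" "dp_prod n (fun_scale s) (frank_phi s lam) q 0 = 0"
    for f g :: "nat \<Rightarrow> 'k" and q A
    by (auto intro!: dp_prod_zero[OF vk] dp_prod_zero[OF vs] dp_prod_zero[OF vs'])
  have zeroA: "dp_prod n s (\<lambda>a x. a x) (dp_tensor (fun_scale s) a f) 0 = 0"
    "dp_prod n s (\<lambda>a x. a x) (dp_tensor (fun_scale s) b f) 0 = 0" for f
    by (auto simp: dp_prod_def dp_tensor_def fun_scale_def fun_eq_iff sum_fun_apply A.zero B.zero)
  have zeroC: "dp_prod n (fun_scale s) (\<lambda>a b. (a \<circ> b) - (b \<circ> a)) 0 0 = 0"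
    "dp_prod n (fun_scale s) (\<lambda>a b. (a \<circ> b) - (b \<circ> a)) 0 (dp_tensor (fun_scale s) a f) = 0"
    "dp_prod n (fun_scale s) (\<lambda>a b. (a \<circ> b) - (b \<circ> a)) (dp_tensor (fun_scale s) a f) 0 = 0" for f
    by (auto simp: dp_prod_def dp_tensor_def fun_scale_def fun_eq_iff sum_fun_apply A.zero)
  have tensor_add: "dp_tensor (fun_scale s) a f - dp_tensor (fun_scale s) a g = dp_tensor (fun_scale s) a (f - g)" for a f g
    by (auto simp: dp_tensor_def fun_scale_def fun_eq_iff scale_left_diff_distrib)
  have mult_comm: "dp_mult n f g = dp_mult n g f" for f g :: "nat \<Rightarrow> 'k"
  proof (rule ext)
    fix k
    have "(\<Sum>i\<le>k. of_nat (k choose i) * (f i * g (k - i))) = (\<Sum>i\<le>k. of_nat (k choose i) * (g i * f (k - i)))"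
      by (rule sum.reindex_bij_witness[of _ "\<lambda>i. k - i" "\<lambda>i. k - i"])
         (auto simp: mult.commute binomial_symmetric[symmetric])
    then show "dp_mult n f g k = dp_mult n g f k" by (simp add: dp_prod_def)
  qed
  have t1: "dp_prod n s s f (dp_tensor s x g) = dp_tensor s x (dp_mult n f g)" for f g x
    by (auto simp: dp_prod_def dp_tensor_def fun_eq_iff scale_sum_left)
  have t2: "dp_prod n (fun_scale s) (fun_scale s) f (dp_tensor (fun_scale s) a g) = dp_tensor (fun_scale s) a (dp_mult n f g)" for f g a
    by (auto simp: dp_prod_def dp_tensor_def fun_scale_def fun_eq_iff sum_fun_apply scale_sum_left)
  have t3: "dp_prod n s (\<lambda>a x. a x) (dp_tensor (fun_scale s) a f) (dp_tensor s x g) = dp_tensor s (a x) (dp_mult n f g)" for f g x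
    by (rule dp_prod_tensor[OF vs]) (simp add: fun_scale_def A.scale)
  have t4: "dp_prod n (fun_scale s) (\<lambda>a b. (a \<circ> b) - (b \<circ> a)) (dp_tensor (fun_scale s) a f) (dp_tensor (fun_scale s) b g)
      = dp_tensor (fun_scale s) ((a \<circ> b) - (b \<circ> a)) (dp_mult n f g)" for f g
    by (rule dp_prod_tensor[OF vs'])
       (simp add: fun_scale_def A.scale B.scale fun_eq_iff scale_right_diff_distrib mult.commute)
  have t5: "dp_prod n (fun_scale s) (frank_phi s lam) (dp_tensor s x f) (dp_tensor s y g)
      = dp_tensor (fun_scale s) (frank_phi s lam x y) (dp_mult n f g)" for f g x y
    by (rule dp_prod_tensor[OF vs'])
       (simp add: fun_scale_def frank_phi_def fun_eq_iff scale_right_distrib mult_ac)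
  have t6: "dp_prod n (*) lam (dp_tensor s x f) (dp_tensor s y g) = dp_tensor (*) (lam x y) (dp_mult n f g)" for f g x y
    by (rule dp_prod_tensor[OF vk]) simp
  note simps = iU_def iS_def iW_def dp_deriv_zero dp_deriv_tensor zeroA zeroC t1 t2 t3 t4 t5 t6
  show "frank_bracket n s lam (iW f) (iW g) = iW (dp_mult n f (dp_deriv g) - dp_mult n g (dp_deriv f))"
    by (simp add: simps)
  show "frank_bracket n s lam (iS a f) (iS b g) = iS ((a \<circ> b) - (b \<circ> a)) (dp_mult n f g)"
    by (simp add: simps)
  show "frank_bracket n s lam (iW f) (iS a g) = iS a (dp_mult n f (dp_deriv g))"
    by (simp add: simps)
  show "frank_bracket n s lam (iW f) (iU x g) = iU x (dp_deriv (dp_mult n f g))"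
    by (simp add: simps)
  show "frank_bracket n s lam (iS a f) (iU x g) = iU (a x) (dp_mult n f g)"
    by (simp add: simps)
  show "frank_bracket n s lam (iU x f) (iU y g) =
       iS (frank_phi s lam x y) (dp_mult n f (dp_deriv g) - dp_mult n g (dp_deriv f))
       + iW (fun_scale (*) (lam x y) (dp_mult n f g))"
    by (simp add: simps tensor_add mult_comm[of g])
       (simp add: dp_tensor_def fun_scale_def mult.commute)
qed


section \<open>Lie algebras in the category of representations of \<open>\<alpha>\<^sub>3\<close>\<close>

record ('k, 'v) rep =
  scl :: "'k \<Rightarrow> 'v \<Rightarrow> 'v"
  car :: "'v set"
  der :: "'v \<Rightarrow> 'v"

record ('k, 'v) alg_rep = "('k, 'v) rep" +
  mul :: "'v \<Rightarrow> 'v \<Rightarrow> 'v"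

definition alpha3_rep :: "('k::field, 'v::ab_group_add, 'z) rep_scheme \<Rightarrow> bool" where
  "alpha3_rep X \<longleftrightarrow>
     vector_space (scl X) \<and> module.subspace (scl X) (car X) \<and>
     (\<exists>B. finite B \<and> B \<subseteq> car X \<and> module.span (scl X) B = car X) \<and>
     linmap (scl X) (car X) (scl X) (car X) (der X) \<and>
     (\<forall>x\<in>car X. der X (der X (der X x)) = 0)"

definition rep_hom ::
  "('k::field, 'v::ab_group_add, 'y) rep_scheme \<Rightarrow> ('k, 'w::ab_group_add, 'z) rep_scheme \<Rightarrow> ('v \<Rightarrow> 'w) \<Rightarrow> bool"
where
  "rep_hom X Y f \<longleftrightarrow>
     linmap (scl X) (car X) (scl Y) (car Y) f \<and> (\<forall>x\<in>car X. f (der X x) = der Y (f x))"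

definition rep_iso ::
  "('k::field, 'v::ab_group_add, 'y) rep_scheme \<Rightarrow> ('k, 'w::ab_group_add, 'z) rep_scheme \<Rightarrow> ('v \<Rightarrow> 'w) \<Rightarrow> bool"
where
  "rep_iso X Y f \<longleftrightarrow> rep_hom X Y f \<and> bij_betw f (car X) (car Y)"

definition negligible ::
  "('k::field, 'v::ab_group_add, 'y) rep_scheme \<Rightarrow> ('k, 'w::ab_group_add, 'z) rep_scheme \<Rightarrow> ('v \<Rightarrow> 'w) \<Rightarrow> bool"
where
  "negligible X Y f \<longleftrightarrow>
     rep_hom X Y f \<and> (\<forall>g. rep_hom Y X g \<longrightarrow> lin_trace (scl Y) (car Y) (f \<circ> g) = 0)"

definition lie_alg_rep :: "('k::field, 'v::ab_group_add, 'z) alg_rep_scheme \<Rightarrow> bool" where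
  "lie_alg_rep A \<longleftrightarrow>
     alpha3_rep A \<and>
     (\<forall>x\<in>car A. linmap (scl A) (car A) (scl A) (car A) (mul A x)) \<and>
     (\<forall>y\<in>car A. linmap (scl A) (car A) (scl A) (car A) (\<lambda>x. mul A x y)) \<and>
     (\<forall>x\<in>car A. mul A x x = 0) \<and>
     (\<forall>x\<in>car A. \<forall>y\<in>car A. \<forall>z\<in>car A.
        mul A x (mul A y z) + mul A y (mul A z x) + mul A z (mul A x y) = 0) \<and>
     (\<forall>x\<in>car A. \<forall>y\<in>car A. der A (mul A x y) = mul A (der A x) y + mul A x (der A y))"

definition frank ::
  "nat \<Rightarrow> ('k::field \<Rightarrow> 'u::ab_group_add \<Rightarrow> 'u) \<Rightarrow> ('u \<Rightarrow> 'u \<Rightarrow> 'k) \<Rightarrow> ('u \<Rightarrow> 'u) \<Rightarrow>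
   ('k, ('k, 'u) frank) alg_rep"
where
  "frank n s lam e =
     \<lparr>scl = frank_scale s,
      car = frank_carrier n s,
      der = frank_bracket n s lam (0, dp_tensor (fun_scale s) e (dp_basis 0), 0),
      mul = frank_bracket n s lam\<rparr>"


section \<open>Superalgebras and semisimplification\<close>

record ('k, 'v) superalg =
  sscl :: "'k \<Rightarrow> 'v \<Rightarrow> 'v"
  evn :: "'v set"
  odd_part :: "'v set"
  smul :: "'v \<Rightarrow> 'v \<Rightarrow> 'v"

definition scar :: "('k, 'v::ab_group_add, 'z) superalg_scheme \<Rightarrow> 'v set" where
  "scar S = {x + y |x y. x \<in> evn S \<and> y \<in> odd_part S}"

definition superalgebra :: "('k::field, 'v::ab_group_add, 'z) superalg_scheme \<Rightarrow> bool" where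
  "superalgebra S \<longleftrightarrow>
     vector_space (sscl S) \<and>
     module.subspace (sscl S) (evn S) \<and> module.subspace (sscl S) (odd_part S) \<and>
     evn S \<inter> odd_part S = {0} \<and>
     (\<forall>x\<in>scar S. linmap (sscl S) (scar S) (sscl S) (scar S) (smul S x)) \<and>
     (\<forall>y\<in>scar S. linmap (sscl S) (scar S) (sscl S) (scar S) (\<lambda>x. smul S x y)) \<and>
     (\<forall>x\<in>evn S. \<forall>y\<in>evn S. smul S x y \<in> evn S) \<and>
     (\<forall>x\<in>evn S. \<forall>y\<in>odd_part S. smul S x y \<in> odd_part S) \<and>
     (\<forall>x\<in>odd_part S. \<forall>y\<in>evn S. smul S x y \<in> odd_part S) \<and>
     (\<forall>x\<in>odd_part S. \<forall>y\<in>odd_part S. smul S x y \<in> evn S)"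

definition superalg_isomorphic ::
  "('k::field, 'v::ab_group_add, 'y) superalg_scheme \<Rightarrow> ('k, 'w::ab_group_add, 'z) superalg_scheme \<Rightarrow> bool"
where
  "superalg_isomorphic S T \<longleftrightarrow>
     (\<exists>h. linmap (sscl S) (scar S) (sscl T) (scar T) h \<and> bij_betw h (scar S) (scar T) \<and>
          h ` evn S = evn T \<and> h ` odd_part S = odd_part T \<and>
          (\<forall>x\<in>scar S. \<forall>y\<in>scar S. h (smul S x y) = smul T (h x) (h y)))"

text \<open>
  The representations \<open>(1) \<otimes> M\<close>, \<open>(2) \<otimes> M\<close>, \<open>(3) \<otimes> M\<close> for a vector space \<open>M\<close>. The pair
  \<open>(x, y)\<close> stands for \<open>u \<otimes> x + v \<otimes> y\<close> with \<open>d v = u\<close>, \<open>d u = 0\<close>, and the triple \<open>(x, y, z)\<close>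
  for \<open>e\<^sub>1 \<otimes> x + e\<^sub>2 \<otimes> y + e\<^sub>3 \<otimes> z\<close>.
\<close>

definition tensor1 :: "('k \<Rightarrow> 'm \<Rightarrow> 'm) \<Rightarrow> 'm::zero set \<Rightarrow> ('k, 'm) rep" where
  "tensor1 s M = \<lparr>scl = s, car = M, der = (\<lambda>_. 0)\<rparr>"

definition tensor2 :: "('k \<Rightarrow> 'm \<Rightarrow> 'm) \<Rightarrow> 'm::zero set \<Rightarrow> ('k, 'm \<times> 'm) rep" where
  "tensor2 s M = \<lparr>scl = prod_scale s s, car = M \<times> M, der = (\<lambda>(x, y). (y, 0))\<rparr>"

definition tensor3 :: "('k \<Rightarrow> 'm \<Rightarrow> 'm) \<Rightarrow> 'm::zero set \<Rightarrow> ('k, 'm \<times> 'm \<times> 'm) rep" where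
  "tensor3 s M =
     \<lparr>scl = prod_scale s (prod_scale s s), car = M \<times> M \<times> M, der = (\<lambda>(x, y, z). (0, x, y))\<rparr>"

abbreviation J2 :: "('k::field, 'k \<times> 'k) rep" where
  "J2 \<equiv> tensor2 (*) UNIV"

definition J2_u :: "'k::field \<times> 'k" where "J2_u = (1, 0)"

definition J2_v :: "'k::field \<times> 'k" where "J2_v = (0, 1)"

definition pure2 :: "('k \<Rightarrow> 'm \<Rightarrow> 'm) \<Rightarrow> 'k \<times> 'k \<Rightarrow> 'm \<Rightarrow> 'm \<times> 'm" where
  "pure2 s z x = (s (fst z) x, s (snd z) x)"

definition rep_sum :: "('k, 'v) rep \<Rightarrow> ('k, 'w) rep \<Rightarrow> ('k, 'v \<times> 'w) rep" where
  "rep_sum X Y =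
     \<lparr>scl = prod_scale (scl X) (scl Y), car = car X \<times> car Y, der = map_prod (der X) (der Y)\<rparr>"

text \<open>
  \<open>S\<close> is the superalgebra obtained from the Lie algebra \<open>A\<close> through the decomposition
  \<open>J : (1) \<otimes> S\<^sub>0 \<oplus> (2) \<otimes> S\<^sub>1 \<oplus> (3) \<otimes> L\<^sub>2 \<cong> A\<close>. Here \<open>one a\<close> and \<open>two z o\<close> are \<open>1 \<otimes> a\<close> and \<open>z \<otimes> o\<close>
  in \<open>A\<close>, while \<open>pr0\<close> and \<open>pr1\<close> are the projections to \<open>S\<^sub>0\<close> and \<open>(2) \<otimes> S\<^sub>1\<close>. The odd-even
  product is determined by super-anticommutativity.
\<close>

definition semisimplification_via ::
  "('k::field, 'v::ab_group_add) alg_rep \<Rightarrow> ('k, 's::ab_group_add) superalg \<Rightarrow> 'v set \<Rightarrow>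
   ('s \<times> ('s \<times> 's) \<times> ('v \<times> 'v \<times> 'v) \<Rightarrow> 'v) \<Rightarrow> bool"
where
  "semisimplification_via A S L2 J \<longleftrightarrow>
     (let D = rep_sum (tensor1 (sscl S) (evn S))
                (rep_sum (tensor2 (sscl S) (odd_part S)) (tensor3 (scl A) L2));
          one = (\<lambda>a. J (a, 0, 0));
          two = (\<lambda>z x. J (0, pure2 (sscl S) z x, 0));
          pr0 = (\<lambda>w. fst (inv_into (car D) J w));
          pr1 = (\<lambda>w. fst (snd (inv_into (car D) J w)))
      in module.subspace (scl A) L2 \<and> rep_iso D A J \<and>
         (\<forall>a\<in>evn S. \<forall>b\<in>evn S. smul S a b = pr0 (mul A (one a) (one b))) \<and>
         (\<forall>a\<in>evn S. \<forall>x\<in>odd_part S.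
            negligible J2 (tensor2 (sscl S) (odd_part S))
              (\<lambda>z. pr1 (mul A (one a) (two z x)) - pure2 (sscl S) z (smul S a x))) \<and>
         (\<forall>a\<in>evn S. \<forall>x\<in>odd_part S. smul S x a = - smul S a x) \<and>
         (\<forall>x\<in>odd_part S. \<forall>y\<in>odd_part S.
            smul S x y = pr0 (mul A (two J2_u x) (two J2_v y) - mul A (two J2_v x) (two J2_u y))))"

definition is_semisimplification ::
  "('k::field, 'v::ab_group_add) alg_rep \<Rightarrow> ('k, 's::ab_group_add) superalg \<Rightarrow> bool"
where
  "is_semisimplification A S \<longleftrightarrow> superalgebra S \<and> (\<exists>L2 J. semisimplification_via A S L2 J)"


section \<open>The contact superalgebra\<close>

text \<open>A pair \<open>(f, g)\<close> stands for \<open>f + g\<theta>\<close> in \<open>\<O>(1,1;n) = \<O> \<otimes> \<Lambda>(1)\<close>.\<close>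

type_synonym 'k sfun = "(nat \<Rightarrow> 'k) \<times> (nat \<Rightarrow> 'k)"

definition sfuns :: "nat \<Rightarrow> 'k::zero sfun set" where
  "sfuns n = dp_space n UNIV \<times> dp_space n UNIV"

definition sfun_scale :: "'k::field \<Rightarrow> 'k sfun \<Rightarrow> 'k sfun" where
  "sfun_scale = prod_scale (fun_scale (*)) (fun_scale (*))"

fun sfun_mult :: "nat \<Rightarrow> 'k::field sfun \<Rightarrow> 'k sfun \<Rightarrow> 'k sfun" where
  "sfun_mult n (f, g) (f', g') = (dp_mult n f f', dp_mult n f g' + dp_mult n g f')"

definition d_x :: "'k::field sfun \<Rightarrow> 'k sfun" where
  "d_x h = (dp_deriv (fst h), dp_deriv (snd h))"

definition d_theta :: "'k::field sfun \<Rightarrow> 'k sfun" where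
  "d_theta h = (snd h, 0)"

text \<open>
  Endomorphisms of \<open>\<O>(1,1;n)\<close> are represented by functions that vanish outside of it, so
  that equality of functions is equality of endomorphisms.
\<close>

definition restrict_sfuns :: "nat \<Rightarrow> ('k::field sfun \<Rightarrow> 'k sfun) \<Rightarrow> 'k sfun \<Rightarrow> 'k sfun" where
  "restrict_sfuns n T = (\<lambda>h. if h \<in> sfuns n then T h else 0)"

text \<open>The superderivation \<open>F\<partial> + G\<partial>\<^sub>\<theta>\<close>.\<close>

definition superder :: "nat \<Rightarrow> 'k::field sfun \<Rightarrow> 'k sfun \<Rightarrow> 'k sfun \<Rightarrow> 'k sfun" where
  "superder n F G = restrict_sfuns n (\<lambda>h. sfun_mult n F (d_x h) + sfun_mult n G (d_theta h))"

definition even_comp :: "nat \<Rightarrow> ('k::field sfun \<Rightarrow> 'k sfun) \<Rightarrow> 'k sfun \<Rightarrow> 'k sfun" where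
  "even_comp n T = restrict_sfuns n (\<lambda>h. (fst (T (fst h, 0)), snd (T (0, snd h))))"

definition odd_comp :: "nat \<Rightarrow> ('k::field sfun \<Rightarrow> 'k sfun) \<Rightarrow> 'k sfun \<Rightarrow> 'k sfun" where
  "odd_comp n T = restrict_sfuns n (\<lambda>h. (fst (T (0, snd h)), snd (T (fst h, 0))))"

text \<open>
  The bilinear extension of \<open>[T, T'] = T T' - (-1)\<^bsup>|T||T'|\<^esup> T' T\<close> from homogeneous endomorphisms.
\<close>

definition supercomm ::
  "nat \<Rightarrow> ('k::field sfun \<Rightarrow> 'k sfun) \<Rightarrow> ('k sfun \<Rightarrow> 'k sfun) \<Rightarrow> 'k sfun \<Rightarrow> 'k sfun"
where
  "supercomm n T T' =
     (\<lambda>h. T (T' h) - even_comp n T' (even_comp n T h) - even_comp n T' (odd_comp n T h)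
          - odd_comp n T' (even_comp n T h) + odd_comp n T' (odd_comp n T h))"

definition witt_super :: "nat \<Rightarrow> ('k::field sfun \<Rightarrow> 'k sfun) set" where
  "witt_super n = {superder n F G |F G. F \<in> sfuns n \<and> G \<in> sfuns n}"

definition witt_subalgebra :: "nat \<Rightarrow> ('k::field sfun \<Rightarrow> 'k sfun) set \<Rightarrow> bool" where
  "witt_subalgebra n V \<longleftrightarrow>
     V \<subseteq> witt_super n \<and> module.subspace (fun_scale sfun_scale) V \<and>
     (\<forall>T\<in>V. \<forall>T'\<in>V. supercomm n T T' \<in> V)"

text \<open>\<open>D\<^sub>K(f + g\<theta>) = (2f + g\<theta>)\<partial> + (g + \<partial>(f)\<theta>)\<partial>\<^sub>\<theta>\<close>\<close>

definition D_K :: "nat \<Rightarrow> 'k::field sfun \<Rightarrow> 'k sfun \<Rightarrow> 'k sfun" where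
  "D_K n h = superder n (fst h + fst h, snd h) (snd h, dp_deriv (fst h))"

lemma D_K_x:
  shows "D_K n (dp_basis i, 0) =
    superder n (fun_scale (*) 2 (dp_basis i), 0) (0, if i = 0 then 0 else dp_basis (i - 1) :: nat \<Rightarrow> 'k::field)"
proof -
  have "dp_basis i + dp_basis i = fun_scale (*) 2 (dp_basis i :: nat \<Rightarrow> 'k)"
    by (simp add: fun_scale_def fun_eq_iff)
  then show ?thesis by (simp add: D_K_def dp_deriv_basis)
qed

lemma D_K_x_theta: "D_K n (0, dp_basis i) = superder n (0, dp_basis i) (dp_basis i, 0 :: nat \<Rightarrow> 'k::field)"
  by (simp add: D_K_def dp_deriv_zero)

definition contact_carrier :: "nat \<Rightarrow> ('k::field sfun \<Rightarrow> 'k sfun) set" where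
  "contact_carrier n = witt_subalgebra n hull (D_K n ` sfuns n)"

definition contact :: "nat \<Rightarrow> ('k::field, 'k sfun \<Rightarrow> 'k sfun) superalg" where
  "contact n =
     \<lparr>sscl = fun_scale sfun_scale,
      evn = {T \<in> contact_carrier n. odd_comp n T = 0},
      odd_part = {T \<in> contact_carrier n. even_comp n T = 0},
      smul = supercomm n\<rparr>"

end

theory Submission
  imports Defs
begin

text \<open>
  Why the theorem holds. In characteristic 3 the operator \<open>d = ad (e \<otimes> 1)\<close> makes \<open>sl(U)\<close> a single
  block \<open>(3)\<close>, namely \<open>f \<mapsto> h \<mapsto> -2e = e\<close>, while \<open>U\<close> is the block \<open>(2)\<close> and \<open>d\<close> kills
  \<open>Id \<otimes> W\<close> because \<open>D(1) = 0\<close>. Hence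
  \<open>\<F>(n) = (1) \<otimes> W \<oplus> (2) \<otimes> \<O>\<^bsub>(div)\<^esub> \<oplus> (3) \<otimes> \<O>\<close>, and the block \<open>(3)\<close> disappears. What survives is
  \<open>W\<close> in even degree, acting on \<open>\<O>\<^bsub>(div)\<^esub>\<close> in odd degree by \<open>f\<partial> \<cdot> g = \<partial>(f g)\<close>, with odd product
  \<open>[g, g'] = 2 g g' \<partial>\<close>, which comes from \<open>[u \<otimes> g, v \<otimes> g'] - [v \<otimes> g, u \<otimes> g']\<close>.
  The map \<open>f\<partial> \<mapsto> D\<^sub>K(2f)\<close>, \<open>g \<mapsto> D\<^sub>K(g\<theta>)\<close> is an isomorphism from this superalgebra onto \<open>K(1,1;n)\<close>.
  The point is that \<open>[D\<^sub>K(f), D\<^sub>K(g\<theta>)] = D\<^sub>K((2f\<partial>(g) - g\<partial>(f))\<theta>)\<close>, and \<open>2f\<partial>(g) - g\<partial>(f) = 2\<partial>(f g)\<close>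
  since \<open>-1 = 2\<close>. In particular the image of \<open>D\<^sub>K\<close> is already closed under the
  supercommutator, so it is all of \<open>K(1,1;n)\<close> (\<open>contact_carrier_eq\<close>).

  A decomposition into blocks is not unique, so one also has to see that it does not affect the
  superalgebra. This is because the multiplicity spaces are subquotients of the representation,
  \<open>L\<^sub>0 \<cong> ker d / (ker d \<inter> im d)\<close> and \<open>L\<^sub>1 \<cong> (ker d \<inter> im d) / im d\<^sup>2\<close>,
  and because the products can be written in terms of these subquotients
  (\<open>semisimplification_subquotient_model\<close>); two superalgebras that are described by the same
  subquotients are isomorphic (\<open>subquotient_model_unique\<close>). Negligible morphisms enter
  at one place only: a negligible map from \<open>(2)\<close> to \<open>(2) \<otimes> M\<close> kills the socle of \<open>(2)\<close>
  (\<open>negligible_J2_vanishes\<close>), which is the part that is visible in \<open>L\<^sub>1\<close>.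

  The identities in the two algebras are proved in coordinates. After a choice of basis of \<open>U\<close>
  and \<open>sl(U)\<close>, the Jacobi identity of the Frank algebra and the commutators of contact operators
  are differential polynomial identities over \<open>\<O>\<close>, valid over every commutative ring with a
  derivation in which \<open>3 = 0\<close> (\<open>frank_br_jacobi\<close>, \<open>contact_op_supercomm\<close>). To have such a ring as
  a type that does not depend on \<open>n\<close>, \<open>\<O>(1;n)\<close> is placed inside the ring of all divided power series, where
  it is a subring because the binomial coefficients that would lead out of it are divisible by 3
  (\<open>dp_mult_coeff\<close>).
\<close>

section \<open>Linear maps, traces and negligible morphisms\<close>

lemma linmapD:
  assumes "linmap s V t W f"
  shows linmap_mem: "\<And>x. x \<in> V \<Longrightarrow> f x \<in> W"
    and linmap_add: "\<And>x y. x \<in> V \<Longrightarrow> y \<in> V \<Longrightarrow> f (x + y) = f x + f y"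
    and linmap_scale: "\<And>c x. x \<in> V \<Longrightarrow> f (s c x) = t c (f x)"
  using assms by (auto simp: linmap_def)

lemma linmap_diff:
  assumes "linmap s V t W f" "x - y \<in> V" "y \<in> V"
  shows "f (x - y) = f x - f y"
  using linmap_add[OF assms] by simp

lemma linmap_zero:
  assumes "linmap s V t W f" "0 \<in> V"
  shows "f 0 = 0"
  using linmap_diff[OF assms(1), of 0 0] assms(2) by simp

lemma linmap_image_span:
  assumes "vector_space s" "vector_space t" "linmap s V t W f"
    and "module.span s C = V" "C \<subseteq> V"
  shows "f ` V \<subseteq> module.span t (f ` C)"
proof
  interpret S: vector_space s by fact
  interpret T: vector_space t by fact
  have "x \<in> V \<and> f x \<in> T.span (f ` C)" if "x \<in> S.span C" for x
    using that
  proof (induction rule: S.span_induct_alt)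
    case base
    have "0 \<in> V" using assms(4) S.span_zero[of C] by simp
    then show ?case using linmap_zero[OF assms(3)] by (simp add: T.span_zero)
  next
    case (step c x y)
    have "x \<in> V" "y \<in> V" "s c x \<in> V"
      using step assms(4) S.span_base[of x C] S.span_scale[of x C c] by auto
    then have "f (s c x + y) = t c (f x) + f y"
      by (simp add: linmapD[OF assms(3)])
    moreover have "t c (f x) \<in> T.span (f ` C)"
      using step by (intro T.span_scale T.span_base) simp
    moreover have "s c x + y \<in> V"
      using \<open>y \<in> V\<close> \<open>s c x \<in> V\<close> assms(4) S.span_add[of "s c x" C y] by simp
    ultimately show ?case using step by (simp add: T.span_add)
  qed
  then show "y \<in> T.span (f ` C)" if "y \<in> f ` V" for y
    using that assms(4) by auto
qed

text \<open>
  The trace of \<open>\<phi> \<otimes> w + \<psi> \<otimes> w'\<close> is \<open>\<phi>(w) + \<psi>(w')\<close> in any basis. This covers every trace that is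
  needed: those of endomorphisms of the plane \<open>U\<close>, and those of maps that factor through \<open>(2)\<close>.
  The finite spanning set makes the basis chosen by \<^const>\<open>lin_trace\<close> finite; over an infinite
  basis the sum in its definition would be \<open>0\<close>.
\<close>

lemma lin_trace_rank_le_2:
  fixes s :: "'k::field \<Rightarrow> 'v::ab_group_add \<Rightarrow> 'v"
  assumes "vector_space s" and V: "module.subspace s V"
    and C: "finite C" "V \<subseteq> module.span s C"
    and phi: "Vector_Spaces.linear s (*) phi" and psi: "Vector_Spaces.linear s (*) psi"
    and w: "w \<in> V" "w' \<in> V"
    and f: "\<And>x. x \<in> V \<Longrightarrow> f x = s (phi x) w + s (psi x) w'"
  shows "lin_trace s V f = phi w + psi w'"
proof -
  interpret vector_space s by fact
  interpret phi: Vector_Spaces.linear s "(*)" phi by fact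
  interpret psi: Vector_Spaces.linear s "(*)" psi by fact
  define B where "B = (SOME B. B \<subseteq> V \<and> independent B \<and> span B = V)"
  have "\<exists>B. B \<subseteq> V \<and> independent B \<and> span B = V"
    using maximal_independent_subset[of V] span_subspace[OF _ _ V] by metis
  then have B: "B \<subseteq> V" "independent B" "span B = V"
    unfolding B_def by (metis (mono_tags, lifting) someI_ex)+
  have "finite B"
    using independent_span_bound[OF C(1) B(2)] B(1) C(2) by auto
  have expand: "(\<Sum>b\<in>B. s (representation B x b) b) = x" if "x \<in> V" for x
    using sum_representation_eq[OF B(2) _ \<open>finite B\<close>, of x] that B(3) by simp
  have "lin_trace s V f = (\<Sum>b\<in>B. representation B (f b) b)"
    by (simp add: lin_trace_def B_def Let_def)
  also have "\<dots> = (\<Sum>b\<in>B. phi b * representation B w b + psi b * representation B w' b)"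
    using B w by (intro sum.cong refl)
      (auto simp: f representation_add representation_scale span_scale)
  also have "\<dots> = phi (\<Sum>b\<in>B. s (representation B w b) b) + psi (\<Sum>b\<in>B. s (representation B w' b) b)"
    by (simp add: phi.sum psi.sum phi.scale psi.scale sum.distrib mult.commute)
  also have "\<dots> = phi w + psi w'"
    using w by (simp add: expand)
  finally show ?thesis .
qed

lemma vector_space_prod_scale:
  assumes "vector_space s" "vector_space t"
  shows "vector_space (prod_scale s t)"
  using assms by (auto simp: vector_space_def prod_scale_def)

lemma subspace_Times:
  assumes "vector_space s" "vector_space t" "module.subspace s V" "module.subspace t W"
  shows "module.subspace (prod_scale s t) (V \<times> W)"
proof -
  interpret S: vector_space s by fact
  interpret T: vector_space t by fact
  interpret P: vector_space "prod_scale s t"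
    using assms(1,2) by (rule vector_space_prod_scale)
  show ?thesis
    using assms(3,4)
    by (auto simp: P.subspace_def S.subspace_def T.subspace_def prod_scale_def zero_prod_def)
qed

text \<open>
  If \<open>f(v) = u \<otimes> x + v \<otimes> y\<close>, then \<open>f(u) = f(d v) = u \<otimes> y\<close>. For a functional \<open>\<xi>\<close> with \<open>\<xi>(y) = 1\<close>
  the composite of \<open>f\<close> with \<open>id \<otimes> \<xi> : (2) \<otimes> M \<rightarrow> (2)\<close> has trace \<open>2 \<xi>(y) = 2\<close>, so \<open>y\<close> must vanish.
\<close>

lemma negligible_J2_vanishes:
  fixes s :: "'k::field \<Rightarrow> 'm::ab_group_add \<Rightarrow> 'm"
  assumes "vector_space s" and M: "module.subspace s M"
    and C: "finite C" "M \<times> M \<subseteq> module.span (prod_scale s s) C"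
    and two: "(2::'k) \<noteq> 0"
    and neg: "negligible J2 (tensor2 s M) f"
  shows "f J2_u = 0"
proof (rule ccontr)
  assume "f J2_u \<noteq> 0"
  interpret vector_space s by fact
  interpret K: vector_space "(*) :: 'k \<Rightarrow> 'k \<Rightarrow> 'k"
    by unfold_locales (auto simp: algebra_simps)
  interpret SK: vector_space_pair s "(*) :: 'k \<Rightarrow> 'k \<Rightarrow> 'k" ..
  from neg have hom: "rep_hom J2 (tensor2 s M) f"
    and tr: "\<And>g. rep_hom (tensor2 s M) J2 g \<Longrightarrow> lin_trace (prod_scale s s) (M \<times> M) (f \<circ> g) = 0"
    by (auto simp: negligible_def tensor2_def)
  from hom have lin: "linmap (prod_scale (*) (*)) (UNIV \<times> UNIV) (prod_scale s s) (M \<times> M) f"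
    and comm: "f (q, 0) = (snd (f (p, q)), 0)" for p q
    by (auto simp: rep_hom_def tensor2_def case_prod_unfold)
  obtain x y where fv: "f (0, 1) = (x, y)" by (cases "f (0, 1)")
  have fu: "f (1, 0) = (y, 0)" using comm[of 1 0] fv by simp
  have xy: "x \<in> M" "y \<in> M" "0 \<in> M"
    using linmap_mem[OF lin, of "(0,1)"] fv subspace_0[OF M] by auto
  have f: "f (p, q) = prod_scale s s p (y, 0) + prod_scale s s q (x, y)" for p q
  proof -
    have "(p, q) = prod_scale (*) (*) p (1, 0) + prod_scale (*) (*) q (0, 1)"
      by (simp add: prod_scale_def)
    then show ?thesis
      using linmap_add[OF lin, of "prod_scale (*) (*) p (1, 0)" "prod_scale (*) (*) q (0, 1)"]
        linmap_scale[OF lin, of "(1, 0)" p] linmap_scale[OF lin, of "(0, 1)" q] fu fv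
      by (simp add: prod_scale_def)
  qed
  have "y \<noteq> 0" using \<open>f J2_u \<noteq> 0\<close> fu by (auto simp: J2_u_def zero_prod_def)
  then have "independent {y}" by (simp add: dependent_single)
  then obtain xi where xi: "Vector_Spaces.linear s (*) xi" "xi y = 1"
    using SK.linear_independent_extend[of "{y}" "\<lambda>_. 1"] by auto
  interpret xi: Vector_Spaces.linear s "(*)" xi by fact
  let ?g = "\<lambda>(p, q). (xi p, xi q)"
  have g: "rep_hom (tensor2 s M) J2 ?g"
    by (auto simp: rep_hom_def tensor2_def linmap_def prod_scale_def xi.add xi.scale xi.zero)
  have P: "vector_space (prod_scale s s)"
    by (rule vector_space_prod_scale) fact+
  interpret P: vector_space "prod_scale s s" by fact
  have lin: "Vector_Spaces.linear (prod_scale s s) (*) (xi \<circ> fst)" "Vector_Spaces.linear (prod_scale s s) (*) (xi \<circ> snd)"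
    unfolding Vector_Spaces.linear_iff using P K.vector_space_axioms
    by (auto simp: prod_scale_def xi.add xi.scale)
  have "lin_trace (prod_scale s s) (M \<times> M) (f \<circ> ?g) = (xi \<circ> fst) (y, 0 :: 'm) + (xi \<circ> snd) (x, y)"
    using xy f by (intro lin_trace_rank_le_2[OF P subspace_Times[OF assms(1,1) M M] C lin]) auto
  then show False using tr[OF g] xi(2) two by simp
qed

section \<open>Semisimplification as a pair of subquotients\<close>

locale derivation_algebra =
  fixes A :: "('k::field, 'v::ab_group_add) alg_rep"
  assumes lie: "lie_alg_rep A"
begin

abbreviation d where "d \<equiv> der A"
abbreviation br where "br \<equiv> mul A"

lemma vs: "vector_space (scl A)"
  using lie by (auto simp: lie_alg_rep_def alpha3_rep_def)

sublocale V: vector_space "scl A" by (rule vs)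

lemma subspace_car: "V.subspace (car A)"
  using lie by (auto simp: lie_alg_rep_def alpha3_rep_def)

lemma d_lin: "linmap (scl A) (car A) (scl A) (car A) d"
  and br_lin1: "y \<in> car A \<Longrightarrow> linmap (scl A) (car A) (scl A) (car A) (\<lambda>x. br x y)"
  and br_lin2: "x \<in> car A \<Longrightarrow> linmap (scl A) (car A) (scl A) (car A) (br x)"
  and leibniz: "x \<in> car A \<Longrightarrow> y \<in> car A \<Longrightarrow> d (br x y) = br (d x) y + br x (d y)"
  using lie by (auto simp: lie_alg_rep_def alpha3_rep_def)

lemma car_closed [simp, intro]:
  "0 \<in> car A"
  "x \<in> car A \<Longrightarrow> y \<in> car A \<Longrightarrow> x + y \<in> car A"
  "x \<in> car A \<Longrightarrow> y \<in> car A \<Longrightarrow> x - y \<in> car A"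
  "x \<in> car A \<Longrightarrow> - x \<in> car A"
  "x \<in> car A \<Longrightarrow> scl A c x \<in> car A"
  "x \<in> car A \<Longrightarrow> d x \<in> car A"
  "x \<in> car A \<Longrightarrow> y \<in> car A \<Longrightarrow> br x y \<in> car A"
  using subspace_car V.subspace_0 V.subspace_add V.subspace_diff V.subspace_neg V.subspace_scale
    linmap_mem[OF d_lin] linmap_mem[OF br_lin2] by auto

lemma d_simps:
  "d 0 = 0"
  "x \<in> car A \<Longrightarrow> y \<in> car A \<Longrightarrow> d (x + y) = d x + d y"
  "x \<in> car A \<Longrightarrow> y \<in> car A \<Longrightarrow> d (x - y) = d x - d y"
  using linmap_zero[OF d_lin] linmap_add[OF d_lin] linmap_diff[OF d_lin] by auto

lemma br_simps:
  "x \<in> car A \<Longrightarrow> br x 0 = 0" "x \<in> car A \<Longrightarrow> br 0 x = 0"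
  "x \<in> car A \<Longrightarrow> y \<in> car A \<Longrightarrow> z \<in> car A \<Longrightarrow> br x (y + z) = br x y + br x z"
  "x \<in> car A \<Longrightarrow> y \<in> car A \<Longrightarrow> z \<in> car A \<Longrightarrow> br (y + z) x = br y x + br z x"
  using linmap_zero[OF br_lin2] linmap_zero[OF br_lin1] linmap_add[OF br_lin2] linmap_add[OF br_lin1]
  by auto

text \<open>
  The two subspaces whose quotients carry the semisimplification. A block \<open>(1)\<close> contributes to
  \<open>ker d\<close> but not to \<open>im d\<close>; the block \<open>(2)\<close> contributes \<open>u\<close> to \<open>ker d \<inter> im d\<close> but nothing to
  \<open>im d\<^sup>2\<close>; the block \<open>(3)\<close> contributes \<open>e\<^sub>3\<close> to all three.
\<close>

definition cycles where "cycles = {x \<in> car A. d x = 0}"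
definition exact_cycles where "exact_cycles = cycles \<inter> d ` car A"

lemma cyclesD: "x \<in> cycles \<Longrightarrow> x \<in> car A" "x \<in> cycles \<Longrightarrow> d x = 0"
  by (auto simp: cycles_def)

lemma exact_cyclesD: "x \<in> exact_cycles \<Longrightarrow> x \<in> cycles" "x \<in> exact_cycles \<Longrightarrow> \<exists>y\<in>car A. x = d y"
  by (auto simp: exact_cycles_def)

lemma cycles_closed:
  "0 \<in> cycles" "x \<in> cycles \<Longrightarrow> y \<in> cycles \<Longrightarrow> x + y \<in> cycles" "x \<in> cycles \<Longrightarrow> y \<in> cycles \<Longrightarrow> x - y \<in> cycles"
  "x \<in> cycles \<Longrightarrow> scl A c x \<in> cycles"
  "x \<in> cycles \<Longrightarrow> y \<in> cycles \<Longrightarrow> br x y \<in> cycles"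
  by (auto simp: cycles_def d_simps linmap_scale[OF d_lin] leibniz br_simps)

lemma exact_cycles_closed:
  "0 \<in> exact_cycles" "x \<in> exact_cycles \<Longrightarrow> y \<in> exact_cycles \<Longrightarrow> x + y \<in> exact_cycles" "x \<in> exact_cycles \<Longrightarrow> y \<in> exact_cycles \<Longrightarrow> x - y \<in> exact_cycles"
  "x \<in> exact_cycles \<Longrightarrow> scl A c x \<in> exact_cycles"
  "x \<in> cycles \<Longrightarrow> y \<in> exact_cycles \<Longrightarrow> br x y \<in> exact_cycles"
proof -
  have im: "0 \<in> d ` car A" "x \<in> d ` car A \<Longrightarrow> y \<in> d ` car A \<Longrightarrow> x + y \<in> d ` car A"
    "x \<in> d ` car A \<Longrightarrow> y \<in> d ` car A \<Longrightarrow> x - y \<in> d ` car A"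
    "x \<in> d ` car A \<Longrightarrow> scl A c x \<in> d ` car A"
    "x \<in> cycles \<Longrightarrow> y \<in> d ` car A \<Longrightarrow> br x y \<in> d ` car A" for x y c
  proof -
    show "0 \<in> d ` car A" using d_simps(1) by (metis car_closed(1) imageI)
    show "x + y \<in> d ` car A" "x - y \<in> d ` car A" if "x \<in> d ` car A" "y \<in> d ` car A"
      using that by (auto simp: d_simps(2,3)[symmetric])
    show "scl A c x \<in> d ` car A" if "x \<in> d ` car A"
      using that by (auto simp: linmap_scale[OF d_lin, symmetric])
    show "br x y \<in> d ` car A" if x: "x \<in> cycles" and "y \<in> d ` car A"
    proof -
      from that(2) obtain z where z: "z \<in> car A" "y = d z" by auto
      then have "br x y = d (br x z)" using cyclesD[OF x] by (simp add: leibniz br_simps)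
      then show ?thesis using cyclesD[OF x] z by blast
    qed
  qed
  show "0 \<in> exact_cycles" "x \<in> exact_cycles \<Longrightarrow> y \<in> exact_cycles \<Longrightarrow> x + y \<in> exact_cycles" "x \<in> exact_cycles \<Longrightarrow> y \<in> exact_cycles \<Longrightarrow> x - y \<in> exact_cycles"
  "x \<in> exact_cycles \<Longrightarrow> scl A c x \<in> exact_cycles"
  "x \<in> cycles \<Longrightarrow> y \<in> exact_cycles \<Longrightarrow> br x y \<in> exact_cycles"
    using im cycles_closed by (auto simp: exact_cycles_def)
qed

text \<open>
  \<open>p0\<close> and \<open>p1\<close> identify the even and the odd part of \<open>S\<close> with \<open>ker d / (ker d \<inter> im d)\<close> and
  \<open>(ker d \<inter> im d) / im d\<^sup>2\<close>. The odd product is the only one that needs preimages under \<open>d\<close>: for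
  \<open>x = v \<otimes> o\<close> and \<open>y = v \<otimes> o'\<close> the expression \<open>[d x, y] - [x, d y]\<close> is
  \<open>[u \<otimes> o, v \<otimes> o'] - [v \<otimes> o, u \<otimes> o']\<close>, and it lies in \<open>ker d\<close> whenever \<open>d\<^sup>2 x = d\<^sup>2 y = 0\<close>.
\<close>

definition subquotient_model :: "('k, 's::ab_group_add) superalg \<Rightarrow> ('v \<Rightarrow> 's) \<Rightarrow> ('v \<Rightarrow> 's) \<Rightarrow> bool" where
  "subquotient_model S p0 p1 \<longleftrightarrow>
     linmap (scl A) cycles (sscl S) (evn S) p0 \<and> p0 ` cycles = evn S \<and>
     (\<forall>w\<in>cycles. p0 w = 0 \<longleftrightarrow> w \<in> d ` car A) \<and>
     linmap (scl A) exact_cycles (sscl S) (odd_part S) p1 \<and> p1 ` exact_cycles = odd_part S \<and>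
     (\<forall>w\<in>exact_cycles. p1 w = 0 \<longleftrightarrow> w \<in> (d \<circ> d) ` car A) \<and>
     (\<forall>w\<in>cycles. \<forall>w'\<in>cycles. smul S (p0 w) (p0 w') = p0 (br w w')) \<and>
     (\<forall>w\<in>cycles. \<forall>q\<in>exact_cycles. smul S (p0 w) (p1 q) = p1 (br w q)) \<and>
     (\<forall>w\<in>cycles. \<forall>q\<in>exact_cycles. smul S (p1 q) (p0 w) = - p1 (br w q)) \<and>
     (\<forall>x\<in>car A. \<forall>y\<in>car A. d (d x) = 0 \<longrightarrow> d (d y) = 0 \<longrightarrow>
        smul S (p1 (d x)) (p1 (d y)) = p0 (br (d x) y - br x (d y)))"

text \<open>
  The kernels of \<open>p0\<close> and \<open>p1\<close> are determined by \<open>A\<close>, so every relation between their values also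
  holds between the values of \<open>q0\<close> and \<open>q1\<close>. This gives both that the isomorphism in
  \<open>subquotient_model_unique\<close> is well defined and, with the roles of \<open>S\<close> and \<open>T\<close> exchanged, that it
  is injective.
\<close>

lemma subquotient_models_agree:
  assumes S: "superalgebra S" and T: "superalgebra T"
    and mS: "subquotient_model S p0 p1" and mT: "subquotient_model T q0 q1"
    and w: "w \<in> cycles" "w' \<in> cycles" and p: "p \<in> exact_cycles" "p' \<in> exact_cycles"
    and eq: "p0 w + p1 p = p0 w' + p1 p'"
  shows "q0 w + q1 p = q0 w' + q1 p'"
proof -
  have lin: "linmap (scl A) cycles (sscl S) (evn S) p0" "linmap (scl A) exact_cycles (sscl S) (odd_part S) p1"
    and lin': "linmap (scl A) cycles (sscl T) (evn T) q0" "linmap (scl A) exact_cycles (sscl T) (odd_part T) q1"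
    using mS mT by (auto simp: subquotient_model_def)
  have w': "w - w' \<in> cycles" and p'': "p' - p \<in> exact_cycles"
    using w p cycles_closed exact_cycles_closed by auto
  have "p0 (w - w') = p0 w - p0 w'" "p1 (p' - p) = p1 p' - p1 p"
    using w w' p p'' lin by (auto intro!: linmap_diff)
  moreover have "p0 w - p0 w' = (p0 w + p1 p) - p1 p - p0 w'" by simp
  ultimately have *: "p0 (w - w') = p1 (p' - p)" using eq by simp
  have "p0 (w - w') \<in> evn S" "p1 (p' - p) \<in> odd_part S"
    using w' p'' lin by (auto intro: linmap_mem)
  with * S have "p0 (w - w') = 0" "p1 (p' - p) = 0"
    by (auto simp: superalgebra_def)
  then have "w - w' \<in> d ` car A" "p' - p \<in> (d \<circ> d) ` car A"
    using mS w' p'' unfolding subquotient_model_def by blast+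
  then have "q0 (w - w') = 0" "q1 (p' - p) = 0"
    using mT w' p'' unfolding subquotient_model_def by blast+
  moreover have "q0 (w - w') = q0 w - q0 w'" "q1 (p' - p) = q1 p' - q1 p"
    using w w' p p'' lin' by (auto intro!: linmap_diff)
  ultimately show ?thesis by simp
qed

lemma scar_subquotient_model:
  assumes "subquotient_model S p0 p1"
  shows "scar S = {p0 w + p1 p |w p. w \<in> cycles \<and> p \<in> exact_cycles}"
proof -
  have "evn S = p0 ` cycles" "odd_part S = p1 ` exact_cycles"
    using assms unfolding subquotient_model_def by auto
  then show ?thesis unfolding scar_def by auto
qed

lemma superalgebra_parts_subset:
  assumes "superalgebra S"
  shows "evn S \<subseteq> scar S" "odd_part S \<subseteq> scar S"
proof -
  interpret S: vector_space "sscl S" using assms by (simp add: superalgebra_def)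
  have "0 \<in> evn S" "0 \<in> odd_part S"
    using assms S.subspace_0 by (auto simp: superalgebra_def)
  then show "evn S \<subseteq> scar S" "odd_part S \<subseteq> scar S"
    unfolding scar_def by (auto, metis add.right_neutral, metis add.left_neutral)
qed

lemma subquotient_model_smul:
  assumes S: "superalgebra S" and m: "subquotient_model S p0 p1"
    and w: "w \<in> cycles" "w' \<in> cycles"
    and x: "x \<in> car A" "d (d x) = 0" "x' \<in> car A" "d (d x') = 0"
  shows "smul S (p0 w + p1 (d x)) (p0 w' + p1 (d x')) =
    p0 (br w w' + (br (d x) x' - br x (d x'))) + p1 (br w (d x') - br w' (d x))"
proof -
  have dx: "d x \<in> exact_cycles" "d x' \<in> exact_cycles"
    using x by (auto simp: exact_cycles_def cycles_def)
  note facts = m[unfolded subquotient_model_def]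
  have mem: "p0 w \<in> scar S" "p0 w' \<in> scar S" "p1 (d x) \<in> scar S" "p1 (d x') \<in> scar S"
    using facts w dx superalgebra_parts_subset[OF S] by (auto simp: linmap_def)
  moreover have "a + b \<in> scar S" if "a \<in> evn S" "b \<in> odd_part S" for a b
    using that by (auto simp: scar_def)
  ultimately have mem': "p0 w + p1 (d x) \<in> scar S" "p0 w' + p1 (d x') \<in> scar S"
    using facts w dx by (auto simp: linmap_def)
  have lin: "\<And>y. y \<in> scar S \<Longrightarrow> linmap (sscl S) (scar S) (sscl S) (scar S) (smul S y)"
    "\<And>y. y \<in> scar S \<Longrightarrow> linmap (sscl S) (scar S) (sscl S) (scar S) (\<lambda>x. smul S x y)"
    using S by (auto simp: superalgebra_def)
  have "smul S (p0 w + p1 (d x)) (p0 w' + p1 (d x')) =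
      (smul S (p0 w) (p0 w') + smul S (p0 w) (p1 (d x'))) +
      (smul S (p1 (d x)) (p0 w') + smul S (p1 (d x)) (p1 (d x')))"
    using linmap_add[OF lin(2)[OF mem'(2)] mem(1,3)]
      linmap_add[OF lin(1)[OF mem(1)] mem(2,4)] linmap_add[OF lin(1)[OF mem(3)] mem(2,4)]
    by simp
  also have "\<dots> = (p0 (br w w') + p0 (br (d x) x' - br x (d x'))) + (p1 (br w (d x')) - p1 (br w' (d x)))"
    using facts w dx x by (simp add: algebra_simps)
  also have "p1 (br w (d x')) - p1 (br w' (d x)) = p1 (br w (d x') - br w' (d x))"
    using facts w dx by (intro linmap_diff[symmetric]) (auto intro: exact_cycles_closed)
  also have "p0 (br w w') + p0 (br (d x) x' - br x (d x')) = p0 (br w w' + (br (d x) x' - br x (d x')))"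
  proof (rule linmap_add[symmetric])
    show "br (d x) x' - br x (d x') \<in> cycles"
      using x by (auto simp: cycles_def d_simps leibniz br_simps)
  qed (use facts w in \<open>auto intro: cycles_closed\<close>)
  finally show ?thesis .
qed

text \<open>
  The isomorphism sends the class of a cycle in \<open>S\<close> to the class of the same cycle in \<open>T\<close>.
\<close>

lemma subquotient_model_unique:
  assumes S: "superalgebra S" and T: "superalgebra T"
    and mS: "subquotient_model S p0 p1" and mT: "subquotient_model T q0 q1"
  shows "superalg_isomorphic S T"
proof -
  define h where "h = (\<lambda>z. SOME z'. \<exists>w\<in>cycles. \<exists>p\<in>exact_cycles. z = p0 w + p1 p \<and> z' = q0 w + q1 p)"
  have h: "h (p0 w + p1 p) = q0 w + q1 p" if "w \<in> cycles" "p \<in> exact_cycles" for w p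
    unfolding h_def
  proof (rule some_equality)
    fix z' assume "\<exists>w'\<in>cycles. \<exists>p'\<in>exact_cycles. p0 w + p1 p = p0 w' + p1 p' \<and> z' = q0 w' + q1 p'"
    then show "z' = q0 w + q1 p"
      using subquotient_models_agree[OF S T mS mT] that by metis
  qed (use that in blast)
  have zS: "p0 0 = 0" "p1 0 = 0" and zT: "q0 0 = 0" "q1 0 = 0"
    using mS mT cycles_closed(1) exact_cycles_closed(1) by (auto simp: subquotient_model_def intro: linmap_zero)
  have h0: "h (p0 w) = q0 w" if "w \<in> cycles" for w
    using h[OF that exact_cycles_closed(1)] by (simp add: zS zT)
  have h1: "h (p1 p) = q1 p" if "p \<in> exact_cycles" for p
    using h[OF cycles_closed(1) that] by (simp add: zS zT)
  note facts = mS[unfolded subquotient_model_def] mT[unfolded subquotient_model_def]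
  have lin: "linmap (scl A) cycles (sscl S) (evn S) p0" "linmap (scl A) exact_cycles (sscl S) (odd_part S) p1"
    and lin': "linmap (scl A) cycles (sscl T) (evn T) q0" "linmap (scl A) exact_cycles (sscl T) (odd_part T) q1"
    using facts by auto
  interpret S: vector_space "sscl S" using S by (simp add: superalgebra_def)
  interpret T: vector_space "sscl T" using T by (simp add: superalgebra_def)
  have scS: "\<exists>w\<in>cycles. \<exists>p\<in>exact_cycles. x = p0 w + p1 p" if "x \<in> scar S" for x
    using that scar_subquotient_model[OF mS] by blast
  have inT: "q0 w + q1 p \<in> scar T" if "w \<in> cycles" "p \<in> exact_cycles" for w p
    using that scar_subquotient_model[OF mT] by blast
  have hlin: "linmap (sscl S) (scar S) (sscl T) (scar T) h"
    unfolding linmap_def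
  proof (intro conjI ballI allI)
    fix x assume "x \<in> scar S"
    then obtain w p where x: "w \<in> cycles" "p \<in> exact_cycles" "x = p0 w + p1 p" using scS by blast
    then show "h x \<in> scar T" by (simp add: h inT)
    fix c
    have "sscl S c x = p0 (scl A c w) + p1 (scl A c p)"
      using x by (simp add: linmap_scale[OF lin(1)] linmap_scale[OF lin(2)] S.scale_right_distrib)
    then show "h (sscl S c x) = sscl T c (h x)"
      using x by (simp add: h cycles_closed exact_cycles_closed linmap_scale[OF lin'(1)] linmap_scale[OF lin'(2)]
          T.scale_right_distrib)
    fix y assume "y \<in> scar S"
    then obtain w' p' where y: "w' \<in> cycles" "p' \<in> exact_cycles" "y = p0 w' + p1 p'" using scS by blast
    have "x + y = p0 (w + w') + p1 (p + p')"
      using x y by (simp add: linmap_add[OF lin(1)] linmap_add[OF lin(2)])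
    then show "h (x + y) = h x + h y"
      using x y by (simp add: h cycles_closed exact_cycles_closed linmap_add[OF lin'(1)] linmap_add[OF lin'(2)])
  qed
  have "inj_on h (scar S)"
  proof (rule inj_onI)
    fix x y assume "x \<in> scar S" "y \<in> scar S" and eq: "h x = h y"
    then obtain w p w' p' where x: "w \<in> cycles" "p \<in> exact_cycles" "x = p0 w + p1 p"
      and y: "w' \<in> cycles" "p' \<in> exact_cycles" "y = p0 w' + p1 p'" using scS by metis
    with eq have "q0 w + q1 p = q0 w' + q1 p'" by (simp add: h)
    from subquotient_models_agree[OF T S mT mS x(1) y(1) x(2) y(2) this] show "x = y"
      using x(3) y(3) by simp
  qed
  moreover have "h ` scar S = scar T"
  proof -
    have "h ` scar S = (\<lambda>(w, p). h (p0 w + p1 p)) ` (cycles \<times> exact_cycles)"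
      unfolding scar_subquotient_model[OF mS] by auto
    also have "\<dots> = (\<lambda>(w, p). q0 w + q1 p) ` (cycles \<times> exact_cycles)"
      by (intro image_cong) (auto simp: h)
    finally show ?thesis unfolding scar_subquotient_model[OF mT] by auto
  qed
  moreover have "h ` evn S = evn T"
  proof -
    have "h ` p0 ` cycles = q0 ` cycles" unfolding image_image by (intro image_cong) (auto simp: h0)
    then show ?thesis using facts by simp
  qed
  moreover have "h ` odd_part S = odd_part T"
  proof -
    have "h ` p1 ` exact_cycles = q1 ` exact_cycles" unfolding image_image by (intro image_cong) (auto simp: h1)
    then show ?thesis using facts by simp
  qed
  moreover have "h (smul S x y) = smul T (h x) (h y)" if xy: "x \<in> scar S" "y \<in> scar S" for x y
  proof -
    from xy scS obtain w p w' p' where *: "w \<in> cycles" "p \<in> exact_cycles" "x = p0 w + p1 p"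
      "w' \<in> cycles" "p' \<in> exact_cycles" "y = p0 w' + p1 p'" by metis
    then obtain z z' where z: "z \<in> car A" "p = d z" "z' \<in> car A" "p' = d z'" using exact_cyclesD by metis
    with * have dz: "d (d z) = 0" "d (d z') = 0" using exact_cyclesD cyclesD by auto
    have "h (smul S x y) = h (p0 (br w w' + (br (d z) z' - br z (d z'))) + p1 (br w (d z') - br w' (d z)))"
      using subquotient_model_smul[OF S mS *(1,4) z(1) dz(1) z(3) dz(2)] * z by simp
    also have "\<dots> = q0 (br w w' + (br (d z) z' - br z (d z'))) + q1 (br w (d z') - br w' (d z))"
    proof (rule h)
      show "br w (d z') - br w' (d z) \<in> exact_cycles" using * z exact_cycles_closed by metis
      have "br (d z) z' - br z (d z') \<in> cycles"
        using z dz by (auto simp: cycles_def d_simps leibniz br_simps)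
      then show "br w w' + (br (d z) z' - br z (d z')) \<in> cycles" using * by (simp add: cycles_closed)
    qed
    also have "\<dots> = smul T (q0 w + q1 (d z)) (q0 w' + q1 (d z'))"
      using subquotient_model_smul[OF T mT *(1,4) z(1) dz(1) z(3) dz(2)] by simp
    also have "\<dots> = smul T (h x) (h y)" using * z by (simp add: h)
    finally show ?thesis .
  qed
  ultimately show ?thesis
    unfolding superalg_isomorphic_def bij_betw_def using hlin by blast
qed

lemma finite_span_car: "\<exists>C. finite C \<and> C \<subseteq> car A \<and> V.span C = car A"
  using lie by (auto simp: lie_alg_rep_def alpha3_rep_def)

text \<open>
  A block decomposition \<open>J\<close> yields \<open>p0\<close> and \<open>p1\<close> as its projections onto the multiplicity spaces
  of \<open>(1)\<close> and of \<open>u \<in> (2)\<close>. Their kernels are read off from \<open>J\<close>. The products are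
  prescribed only for the representatives \<open>1 \<otimes> a\<close>, \<open>u \<otimes> x\<close> and \<open>v \<otimes> x\<close>, and the work consists in
  showing that other representatives change a product only by elements of \<open>im d\<close>, or of \<open>im d\<^sup>2\<close> for
  a product in the odd part.
\<close>

lemma semisimplification_subquotient_model:
  fixes S :: "('k, 's::ab_group_add) superalg"
  assumes two: "(2::'k) \<noteq> 0"
    and S: "superalgebra S" and via: "semisimplification_via A S L2 J"
  shows "\<exists>p0 p1. subquotient_model S p0 p1"
proof -
  interpret S: vector_space "sscl S" using S by (simp add: superalgebra_def)
  have subS: "S.subspace (evn S)" "S.subspace (odd_part S)"
    using S by (auto simp: superalgebra_def)
  define S0 S1 where "S0 = evn S" and "S1 = odd_part S"
  define D where "D = rep_sum (tensor1 (sscl S) S0) (rep_sum (tensor2 (sscl S) S1) (tensor3 (scl A) L2))"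
  define G where "G = inv_into (car D) J"
  have carD: "car D = S0 \<times> (S1 \<times> S1) \<times> (L2 \<times> L2 \<times> L2)"
    by (simp add: D_def rep_sum_def tensor1_def tensor2_def tensor3_def)
  have derD: "der D (a, (x, y), (r, s, t)) = (0, (y, 0), (0, r, s))" for a x y r s t
    by (simp add: D_def rep_sum_def tensor1_def tensor2_def tensor3_def)
  have sclD: "scl D c (a, (x, y), (r, s, t)) =
      (sscl S c a, (sscl S c x, sscl S c y), (scl A c r, scl A c s, scl A c t))" for c a x y r s t
    by (simp add: D_def rep_sum_def tensor1_def tensor2_def tensor3_def prod_scale_def)
  \<comment> \<open>The representatives \<open>1 \<otimes> a\<close>, \<open>u \<otimes> x\<close> and \<open>v \<otimes> x\<close> in \<open>A\<close>.\<close>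
  define one where "one = (\<lambda>a. J (a, (0, 0), (0, 0, 0)))"
  define twou where "twou = (\<lambda>x. J (0, (x, 0), (0, 0, 0)))"
  define twov where "twov = (\<lambda>x. J (0, (0, x), (0, 0, 0)))"
  note via' = via[unfolded semisimplification_via_def Let_def, folded S0_def S1_def, folded D_def, folded G_def]
  have L2: "V.subspace L2" and iso: "rep_iso D A J"
    using via' by auto
  have via00: "smul S a b = fst (G (br (one a) (one b)))" if "a \<in> S0" "b \<in> S0" for a b
    using via' that by (auto simp: one_def zero_prod_def)
  have via01: "negligible J2 (tensor2 (sscl S) S1)
      (\<lambda>z. fst (snd (G (br (one a) (J (0, pure2 (sscl S) z x, 0))))) - pure2 (sscl S) z (smul S a x))"
    if "a \<in> S0" "x \<in> S1" for a x
    using via' that by (auto simp: one_def zero_prod_def)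
  have via10: "smul S x a = - smul S a x" if "a \<in> S0" "x \<in> S1" for a x
    using via' that by auto
  have via11: "smul S x y = fst (G (br (twou x) (twov y) - br (twov x) (twou y)))"
    if "x \<in> S1" "y \<in> S1" for x y
    using via' that by (auto simp: twou_def twov_def J2_u_def J2_v_def pure2_def zero_prod_def)
  have Jlin: "linmap (scl D) (car D) (scl A) (car A) J"
    and Jder: "\<And>x. x \<in> car D \<Longrightarrow> J (der D x) = d (J x)"
    and bij: "bij_betw J (car D) (car A)"
    using iso by (auto simp: rep_iso_def rep_hom_def)
  have G: "G w \<in> car D" "J (G w) = w" if "w \<in> car A" for w
    using bij that unfolding G_def bij_betw_def by (auto intro: inv_into_into f_inv_into_f)
  have GJ: "G (J z) = z" if "z \<in> car D" for z
    using bij that unfolding G_def bij_betw_def by (auto intro: inv_into_f_f)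
  have zeros [simp]: "0 \<in> S0" "0 \<in> S1" "0 \<in> L2"
    using subS L2 S.subspace_0 V.subspace_0 by (auto simp: S0_def S1_def)
  have subspaces: "S.subspace S0" "S.subspace S1" using subS by (auto simp: S0_def S1_def)
  have D_add: "x + y \<in> car D" if "x \<in> car D" "y \<in> car D" for x y
    using that subspaces L2 unfolding carD
    by (auto simp: S.subspace_add V.subspace_add)
  have D_scl: "scl D c x \<in> car D" if "x \<in> car D" for x c
    using that subspaces L2 unfolding carD
    by (auto simp: sclD S.subspace_scale V.subspace_scale)
  have D_der: "der D x \<in> car D" if "x \<in> car D" for x
    using that unfolding carD by (auto simp: derD)
  have Glin: "linmap (scl A) (car A) (scl D) (car D) G"
    unfolding linmap_def
  proof (intro conjI ballI allI)
    fix x assume x: "x \<in> car A"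
    show "G x \<in> car D" using G x by simp
    show "G (scl A c x) = scl D c (G x)" for c
      using GJ[OF D_scl[OF G(1)[OF x]]] linmap_scale[OF Jlin G(1)[OF x]] G(2)[OF x] by metis
    fix y assume y: "y \<in> car A"
    show "G (x + y) = G x + G y"
      using GJ[OF D_add[OF G(1)[OF x] G(1)[OF y]]] linmap_add[OF Jlin G(1)[OF x] G(1)[OF y]]
        G(2)[OF x] G(2)[OF y] by metis
  qed
  have Gd: "G (d x) = der D (G x)" if "x \<in> car A" for x
    using GJ[OF D_der[OF G(1)[OF that]]] Jder[OF G(1)[OF that]] G(2)[OF that] by metis
  have Geq: "x = y" if "x \<in> car A" "y \<in> car A" "G x = G y" for x y
    using that G(2) by metis
  have Jcar: "J z \<in> car A" if "z \<in> car D" for z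
    using that linmap_mem[OF Jlin] by blast
  define p0 where "p0 = (\<lambda>w. fst (G w))"
  define p1 where "p1 = (\<lambda>w. fst (fst (snd (G w))))"
  have p0_lin: "linmap (scl A) (car A) (sscl S) S0 p0" and p1_lin: "linmap (scl A) (car A) (sscl S) S1 p1"
  proof -
    have "p0 w \<in> S0" "p1 w \<in> S1" "p0 (scl A c w) = sscl S c (p0 w)" "p1 (scl A c w) = sscl S c (p1 w)"
      if "w \<in> car A" for w c
      using G(1)[OF that] linmap_scale[OF Glin that, of c] unfolding carD p0_def p1_def
      by (auto simp: sclD)
    then show "linmap (scl A) (car A) (sscl S) S0 p0" "linmap (scl A) (car A) (sscl S) S1 p1"
      using linmap_add[OF Glin] by (auto simp: linmap_def p0_def p1_def)
  qed
  have p0_d: "p0 (d x) = 0" and p1_dd: "p1 (d (d x)) = 0" if x: "x \<in> car A" for x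
  proof -
    obtain a y z r s t where "G x = (a, (y, z), (r, s, t))" using prod_cases6 by (metis surj_pair)
    then show "p0 (d x) = 0" "p1 (d (d x)) = 0"
      using x by (simp_all add: p0_def p1_def Gd derD)
  qed
  have G_cycle: "\<exists>a x t. G w = (a, (x, 0), (0, 0, t)) \<and> a \<in> S0 \<and> x \<in> S1 \<and> t \<in> L2"
    if w: "w \<in> cycles" for w
  proof -
    obtain a x y r s t where *: "G w = (a, (x, y), (r, s, t))" by (metis surj_pair)
    then have "G (d w) = (0, (y, 0), (0, r, s))"
      using Gd[OF cyclesD(1)[OF w]] by (simp only: derD)
    moreover have "G (d w) = 0" using cyclesD[OF w] linmap_zero[OF Glin] by simp
    ultimately have "y = 0" "r = 0" "s = 0" by (auto simp: zero_prod_def)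
    then show ?thesis using G(1)[OF cyclesD(1)[OF w]] * unfolding carD by auto
  qed
  have one: "one a \<in> cycles" "p0 (one a) = a" if "a \<in> S0" for a
  proof -
    have in_D: "(a, (0, 0), (0, 0, 0)) \<in> car D" using that by (simp add: carD)
    have "d (one a) = J (der D (a, (0, 0), (0, 0, 0)))" using Jder[OF in_D] by (simp add: one_def)
    also have "\<dots> = d (J 0)"
      using Jder[of 0] by (simp add: carD zero_prod_def derD)
    also have "\<dots> = 0" using linmap_zero[OF Jlin] by (simp add: carD zero_prod_def d_simps)
    finally show "one a \<in> cycles" using Jcar[OF in_D] by (simp add: cycles_def one_def)
    show "p0 (one a) = a" using GJ[OF in_D] by (simp add: p0_def one_def)
  qed
  have twov: "twov x \<in> car A" "d (twov x) = twou x" "d (twou x) = 0" "p1 (twou x) = x" "p0 (twou x) = 0"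
    "G (twou x) = (0, (x, 0), (0, 0, 0))" if "x \<in> S1" for x
  proof -
    have in_D: "(0, (0, x), (0, 0, 0)) \<in> car D" "(0, (x, 0), (0, 0, 0)) \<in> car D"
      using that by (simp_all add: carD)
    show "twov x \<in> car A" using Jcar[OF in_D(1)] by (simp add: twov_def)
    show "d (twov x) = twou x" using Jder[OF in_D(1)] by (simp add: twov_def twou_def derD)
    have "d (twou x) = J 0" using Jder[OF in_D(2)] by (simp add: twov_def twou_def derD zero_prod_def)
    also have "\<dots> = 0" using linmap_zero[OF Jlin] by (simp add: carD zero_prod_def)
    finally show "d (twou x) = 0" .
    show "G (twou x) = (0, (x, 0), (0, 0, 0))" using GJ[OF in_D(2)] by (simp add: twou_def)
    then show "p1 (twou x) = x" "p0 (twou x) = 0" by (simp_all add: p0_def p1_def)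
  qed
  have twou: "twou x \<in> exact_cycles" if "x \<in> S1" for x
  proof -
    have "twou x \<in> d ` car A" using twov[OF that] by (metis imageI)
    moreover have "twou x \<in> car A" using twov(1,2)[OF that] by (metis car_closed(6))
    ultimately show ?thesis using twov(3)[OF that] by (simp add: exact_cycles_def cycles_def)
  qed
  have p0_ker: "w \<in> d ` car A" if w: "w \<in> cycles" and "p0 w = 0" for w
  proof -
    obtain x t where Gw: "G w = (0, (x, 0), (0, 0, t))" "x \<in> S1" "t \<in> L2"
      using G_cycle[OF w] \<open>p0 w = 0\<close> by (auto simp: p0_def)
    then have in_D: "(0, (0, x), (0, t, 0)) \<in> car D" by (simp add: carD)
    have "G w = G (d (J (0, (0, x), (0, t, 0))))"
      using GJ[OF D_der[OF in_D]] Jder[OF in_D] Gw by (simp add: derD)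
    then have "w = d (J (0, (0, x), (0, t, 0)))"
      using cyclesD(1)[OF w] Jcar[OF in_D] by (intro Geq) auto
    then show ?thesis using Jcar[OF in_D] by blast
  qed
  have p1_ker: "w \<in> (d \<circ> d) ` car A" if w: "w \<in> exact_cycles" and "p1 w = 0" for w
  proof -
    have wc: "w \<in> cycles" "p0 w = 0" using exact_cyclesD[OF w] p0_d by auto
    obtain t where Gw: "G w = (0, (0, 0), (0, 0, t))" "t \<in> L2"
      using G_cycle[OF wc(1)] \<open>p1 w = 0\<close> \<open>p0 w = 0\<close> by (auto simp: p0_def p1_def)
    then have in_D: "(0, (0, 0), (t, 0, 0)) \<in> car D" by (simp add: carD)
    have "G w = G (d (d (J (0, (0, 0), (t, 0, 0)))))"
      using GJ[OF in_D] Gw by (simp add: derD Gd Jcar[OF in_D])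
    then have "w = d (d (J (0, (0, 0), (t, 0, 0))))"
      using cyclesD(1)[OF wc(1)] Jcar[OF in_D] by (intro Geq) auto
    then show ?thesis using Jcar[OF in_D] by auto
  qed
  have p0_eqI: "p0 x = p0 y" if "x \<in> car A" "y \<in> car A" "x - y \<in> d ` car A" for x y
    using that p0_d linmap_diff[OF p0_lin, of x y] by auto
  \<comment> \<open>A cycle differs from the representative of its class by a boundary.\<close>
  have decomp: "\<exists>y\<in>car A. w = one (p0 w) + d y" if w: "w \<in> cycles" for w
  proof -
    have S0: "p0 w \<in> S0" using cyclesD[OF w] linmap_mem[OF p0_lin] by simp
    have cyc: "w - one (p0 w) \<in> cycles" using w one[OF S0] by (simp add: cycles_closed)
    have "p0 (w - one (p0 w)) = 0"
      using linmap_diff[OF p0_lin, of w "one (p0 w)"] cyclesD w one[OF S0] by auto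
    then have "w - one (p0 w) \<in> d ` car A" using p0_ker cyc by blast
    then show ?thesis by (auto simp: algebra_simps)
  qed
  obtain C where C: "finite C" "C \<subseteq> car A" "V.span C = car A" using finite_span_car by blast
  \<comment> \<open>The multiplicity space of \<open>(2)\<close> inherits a finite spanning set from \<open>A\<close>, as
      \<open>negligible_J2_vanishes\<close> requires.\<close>
  have fin: "finite ((\<lambda>w. fst (snd (G w))) ` C)"
    "S1 \<times> S1 \<subseteq> module.span (prod_scale (sscl S) (sscl S)) ((\<lambda>w. fst (snd (G w))) ` C)"
  proof -
    let ?P = "\<lambda>w. fst (snd (G w))"
    have "linmap (scl A) (car A) (prod_scale (sscl S) (sscl S)) (S1 \<times> S1) ?P"
      unfolding linmap_def
    proof (intro conjI ballI allI)
      fix x y c assume x: "x \<in> car A"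
      show "?P x \<in> S1 \<times> S1" using G(1)[OF x] unfolding carD by auto
      show "?P (scl A c x) = prod_scale (sscl S) (sscl S) c (?P x)"
        using linmap_scale[OF Glin x, of c] by (cases "G x") (auto simp: sclD prod_scale_def)
      assume y: "y \<in> car A"
      show "?P (x + y) = ?P x + ?P y" using linmap_add[OF Glin x y] by simp
    qed
    from linmap_image_span[OF vs vector_space_prod_scale[OF S.vector_space_axioms S.vector_space_axioms] this C(3,2)]
    have "?P ` car A \<subseteq> module.span (prod_scale (sscl S) (sscl S)) (?P ` C)" .
    moreover have "S1 \<times> S1 \<subseteq> ?P ` car A"
    proof
      fix z assume "z \<in> S1 \<times> S1"
      then have "(0, z, (0, 0, 0)) \<in> car D" by (auto simp: carD)
      then show "z \<in> ?P ` car A" using GJ Jcar by (intro image_eqI[of _ _ "J (0, z, (0, 0, 0))"]) auto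
    qed
    ultimately show "S1 \<times> S1 \<subseteq> module.span (prod_scale (sscl S) (sscl S)) (?P ` C)" by blast
  qed (use C in simp)
  have sm00: "smul S (p0 w) (p0 w') = p0 (br w w')" if w: "w \<in> cycles" "w' \<in> cycles" for w w'
  proof -
    have S0: "p0 w \<in> S0" "p0 w' \<in> S0" using cyclesD w linmap_mem[OF p0_lin] by auto
    define a b where "a = one (p0 w)" and "b = one (p0 w')"
    obtain y where y: "y \<in> car A" "w = a + d y" using decomp w unfolding a_def by blast
    obtain y' where y': "y' \<in> car A" "w' = b + d y'" using decomp w unfolding b_def by blast
    have ab: "a \<in> car A" "d a = 0" "b \<in> car A" "d b = 0"
      using one S0 cyclesD unfolding a_def b_def by auto
    have w'c: "w' \<in> car A" "d w' = 0" using cyclesD[OF w(2)] by auto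
    have "br w w' = br a w' + br (d y) w'"
      using y ab w'c by (simp add: br_simps)
    also have "br a w' = br a b + br a (d y')"
      using y' ab by (simp add: br_simps)
    finally have "br w w' = br a b + (br a (d y') + br (d y) w')" by (simp add: add.assoc)
    moreover have "br a (d y') + br (d y) w' = d (br a y' + br y w')"
      using y(1) y'(1) ab w'c by (simp add: d_simps leibniz br_simps)
    ultimately have "br w w' - br a b = d (br a y' + br y w')" by simp
    then have "p0 (br w w') = p0 (br a b)"
      using y(1) y'(1) ab cyclesD w by (intro p0_eqI) auto
    then show ?thesis using via00[OF S0] by (simp add: p0_def a_def b_def)
  qed
  have sm01: "smul S (p0 w) (p1 q) = p1 (br w q)" if w: "w \<in> cycles" and q: "q \<in> exact_cycles" for w q
  proof -
    have qc: "q \<in> cycles" using exact_cyclesD q by blast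
    have S0: "p0 w \<in> S0" and S1: "p1 q \<in> S1"
      using cyclesD w qc linmap_mem[OF p0_lin] linmap_mem[OF p1_lin] by auto
    define a q0 q' where "a = one (p0 w)" and "q0 = twou (p1 q)" and "q' = twov (p1 q)"
    obtain y where y: "y \<in> car A" "w = a + d y" using decomp w unfolding a_def by blast
    have a: "a \<in> car A" "d a = 0" using one S0 cyclesD unfolding a_def by auto
    note tq = twov[OF S1, folded q0_def q'_def] twou[OF S1, folded q0_def]
    have q0: "q0 \<in> car A" using tq exact_cyclesD cyclesD by blast
    have "p1 (q - q0) = 0"
      using linmap_diff[OF p1_lin, of q q0] cyclesD[OF qc] q0 tq by auto
    moreover have "q - q0 \<in> exact_cycles" using q tq exact_cycles_closed by blast
    ultimately obtain r where r: "r \<in> car A" "q = q0 + d (d r)"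
      using p1_ker[of "q - q0"] by (auto simp: algebra_simps)
    \<comment> \<open>With \<open>q0 = d q'\<close>, all terms of the Leibniz formula for \<open>d\<^sup>2 [y, q']\<close> vanish except
        \<open>2 [d y, d q']\<close>, so \<open>[d y, q0]\<close> lies in \<open>im d\<^sup>2\<close>.\<close>
    have p1_br: "p1 (br (d y) q0) = 0"
    proof -
      have "d (d y) = 0" using y a cyclesD[OF w] by (simp add: d_simps)
      then have "d (d (br y q')) = br (d y) q0 + br (d y) q0"
        using y tq q0 by (simp add: d_simps leibniz br_simps)
      then have "p1 (br (d y) q0) + p1 (br (d y) q0) = 0"
        using p1_dd[of "br y q'"] linmap_add[OF p1_lin, of "br (d y) q0" "br (d y) q0"] y tq q0 by auto
      then have "sscl S 2 (p1 (br (d y) q0)) = 0"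
        using S.scale_left_distrib[of 1 1] by simp
      then show ?thesis using two by simp
    qed
    have "br w q = br a q0 + (br (d y) q0 + br w (d (d r)))"
      using y r a q0 cyclesD[OF w] by (simp add: br_simps add.assoc)
    moreover have "br w (d (d r)) = d (d (br w r))"
      using r cyclesD[OF w] by (simp add: leibniz br_simps)
    ultimately have "p1 (br w q) = p1 (br a q0) + (p1 (br (d y) q0) + p1 (d (d (br w r))))"
      using y r a q0 cyclesD[OF w] by (simp add: linmap_add[OF p1_lin])
    also have "\<dots> = p1 (br a q0)"
      using p1_br p1_dd[of "br w r"] r cyclesD[OF w] by simp
    also have "\<dots> = smul S (p0 w) (p1 q)"
    proof -
      have "fst (snd (G (br a (J (0, pure2 (sscl S) J2_u (p1 q), 0))))) - pure2 (sscl S) J2_u (smul S (p0 w) (p1 q)) = 0"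
        using negligible_J2_vanishes[OF S.vector_space_axioms subspaces(2) fin two via01[OF S0 S1]] by (simp add: a_def)
      then show ?thesis
        by (auto simp: J2_u_def pure2_def p1_def twou_def q0_def zero_prod_def prod_eq_iff)
    qed
    finally show ?thesis ..
  qed
  have sm10: "smul S (p1 q) (p0 w) = - p1 (br w q)" if w: "w \<in> cycles" and q: "q \<in> exact_cycles" for w q
    using sm01[OF w q] via10[of "p0 w" "p1 q"] w q cyclesD exact_cyclesD linmap_mem[OF p0_lin] linmap_mem[OF p1_lin]
    by metis
  \<comment> \<open>The odd product on preimages under \<open>d\<close>. The fact \<open>Phi_0\<close> exhibits a primitive of \<open>Phi x y\<close> when
      one of the arguments lies in \<open>im d + ker d\<close>.\<close>
  define Phi where "Phi = (\<lambda>x y. br (d x) y - br x (d y))"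
  have Phi_car: "Phi x y \<in> car A" if "x \<in> car A" "y \<in> car A" for x y
    using that by (simp add: Phi_def)
  have Phi_add: "Phi (x + x') y = Phi x y + Phi x' y" "Phi y (x + x') = Phi y x + Phi y x'"
    if "x \<in> car A" "x' \<in> car A" "y \<in> car A" for x x' y
    using that by (simp_all add: Phi_def br_simps d_simps)
  have Phi_0: "p0 (Phi (d r + k) y) = 0" "p0 (Phi y (d r + k)) = 0"
    if k: "k \<in> cycles" and r: "r \<in> car A" and y: "y \<in> car A" "d (d y) = 0" for k r y
  proof -
    note kc = cyclesD[OF k]
    have "Phi (d r + k) y = d (br (d r) y - br r (d y) - br r (d y) - br k y)"
      using kc r y by (simp add: Phi_def d_simps leibniz br_simps)
    then show "p0 (Phi (d r + k) y) = 0" using kc r y by (simp add: p0_d)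
    have "Phi y (d r + k) = d (br (d y) r + br (d y) r - br y (d r) + br y k)"
      using kc r y by (simp add: Phi_def d_simps leibniz br_simps)
    then show "p0 (Phi y (d r + k)) = 0" using kc r y by (simp add: p0_d)
  qed
  have sm11: "smul S (p1 (d x)) (p1 (d y)) = p0 (br (d x) y - br x (d y))"
    if x: "x \<in> car A" "d (d x) = 0" and y: "y \<in> car A" "d (d y) = 0" for x y
  proof -
    \<comment> \<open>A preimage under \<open>d\<close> of an element of \<open>ker d \<inter> im d\<close> is of the form \<open>v \<otimes> o\<close> up to
        \<open>im d + ker d\<close>: since \<open>u \<otimes> o\<close> represents the same class, the difference of the
        two images is some \<open>d (d r)\<close>.\<close>
    have dec: "\<exists>r\<in>car A. \<exists>k\<in>cycles. x = twov (p1 (d x)) + (d r + k) \<and> p1 (d x) \<in> S1"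
      if x: "x \<in> car A" "d (d x) = 0" for x
    proof -
      have S1: "p1 (d x) \<in> S1" using x linmap_mem[OF p1_lin] by simp
      define v where "v = twov (p1 (d x))"
      note v = twov[OF S1, folded v_def] twou[OF S1]
      have dx: "d x \<in> exact_cycles" using x by (auto simp: exact_cycles_def cycles_def)
      have "d (x - v) = d x - twou (p1 (d x))" using x v by (simp add: d_simps)
      then have "d (x - v) \<in> exact_cycles" using dx v exact_cycles_closed by simp
      moreover have "p1 (d (x - v)) = 0"
      proof -
        have "twou (p1 (d x)) \<in> car A" using v(1,2) by (metis car_closed(6))
        then have "p1 (d x - twou (p1 (d x))) = p1 (d x) - p1 (twou (p1 (d x)))"
          using x by (intro linmap_diff[OF p1_lin]) auto
        then show ?thesis using \<open>d (x - v) = _\<close> v(4) by simp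
      qed
      ultimately have "d (x - v) \<in> (d \<circ> d) ` car A" by (rule p1_ker)
      then obtain r where r: "r \<in> car A" "d (x - v) = d (d r)" by auto
      then have "x - v - d r \<in> cycles"
        using x v(1) by (simp add: cycles_def d_simps)
      moreover have "x = v + (d r + (x - v - d r))" by simp
      ultimately show ?thesis using r S1 unfolding v_def by blast
    qed
    define x0 y0 where "x0 = twov (p1 (d x))" and "y0 = twov (p1 (d y))"
    obtain r k where rk: "r \<in> car A" "k \<in> cycles" "x = x0 + (d r + k)" "p1 (d x) \<in> S1"
      using dec[OF x] unfolding x0_def by blast
    obtain r' k' where rk': "r' \<in> car A" "k' \<in> cycles" "y = y0 + (d r' + k')" "p1 (d y) \<in> S1"
      using dec[OF y] unfolding y0_def by blast
    note tx = twov[OF rk(4), folded x0_def] and ty = twov[OF rk'(4), folded y0_def]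
    have c: "d r + k \<in> car A" "d r' + k' \<in> car A" using rk rk' cyclesD by auto
    have "p0 (Phi x y) = p0 (Phi x0 y + Phi (d r + k) y)"
      using Phi_add(1)[of x0 "d r + k" y] rk(3) tx(1) c y by simp
    also have "\<dots> = p0 (Phi x0 y)"
      using Phi_0(1)[OF rk(2,1) y] tx(1) c y by (simp add: linmap_add[OF p0_lin] Phi_car)
    also have "\<dots> = p0 (Phi x0 y0 + Phi x0 (d r' + k'))"
      using Phi_add(2)[of y0 "d r' + k'" x0] rk'(3) tx(1) ty(1) c by simp
    also have "\<dots> = p0 (Phi x0 y0)"
      using Phi_0(2)[OF rk'(2,1), of x0] tx ty(1) c by (simp add: linmap_add[OF p0_lin] Phi_car)
    also have "\<dots> = smul S (p1 (d x)) (p1 (d y))"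
      using via11[OF rk(4) rk'(4), folded x0_def y0_def] tx(2) ty(2) by (simp add: Phi_def p0_def)
    finally show ?thesis by (simp add: Phi_def)
  qed
  have sub: "cycles \<subseteq> car A" "exact_cycles \<subseteq> car A" "exact_cycles \<subseteq> cycles" using cyclesD exact_cyclesD by auto
  have lin: "linmap (scl A) cycles (sscl S) S0 p0" "linmap (scl A) exact_cycles (sscl S) S1 p1"
    using p0_lin p1_lin sub unfolding linmap_def by blast+
  have im0: "p0 ` cycles = S0" using one linmap_mem[OF lin(1)] by force
  have im1: "p1 ` exact_cycles = S1" using twou twov(4) linmap_mem[OF lin(2)] by force
  have ker0: "\<forall>w\<in>cycles. p0 w = 0 \<longleftrightarrow> w \<in> d ` car A" using p0_ker p0_d by blast
  have ker1: "\<forall>w\<in>exact_cycles. p1 w = 0 \<longleftrightarrow> w \<in> (d \<circ> d) ` car A" using p1_ker p1_dd by auto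
  have "subquotient_model S p0 p1"
    unfolding subquotient_model_def S0_def[symmetric] S1_def[symmetric]
    by (intro conjI lin im0 im1 ker0 ker1 ballI allI impI sm00 sm01 sm10 sm11)
  then show ?thesis by blast
qed

end

section \<open>The two brackets over a differential ring of characteristic 3\<close>

locale differential_ring3 =
  fixes D :: "'a::comm_ring_1 \<Rightarrow> 'a"
  assumes D_add: "D (x + y) = D x + D y"
    and D_mult: "D (x * y) = D x * y + x * D y"
    and three: "(3::'a) = 0"
begin

lemma D_zero: "D 0 = 0"
  using D_add[of 0 0] by simp

lemma D_minus: "D (- x) = - D x"
  using D_add[of x "- x"] by (simp add: D_zero eq_neg_iff_add_eq_0 add.commute)

lemma D_diff: "D (x - y) = D x - D y"
  using D_add[of x "- y"] by (simp add: D_minus)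

lemmas D_simps = D_zero D_add D_mult D_minus D_diff

text \<open>
  The bracket of the Frank algebra over a differential ring. The tuple \<open>(p1, p2, a, b, c, f)\<close>
  stands for \<open>u \<otimes> p1 + v \<otimes> p2\<close>, plus the matrix with rows \<open>(a, b)\<close> and \<open>(c, -a)\<close> with respect to
  \<open>u, v\<close>, plus \<open>Id \<otimes> f\<partial>\<close>. The coefficients \<open>2\<close> that occur in the off-diagonal entries of a
  commutator and of \<open>\<phi>\<close> are written as \<open>-1\<close>.
\<close>

fun frank_br where
  "frank_br (p1, p2, a, b, c, f) (q1, q2, a', b', c', g) =
     (D (f * q1) - D (g * p1) + (a * q1 + b * q2) - (a' * p1 + b' * p2),
      D (f * q2) - D (g * p2) + (c * q1 - a * q2) - (c' * p1 - a' * p2),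
      (b * c' - b' * c) + f * D a' - g * D a - (p2 * D q1 + p1 * D q2) + (D p2 * q1 + D p1 * q2),
      (b * a' - a * b') + f * D b' - g * D b - p1 * D q1 + D p1 * q1,
      (a * c' - c * a') + f * D c' - g * D c + p2 * D q2 - D p2 * q2,
      f * D g - g * D f + (p1 * q2 - p2 * q1))"

lemma triple: "x + x + x = (0::'a)" "x + (x + x) = (0::'a)" "x + (x + (x + y)) = (y::'a)"
proof -
  have "x + x + x = 3 * x" by (simp add: algebra_simps)
  then show *: "x + x + x = (0::'a)" by (simp add: three)
  then show "x + (x + x) = (0::'a)" "x + (x + (x + y)) = y" by (simp_all add: add.assoc[symmetric])
qed

text \<open>
  The cyclic sum is not formally zero. The coefficients of the terms that survive cancellation are
  divisible by 3, and \<open>triple\<close> removes these terms.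
\<close>

lemma frank_br_jacobi: "frank_br X (frank_br Y Z) + frank_br Y (frank_br Z X) + frank_br Z (frank_br X Y) = 0"
proof -
  obtain p1 p2 a1 b1 c1 f1 where X: "X = (p1, p2, a1, b1, c1, f1)" by (cases X)
  obtain q1 q2 a2 b2 c2 f2 where Y: "Y = (q1, q2, a2, b2, c2, f2)" by (cases Y)
  obtain r1 r2 a3 b3 c3 f3 where Z: "Z = (r1, r2, a3, b3, c3, f3)" by (cases Z)
  show ?thesis unfolding X Y Z frank_br.simps D_simps plus_prod_def fst_conv snd_conv zero_prod_def prod.inject
    by (intro conjI; simp add: algebra_simps three triple)
qed

lemma frank_br_add: "frank_br (X + X') Y = frank_br X Y + frank_br X' Y" "frank_br X (Y + Y') = frank_br X Y + frank_br X Y'"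
  by (cases X; cases X'; cases Y; simp add: D_simps algebra_simps)
     (cases X; cases Y; cases Y'; simp add: D_simps algebra_simps)

lemma frank_br_alternating: "frank_br X X = 0"
  by (cases X) (simp add: zero_prod_def D_simps algebra_simps)

text \<open>
  The operator \<open>ad (e \<otimes> 1)\<close>. On \<open>sl(U)\<close> it is the Jordan block \<open>c \<mapsto> a \<mapsto> b\<close> of length 3;
  the last arrow carries the factor \<open>-2 = 1\<close>.
\<close>

fun ad_e :: "'a \<times> 'a \<times> 'a \<times> 'a \<times> 'a \<times> 'a \<Rightarrow> 'a \<times> 'a \<times> 'a \<times> 'a \<times> 'a \<times> 'a" where
  "ad_e (p, q, a, b, c, f) = (q, 0, c, a, 0, 0)"

lemma D_1: "D 1 = 0"
  using D_mult[of 1 1] by simp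

lemma frank_br_e: "frank_br (0, 0, 0, 1, 0, 0) X = ad_e X"
  by (cases X) (simp add: D_simps D_1)

lemma ad_e_derivation: "ad_e (frank_br X Y) = frank_br (ad_e X) Y + frank_br X (ad_e Y)"
  by (cases X; cases Y) (simp add: D_simps algebra_simps three triple)

text \<open>
  \<open>contact_op (f, g)\<close> is the action of \<open>D\<^sub>K(f + g\<theta>)\<close> on a function \<open>h + k\<theta>\<close>, with \<open>2f = -f\<close>.
  \<open>contact_br\<close> is the contact bracket: even arguments give \<open>2(f\<partial>(f') - f'\<partial>(f))\<close>, odd
  ones \<open>g g'\<close>, and in mixed degree it is up to sign the divergence action \<open>\<partial>(f g)\<close>.
\<close>

fun contact_op :: "'a \<times> 'a \<Rightarrow> 'a \<times> 'a \<Rightarrow> 'a \<times> 'a" where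
  "contact_op (f, g) (h, k) = (g * k - f * D h, g * D h + D f * k - f * D k)"

fun contact_br :: "'a \<times> 'a \<Rightarrow> 'a \<times> 'a \<Rightarrow> 'a \<times> 'a" where
  "contact_br (f, g) (f', g') = (f' * D f - f * D f' + g * g', D (f' * g) - D (f * g'))"

text \<open>
  The left-hand side is the supercommutator, expanded into the homogeneous components of the two
  operators. Beyond the convention \<open>2 = -1\<close>, the identity needs \<open>3 = 0\<close> in mixed degree, where the
  generator of the commutator is
  \<open>2f\<partial>(g') - g'\<partial>(f)\<close> and has to be recognised as \<open>-\<partial>(f g')\<close>.
\<close>

lemma contact_op_supercomm:
  "contact_op (f, g) (contact_op (f', g') H) - contact_op (f', 0) (contact_op (f, 0) H) - contact_op (f', 0) (contact_op (0, g) H)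
     - contact_op (0, g') (contact_op (f, 0) H) + contact_op (0, g') (contact_op (0, g) H) = contact_op (contact_br (f, g) (f', g')) H"
  by (cases H) (simp add: D_simps algebra_simps three triple)

lemma contact_op_0: "contact_op 0 H = 0" "contact_op F 0 = 0"
  by (cases H; simp add: zero_prod_def D_simps) (cases F; simp add: zero_prod_def D_simps)

lemma contact_op_add: "contact_op (F + F') H = contact_op F H + contact_op F' H"
  by (cases F; cases F'; cases H) (simp add: D_simps algebra_simps)

lemma contact_br_add: "contact_br (F + F') G = contact_br F G + contact_br F' G" "contact_br F (G + G') = contact_br F G + contact_br F G'"
  by (cases F; cases F'; cases G; simp add: D_simps algebra_simps)
     (cases F; cases G; cases G'; simp add: D_simps algebra_simps)

end

section \<open>Divided power series\<close>

text \<open>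
  The completed divided power algebra, with elements \<open>\<Sum>i. F\<^sub>i x\<^sup>(\<^sup>i\<^sup>)\<close>. It is a commutative ring with a
  derivation over any commutative base ring. In characteristic \<open>p\<close> it is not the ring of formal
  power series, since the \<open>p\<close>-th power of \<open>x\<^sup>(\<^sup>1\<^sup>)\<close> is \<open>p! x\<^sup>(\<^sup>p\<^sup>) = 0\<close>.
\<close>

typedef 'a dpow = "UNIV :: (nat \<Rightarrow> 'a) set"
  morphisms dp_coeff Dpow ..

lemma coeff_Dpow [simp]: "dp_coeff (Dpow f) = f"
  by (simp add: Dpow_inverse)

lemma dpow_eqI: "(\<And>i. dp_coeff F i = dp_coeff G i) \<Longrightarrow> F = G"
  by (simp add: dp_coeff_inject[symmetric] fun_eq_iff)

instantiation dpow :: (comm_ring_1) comm_ring_1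
begin

definition "0 = Dpow (\<lambda>_. 0)"
definition "1 = Dpow (\<lambda>i. if i = 0 then 1 else 0)"
definition "F + G = Dpow (\<lambda>i. dp_coeff F i + dp_coeff G i)"
definition "F - G = Dpow (\<lambda>i. dp_coeff F i - dp_coeff G i)"
definition "- F = Dpow (\<lambda>i. - dp_coeff F i)"
definition "F * G = Dpow (\<lambda>k. \<Sum>i\<le>k. of_nat (k choose i) * (dp_coeff F i * dp_coeff G (k - i)))"

lemma coeff_ring_ops:
  "dp_coeff (0 :: 'a dpow) = (\<lambda>_. 0)"
  "dp_coeff (1 :: 'a dpow) = (\<lambda>i. if i = 0 then 1 else 0)"
  "dp_coeff (F + G) = (\<lambda>i. dp_coeff F i + dp_coeff G i)"
  "dp_coeff (F - G) = (\<lambda>i. dp_coeff F i - dp_coeff G i)"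
  "dp_coeff (- F) = (\<lambda>i. - dp_coeff F i)"
  "dp_coeff (F * G) = (\<lambda>k. \<Sum>i\<le>k. of_nat (k choose i) * (dp_coeff F i * dp_coeff G (k - i)))"
  for F G :: "'a dpow"
  by (simp_all add: zero_dpow_def one_dpow_def plus_dpow_def minus_dpow_def uminus_dpow_def
      times_dpow_def)

instance
proof
  fix F G H :: "'a dpow"
  show comm: "F * G = G * F" for F G :: "'a dpow"
  proof (rule dpow_eqI)
    fix k
    show "dp_coeff (F * G) k = dp_coeff (G * F) k"
      unfolding coeff_ring_ops
      by (rule sum.reindex_bij_witness[of _ "\<lambda>i. k - i" "\<lambda>i. k - i"])
         (auto simp: mult.commute binomial_symmetric[symmetric])
  qed
  show "F * G * H = F * (G * H)"
  proof (rule dpow_eqI)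
    fix k
    let ?t = "\<lambda>a b c. of_nat (k choose a) * of_nat (k - a choose b) * (dp_coeff F a * dp_coeff G b * dp_coeff H c)"
    have "dp_coeff (F * G * H) k =
      (\<Sum>i\<le>k. \<Sum>j\<le>i. of_nat (k choose i) * of_nat (i choose j) * (dp_coeff F j * dp_coeff G (i - j) * dp_coeff H (k - i)))"
      by (simp add: coeff_ring_ops sum_distrib_left sum_distrib_right mult_ac)
    also have "\<dots> = (\<Sum>i\<le>k. \<Sum>j\<le>i. ?t j (i - j) (k - i))"
    proof (intro sum.cong refl)
      fix i j assume "i \<in> {..k}" "j \<in> {..i}"
      then have "(k choose i) * (i choose j) = (k choose j) * (k - j choose (i - j))"
        by (intro choose_mult) auto
      then have "of_nat (k choose i) * of_nat (i choose j) = (of_nat (k choose j) * of_nat (k - j choose (i - j)) :: 'a)"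
        unfolding of_nat_mult[symmetric] by simp
      then show "of_nat (k choose i) * of_nat (i choose j) * (dp_coeff F j * dp_coeff G (i - j) * dp_coeff H (k - i))
        = ?t j (i - j) (k - i)" by simp
    qed
    also have "\<dots> = (\<Sum>j\<le>k. \<Sum>i\<le>k - j. ?t j i (k - j - i))"
      using fps_mult_assoc_lemma[of ?t k k] by (simp add: atLeast0AtMost)
    also have "\<dots> = dp_coeff (F * (G * H)) k"
      by (simp add: coeff_ring_ops sum_distrib_left sum_distrib_right mult_ac)
    finally show "dp_coeff (F * G * H) k = dp_coeff (F * (G * H)) k" .
  qed
  show "(F + G) * H = F * H + G * H"
    by (rule dpow_eqI) (simp add: coeff_ring_ops algebra_simps sum.distrib)
  show "1 * F = F"
  proof (rule dpow_eqI)
    fix k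
    have "dp_coeff (1 * F) k = (\<Sum>i\<le>k. if i = 0 then dp_coeff F k else 0)"
      unfolding coeff_ring_ops by (rule sum.cong) auto
    then show "dp_coeff (1 * F) k = dp_coeff F k" by (simp add: sum.delta)
  qed
  show "(0::'a dpow) \<noteq> 1"
    by (metis coeff_ring_ops(1,2) zero_neq_one)
qed (rule dpow_eqI; simp add: coeff_ring_ops algebra_simps)+

end

definition dpow_deriv :: "'a dpow \<Rightarrow> 'a dpow" where
  "dpow_deriv F = Dpow (dp_deriv (dp_coeff F))"

definition dpow_const :: "'a::zero \<Rightarrow> 'a dpow" where
  "dpow_const c = Dpow (\<lambda>i. if i = 0 then c else 0)"

lemma coeff_deriv: "dp_coeff (dpow_deriv F) i = dp_coeff F (Suc i)"
  by (simp add: dpow_deriv_def dp_deriv_def)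

lemma coeff_const_mult: "dp_coeff (dpow_const c * F) i = c * dp_coeff F i"
proof -
  have "dp_coeff (dpow_const c * F) i = (\<Sum>j\<le>i. if j = 0 then c * dp_coeff F i else 0)"
    unfolding coeff_ring_ops dpow_const_def coeff_Dpow by (rule sum.cong) auto
  then show ?thesis by (simp add: sum.delta)
qed

lemma dpow_deriv_const: "dpow_deriv (dpow_const c) = 0"
  by (rule dpow_eqI) (simp add: coeff_ring_ops coeff_deriv dpow_const_def coeff_Dpow)

lemma dpow_deriv_mult:
  fixes F G :: "'a::comm_ring_1 dpow"
  shows "dpow_deriv (F * G) = dpow_deriv F * G + F * dpow_deriv G"
proof (rule dpow_eqI)
  fix k
  let ?t = "\<lambda>i. dp_coeff F i * dp_coeff G (Suc k - i)"
  have "dp_coeff (dpow_deriv (F * G)) k = (\<Sum>i\<le>Suc k. of_nat (Suc k choose i) * ?t i)"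
    by (simp add: coeff_deriv coeff_ring_ops(6))
  also have "\<dots> = ?t 0 + (\<Sum>i\<le>k. of_nat (Suc k choose Suc i) * ?t (Suc i))"
    by (subst sum.atMost_Suc_shift) simp
  also have "(\<Sum>i\<le>k. of_nat (Suc k choose Suc i) * ?t (Suc i)) =
      (\<Sum>i\<le>k. of_nat (k choose i) * ?t (Suc i)) + (\<Sum>i\<le>k. of_nat (k choose Suc i) * ?t (Suc i))"
    by (simp add: algebra_simps sum.distrib)
  also have "?t 0 + (\<dots>) = (\<Sum>i\<le>k. of_nat (k choose i) * ?t (Suc i)) + (\<Sum>i\<le>Suc k. of_nat (k choose i) * ?t i)"
    unfolding sum.atMost_Suc_shift[of "\<lambda>i. of_nat (k choose i) * ?t i"] by (simp add: algebra_simps)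
  also have "(\<Sum>i\<le>Suc k. of_nat (k choose i) * ?t i) = (\<Sum>i\<le>k. of_nat (k choose i) * ?t i)"
    by (simp add: binomial_eq_0)
  also have "\<dots> = (\<Sum>i\<le>k. of_nat (k choose i) * (dp_coeff F i * dp_coeff G (Suc (k - i))))"
    by (intro sum.cong refl) (simp add: Suc_diff_le)
  finally show "dp_coeff (dpow_deriv (F * G)) k = dp_coeff (dpow_deriv F * G + F * dpow_deriv G) k"
    by (simp add: coeff_deriv coeff_ring_ops)
qed

lemma three_eq_zero:
  assumes "CHAR('k::field) = 3"
  shows "(3::'k) = 0"
  using of_nat_CHAR[where 'a = 'k] assms by simp

lemma differential_ring3_dpow:
  assumes "CHAR('k::field) = 3"
  shows "differential_ring3 (dpow_deriv :: 'k dpow \<Rightarrow> 'k dpow)"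
proof
  show "dpow_deriv (F + G) = dpow_deriv F + dpow_deriv G" for F G :: "'k dpow"
    by (rule dpow_eqI) (simp add: coeff_deriv coeff_ring_ops)
  have "(1::'k dpow) + 1 + 1 = 0"
    using three_eq_zero[OF assms] by (intro dpow_eqI) (simp only: coeff_ring_ops, simp)
  then show "(3::'k dpow) = 0" by simp
qed (rule dpow_deriv_mult)

text \<open>
  The copy of \<open>\<O>(1;n)\<close> among the divided power series.
\<close>

definition trunc :: "nat \<Rightarrow> 'a::zero dpow set" where
  "trunc n = {F. dp_coeff F \<in> dp_space n UNIV}"

text \<open>
  Adding \<open>i\<close> and \<open>j\<close> in base \<open>p\<close> produces a carry. Concretely, write \<open>i + j = p\<^sup>n + r\<close> with
  \<open>r < i\<close> and apply the Vandermonde convolution: \<open>p\<close> divides \<open>p\<^sup>n choose l\<close> for \<open>0 < l < p\<^sup>n\<close>, and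
  the term for \<open>l = 0\<close> vanishes because \<open>r < i\<close>.
\<close>

lemma prime_dvd_binomial_of_sum_lt_power:
  fixes p :: nat
  assumes "prime p" "i < p ^ n" "j < p ^ n" "p ^ n \<le> i + j"
  shows "p dvd (i + j choose i)"
proof -
  have dvd_choose: "p dvd (p ^ n choose l)" if "0 < l" "l < p ^ n" for l
  proof (rule ccontr)
    assume "\<not> p dvd (p ^ n choose l)"
    then have "coprime (p ^ n) (p ^ n choose l)"
      using \<open>prime p\<close> by (simp add: prime_imp_coprime)
    moreover have "p ^ n dvd l * (p ^ n choose l)"
      using that times_binomial_minus1_eq[of l "p ^ n"] by simp
    ultimately have "p ^ n dvd l"
      by (simp add: coprime_dvd_mult_left_iff)
    then show False using that by (auto dest: dvd_imp_le)
  qed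
  define r where "r = i + j - p ^ n"
  have ij: "i + j = p ^ n + r" and "r < i"
    using assms(3,4) by (auto simp: r_def)
  have "p dvd (\<Sum>l\<le>i. (p ^ n choose l) * (r choose (i - l)))"
  proof (rule dvd_sum)
    fix l assume l: "l \<in> {..i}"
    show "p dvd (p ^ n choose l) * (r choose (i - l))"
    proof (cases "l = 0")
      case True
      then show ?thesis using \<open>r < i\<close> by (simp add: binomial_eq_0)
    next
      case False
      then show ?thesis using dvd_choose[of l] l assms(2) by simp
    qed
  qed
  then show ?thesis unfolding ij by (simp add: vandermonde)
qed

text \<open>
  In characteristic 3 the truncation in the product of \<open>\<O>(1;n)\<close> discards only terms that are zero
  anyway, so \<open>\<O>(1;n)\<close> is a subring.
\<close>

lemma dp_mult_coeff:
  assumes "CHAR('k::field) = 3" "F \<in> trunc n" "G \<in> trunc n"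
  shows "dp_mult n (dp_coeff F) (dp_coeff G) = dp_coeff (F * G :: 'k dpow)"
proof
  fix k
  have "dp_coeff (F * G) k = 0" if k: "k \<ge> 3 ^ n"
  proof -
    have "of_nat (k choose i) * (dp_coeff F i * dp_coeff G (k - i)) = 0" if i: "i \<le> k" for i
    proof (cases "i < 3 ^ n \<and> k - i < 3 ^ n")
      case True
      with i k have "3 dvd (k choose i)"
        using prime_dvd_binomial_of_sum_lt_power[of 3 i n "k - i"] by simp
      then have "of_nat (k choose i) = (0::'k)"
        using assms(1) by (simp add: of_nat_eq_0_iff_char_dvd)
      then show ?thesis by simp
    next
      case False
      then show ?thesis using assms(2,3) by (auto simp: trunc_def dp_space_def)
    qed
    then show ?thesis unfolding coeff_ring_ops by (intro sum.neutral) simp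
  qed
  then show "dp_mult n (dp_coeff F) (dp_coeff G) k = dp_coeff (F * G) k"
    by (auto simp: dp_prod_def coeff_ring_ops)
qed

lemma trunc_mult:
  assumes "CHAR('k::field) = 3" "F \<in> trunc n" "G \<in> trunc n"
  shows "(F * G :: 'k dpow) \<in> trunc n"
  using dp_mult_coeff[OF assms] unfolding trunc_def dp_space_def
  by (auto simp: dp_prod_def fun_eq_iff) (metis not_less)

lemma trunc_closed:
  "0 \<in> trunc n" "1 \<in> trunc n"
  "F \<in> trunc n \<Longrightarrow> G \<in> trunc n \<Longrightarrow> F + G \<in> trunc n"
  "F \<in> trunc n \<Longrightarrow> G \<in> trunc n \<Longrightarrow> F - G \<in> trunc n"
  "F \<in> trunc n \<Longrightarrow> - F \<in> trunc n"
  "F \<in> trunc n \<Longrightarrow> dpow_deriv F \<in> trunc n"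
  "F \<in> trunc n \<Longrightarrow> dpow_const c * F \<in> trunc n"
  for F G :: "'k::comm_ring_1 dpow"
  by (auto simp: trunc_def dp_space_def coeff_const_mult coeff_ring_ops(1-5) coeff_deriv)

section \<open>The Frank algebra in coordinates\<close>

type_synonym 'a coords = "'a dpow \<times> 'a dpow \<times> 'a dpow \<times> 'a dpow \<times> 'a dpow \<times> 'a dpow"

text \<open>
  The vectors \<open>u, v\<close> form a symplectic basis, with coordinate functions \<open>lam _ v\<close> and \<open>lam u _\<close>.
\<close>

locale symplectic_basis =
  fixes s :: "'k::field \<Rightarrow> 'u::ab_group_add \<Rightarrow> 'u"
    and lam :: "'u \<Rightarrow> 'u \<Rightarrow> 'k" and u v :: 'u
  assumes char3: "CHAR('k) = 3"
    and plane: "symplectic_plane s lam"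
    and spans: "module.span s {u, v} = UNIV"
    and lam_uv: "lam u v = 1"
begin

lemma vs: "vector_space s"
  using plane unfolding symplectic_plane_def by blast

sublocale vector_space s by (rule vs)

lemma vs_field: "vector_space ((*) :: 'k \<Rightarrow> 'k \<Rightarrow> 'k)"
  by unfold_locales (auto simp: algebra_simps)

lemma lam_linear: "Vector_Spaces.linear s (*) (lam x)" "Vector_Spaces.linear s (*) (\<lambda>x. lam x y)"
  using plane unfolding symplectic_plane_def by blast+

lemma lam_simps [simp]:
  "lam 0 y = 0" "lam x 0 = 0"
  "lam (x + x') y = lam x y + lam x' y" "lam x (y + y') = lam x y + lam x y'"
  "lam (x - x') y = lam x y - lam x' y" "lam x (y - y') = lam x y - lam x y'"
  "lam (s c x) y = c * lam x y" "lam x (s c y) = c * lam x y"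
proof -
  interpret L: Vector_Spaces.linear s "(*)" "lam x" for x by (rule lam_linear)
  interpret R: Vector_Spaces.linear s "(*)" "\<lambda>x. lam x y" for y by (rule lam_linear)
  show "lam 0 y = 0" "lam x 0 = 0" "lam (x + x') y = lam x y + lam x' y"
    "lam x (y + y') = lam x y + lam x y'"
    "lam (x - x') y = lam x y - lam x' y" "lam x (y - y') = lam x y - lam x y'"
    "lam (s c x) y = c * lam x y" "lam x (s c y) = c * lam x y"
    by (simp_all add: L.diff R.diff L.zero R.zero L.add R.add L.scale R.scale)
qed

lemma three: "(3::'k) = 0"
  using char3 by (rule three_eq_zero)

lemma two_neq_0: "(2::'k) \<noteq> 0"
proof
  assume "(2::'k) = 0"
  moreover have "(3::'k) = 2 + 1" by simp
  ultimately show False using three by simp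
qed

lemma lam_basis [simp]: "lam u v = 1" "lam v u = - 1" "lam u u = 0" "lam v v = 0"
proof -
  have skew: "lam x y = - lam y x" for x y using plane unfolding symplectic_plane_def by blast
  have "2 * lam x x = 0" for x using skew[of x x] by (metis eq_neg_iff_add_eq_0 mult_2)
  then show "lam u u = 0" "lam v v = 0" using two_neq_0 by auto
  show "lam u v = 1" "lam v u = - 1" using lam_uv skew[of v u] by auto
qed

lemma lam_v_left: "lam v x = - lam x v"
  using plane unfolding symplectic_plane_def by blast

lemma expand: "x = s (lam x v) u + s (lam u x) v"
proof -
  have "x \<in> span {u, v}" by (simp add: spans)
  then obtain a b where "x = s a u + s b v"
    unfolding span_insert span_empty by (auto simp: diff_eq_eq add.commute)
  then show ?thesis by simp
qed

lemma eqI: "x = y" if "lam x v = lam y v" "lam u x = lam u y"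
  using expand[of x] expand[of y] that by simp

definition sl_mat :: "'k \<Rightarrow> 'k \<Rightarrow> 'k \<Rightarrow> 'u \<Rightarrow> 'u" where
  "sl_mat a b c = (\<lambda>x. s (a * lam x v + b * lam u x) u + s (c * lam x v - a * lam u x) v)"

lemma lin_trace_eq:
  assumes "Vector_Spaces.linear s s f"
  shows "lin_trace s UNIV f = lam (f u) v + lam u (f v)"
proof -
  interpret f: Vector_Spaces.linear s s f by fact
  have "f x = s (lam x v) (f u) + s (lam u x) (f v)" for x
    by (subst expand[of x]) (simp only: f.add f.scale)
  from lin_trace_rank_le_2[OF vs subspace_UNIV, of "{u, v}" "\<lambda>x. lam x v" "lam u", OF _ _ lam_linear(2,1) _ _ this]
  show ?thesis by (simp add: spans)
qed

lemma mat_linear: "Vector_Spaces.linear s s (sl_mat a b c)"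
  unfolding Vector_Spaces.linear_iff using vs
  by (auto simp: sl_mat_def algebra_simps scale_left_distrib scale_right_distrib)

lemma mat_in_sl: "sl_mat a b c \<in> sl s"
  by (simp add: sl_def mat_linear lin_trace_eq) (simp add: sl_mat_def)

lemma mat_entries:
  "lam (sl_mat a b c u) v = a" "lam (sl_mat a b c v) v = b" "lam u (sl_mat a b c u) = c"
  by (simp_all add: sl_mat_def)

lemma sl_eq_sl_mat:
  assumes "A \<in> sl s"
  shows "A = sl_mat (lam (A u) v) (lam (A v) v) (lam u (A u))"
proof
  fix x
  from assms have lin: "Vector_Spaces.linear s s A" by (simp add: sl_def)
  interpret A: Vector_Spaces.linear s s A by fact
  have tr: "lam u (A v) = - lam (A u) v"
    using assms lin_trace_eq[OF lin] by (simp add: sl_def eq_neg_iff_add_eq_0 add.commute)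
  have "A x = s (lam x v) (A u) + s (lam u x) (A v)"
    by (subst expand[of x]) (simp only: A.add A.scale)
  then show "A x = sl_mat (lam (A u) v) (lam (A v) v) (lam u (A u)) x"
    by (intro eqI) (simp_all add: sl_mat_def tr algebra_simps)
qed

lemma mat_eqI: "A \<in> sl s \<Longrightarrow> lam (A u) v = a \<Longrightarrow> lam (A v) v = b \<Longrightarrow> lam u (A u) = c \<Longrightarrow> A = sl_mat a b c"
  using sl_eq_sl_mat by metis

definition u_part :: "'k dpow \<Rightarrow> 'k dpow \<Rightarrow> nat \<Rightarrow> 'u" where
  "u_part p q = (\<lambda>i. s (dp_coeff p i) u + s (dp_coeff q i) v)"

definition sl_part :: "'k dpow \<Rightarrow> 'k dpow \<Rightarrow> 'k dpow \<Rightarrow> nat \<Rightarrow> 'u \<Rightarrow> 'u" where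
  "sl_part a b c = (\<lambda>i. sl_mat (dp_coeff a i) (dp_coeff b i) (dp_coeff c i))"

fun frank_of :: "'k coords \<Rightarrow> ('k, 'u) frank" where
  "frank_of (p, q, a, b, c, f) = (u_part p q, sl_part a b c, dp_coeff f)"

definition trunc_coords :: "nat \<Rightarrow> 'k coords set" where
  "trunc_coords n = trunc n \<times> trunc n \<times> trunc n \<times> trunc n \<times> trunc n \<times> trunc n"

sublocale dpow: differential_ring3 "dpow_deriv :: 'k dpow \<Rightarrow> 'k dpow"
  using char3 by (rule differential_ring3_dpow)

text \<open>
  The scalar part of \<^const>\<open>dp_prod\<close>, for an arbitrary array \<open>\<alpha> i j\<close> in place of \<open>F i * G j\<close>.
  Being additive in \<open>\<alpha>\<close>, it turns a coordinate formula for a bilinear map \<open>m\<close> into one for its divided power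
  extension \<open>dp_prod n s m\<close>.
\<close>

definition binomial_conv :: "nat \<Rightarrow> (nat \<Rightarrow> nat \<Rightarrow> 'k) \<Rightarrow> nat \<Rightarrow> 'k" where
  "binomial_conv n \<alpha> k = (if k < 3 ^ n then \<Sum>i\<le>k. of_nat (k choose i) * \<alpha> i (k - i) else 0)"

lemma binomial_conv_mult:
  assumes "f \<in> trunc n" "g \<in> trunc n"
  shows "binomial_conv n (\<lambda>i j. dp_coeff f i * dp_coeff g j) = dp_coeff (f * g)"
  using dp_mult_coeff[OF char3 assms] by (simp add: binomial_conv_def dp_prod_def fun_eq_iff)

lemma binomial_conv_add: "binomial_conv n (\<lambda>i j. \<alpha> i j + \<beta> i j) = (\<lambda>k. binomial_conv n \<alpha> k + binomial_conv n \<beta> k)"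
  and binomial_conv_diff: "binomial_conv n (\<lambda>i j. \<alpha> i j - \<beta> i j) = (\<lambda>k. binomial_conv n \<alpha> k - binomial_conv n \<beta> k)"
  and binomial_conv_minus: "binomial_conv n (\<lambda>i j. - \<alpha> i j) = (\<lambda>k. - binomial_conv n \<alpha> k)"
  by (auto simp: binomial_conv_def fun_eq_iff sum.distrib sum_subtractf sum_negf algebra_simps)

lemma dp_prod_U:
  assumes "\<And>i j. m (F i) (G j) = s (\<alpha> i j) u + s (\<beta> i j) v"
  shows "dp_prod n s m F G = (\<lambda>k. s (binomial_conv n \<alpha> k) u + s (binomial_conv n \<beta> k) v)"
  using assms by (auto simp: dp_prod_def binomial_conv_def fun_eq_iff scale_sum_left scale_right_distrib sum.distrib)

lemma mat_0: "sl_mat 0 0 0 = 0"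
  by (simp add: sl_mat_def fun_eq_iff)

lemma mat_add: "sl_mat a b c + sl_mat a' b' c' = sl_mat (a + a') (b + b') (c + c')"
  by (auto simp: sl_mat_def fun_eq_iff algebra_simps scale_left_distrib scale_left_diff_distrib)

lemma mat_scale: "fun_scale s k (sl_mat a b c) = sl_mat (k * a) (k * b) (k * c)"
  by (auto simp: sl_mat_def fun_eq_iff fun_scale_def algebra_simps scale_right_distrib)

lemma mat_diff: "sl_mat a b c - sl_mat a' b' c' = sl_mat (a - a') (b - b') (c - c')"
  using mat_add[of "a - a'" "b - b'" "c - c'" a' b' c'] by (simp add: algebra_simps)

lemma mat_sum: "(\<Sum>i\<in>I. sl_mat (a i) (b i) (c i)) = sl_mat (sum a I) (sum b I) (sum c I)"
  by (induction I rule: infinite_finite_induct) (simp_all add: mat_0 mat_add)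

lemma dp_prod_sl:
  assumes "\<And>i j. m (F i) (G j) = sl_mat (\<alpha> i j) (\<beta> i j) (\<gamma> i j)"
  shows "dp_prod n (fun_scale s) m F G = (\<lambda>k. sl_mat (binomial_conv n \<alpha> k) (binomial_conv n \<beta> k) (binomial_conv n \<gamma> k))"
proof
  show "dp_prod n (fun_scale s) m F G k = sl_mat (binomial_conv n \<alpha> k) (binomial_conv n \<beta> k) (binomial_conv n \<gamma> k)" for k
    by (simp add: dp_prod_def binomial_conv_def assms mat_scale mat_sum mat_0)
qed

lemma dp_prod_field: "dp_prod n (*) m F G = binomial_conv n (\<lambda>i j. m (F i) (G j))" for m :: "'x \<Rightarrow> 'y \<Rightarrow> 'k"
  by (simp add: dp_prod_def binomial_conv_def fun_eq_iff)

lemmas binomial_conv_simps = binomial_conv_add binomial_conv_diff binomial_conv_minus binomial_conv_mult coeff_ring_ops(3-5)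

lemma u_part_scale:
  assumes "f \<in> trunc n" "p \<in> trunc n" "q \<in> trunc n"
  shows "dp_prod n s s (dp_coeff f) (u_part p q) = u_part (f * p) (f * q)"
proof -
  have "s (dp_coeff f i) (u_part p q j) = s (dp_coeff f i * dp_coeff p j) u + s (dp_coeff f i * dp_coeff q j) v" for i j
    by (simp add: u_part_def scale_right_distrib)
  from dp_prod_U[of s, OF this] show ?thesis
    using assms by (simp add: binomial_conv_simps u_part_def)
qed

lemma sl_part_u_part:
  assumes "a \<in> trunc n" "b \<in> trunc n" "c \<in> trunc n" "p \<in> trunc n" "q \<in> trunc n"
  shows "dp_prod n s (\<lambda>A x. A x) (sl_part a b c) (u_part p q) = u_part (a * p + b * q) (c * p - a * q)"
proof -
  have "sl_part a b c i (u_part p q j) = s (dp_coeff a i * dp_coeff p j + dp_coeff b i * dp_coeff q j) u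
      + s (dp_coeff c i * dp_coeff p j - dp_coeff a i * dp_coeff q j) v" for i j
    by (simp add: u_part_def sl_part_def sl_mat_def)
  from dp_prod_U[of "\<lambda>A x. A x" "sl_part a b c" "u_part p q", OF this] show ?thesis
    using assms by (simp add: binomial_conv_simps u_part_def)
qed

lemma sl_part_scale:
  assumes "f \<in> trunc n" "a \<in> trunc n" "b \<in> trunc n" "c \<in> trunc n"
  shows "dp_prod n (fun_scale s) (fun_scale s) (dp_coeff f) (sl_part a b c) = sl_part (f * a) (f * b) (f * c)"
proof -
  have "fun_scale s (dp_coeff f i) (sl_part a b c j) =
      sl_mat (dp_coeff f i * dp_coeff a j) (dp_coeff f i * dp_coeff b j) (dp_coeff f i * dp_coeff c j)" for i j
    by (simp add: sl_part_def mat_scale)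
  from dp_prod_sl[of "fun_scale s", OF this] show ?thesis
    using assms by (simp add: binomial_conv_simps sl_part_def)
qed

lemma mat_commutator: "(sl_mat a b c \<circ> sl_mat a' b' c') - (sl_mat a' b' c' \<circ> sl_mat a b c) =
  sl_mat (b * c' - b' * c) (b * a' - a * b') (a * c' - c * a')"
proof
  fix x
  show "((sl_mat a b c \<circ> sl_mat a' b' c') - (sl_mat a' b' c' \<circ> sl_mat a b c)) x =
    sl_mat (b * c' - b' * c) (b * a' - a * b') (a * c' - c * a') x"
    by (intro eqI) (simp_all add: sl_mat_def algebra_simps three)
qed

lemma frank_phi_coords:
  "frank_phi s lam (s p u + s q v) (s p' u + s q' v) =
    sl_mat (- (q * p' + p * q')) (- (p * p')) (q * q')"
proof
  fix x
  show "frank_phi s lam (s p u + s q v) (s p' u + s q' v) x = sl_mat (- (q * p' + p * q')) (- (p * p')) (q * q') x"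
    by (intro eqI) (simp_all add: sl_mat_def frank_phi_def lam_v_left[of x] algebra_simps three)
qed

lemma sl_part_commutator:
  assumes "a \<in> trunc n" "b \<in> trunc n" "c \<in> trunc n" "a' \<in> trunc n" "b' \<in> trunc n" "c' \<in> trunc n"
  shows "dp_prod n (fun_scale s) (\<lambda>A B. (A \<circ> B) - (B \<circ> A)) (sl_part a b c) (sl_part a' b' c') =
    sl_part (b * c' - b' * c) (b * a' - a * b') (a * c' - c * a')"
proof -
  let ?m = "\<lambda>A B. (A \<circ> B) - (B \<circ> A)"
  have "?m (sl_part a b c i) (sl_part a' b' c' j) =
      sl_mat (dp_coeff b i * dp_coeff c' j - dp_coeff c i * dp_coeff b' j)
          (dp_coeff b i * dp_coeff a' j - dp_coeff a i * dp_coeff b' j)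
          (dp_coeff a i * dp_coeff c' j - dp_coeff c i * dp_coeff a' j)" for i j
    by (simp add: sl_part_def mat_commutator mult.commute)
  from dp_prod_sl[of ?m "sl_part a b c" "sl_part a' b' c'", OF this] show ?thesis
    using assms by (simp add: binomial_conv_simps sl_part_def mult.commute[of b' c])
qed

lemma u_part_phi:
  assumes "p \<in> trunc n" "q \<in> trunc n" "p' \<in> trunc n" "q' \<in> trunc n"
  shows "dp_prod n (fun_scale s) (frank_phi s lam) (u_part p q) (u_part p' q') =
    sl_part (- (q * p' + p * q')) (- (p * p')) (q * q')"
proof -
  have "frank_phi s lam (u_part p q i) (u_part p' q' j) =
      sl_mat (- (dp_coeff q i * dp_coeff p' j + dp_coeff p i * dp_coeff q' j))
          (- (dp_coeff p i * dp_coeff p' j)) (dp_coeff q i * dp_coeff q' j)" for i j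
    by (simp add: u_part_def frank_phi_coords)
  from dp_prod_sl[of "frank_phi s lam" "u_part p q" "u_part p' q'", OF this] show ?thesis
    using assms by (simp add: binomial_conv_simps sl_part_def)
qed

lemma u_part_lam:
  assumes "p \<in> trunc n" "q \<in> trunc n" "p' \<in> trunc n" "q' \<in> trunc n"
  shows "dp_prod n (*) lam (u_part p q) (u_part p' q') = dp_coeff (p * q' - q * p')"
proof -
  have "lam (u_part p q i) (u_part p' q' j) = dp_coeff p i * dp_coeff q' j - dp_coeff q i * dp_coeff p' j" for i j
    by (simp add: u_part_def mult.commute)
  then show ?thesis
    using assms by (simp add: dp_prod_field binomial_conv_simps)
qed

lemma part_ops:
  "u_part p q + u_part p' q' = u_part (p + p') (q + q')"
  "u_part p q - u_part p' q' = u_part (p - p') (q - q')"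
  "sl_part a b c + sl_part a' b' c' = sl_part (a + a') (b + b') (c + c')"
  "sl_part a b c - sl_part a' b' c' = sl_part (a - a') (b - b') (c - c')"
  "dp_coeff f + dp_coeff g = dp_coeff (f + g)" "dp_coeff f - dp_coeff g = dp_coeff (f - g)"
  by (auto simp: u_part_def sl_part_def fun_eq_iff coeff_ring_ops(3,4) mat_add[symmetric] mat_diff[symmetric]
      scale_left_distrib scale_left_diff_distrib)

lemma part_deriv:
  "dp_deriv (u_part p q) = u_part (dpow_deriv p) (dpow_deriv q)"
  "dp_deriv (sl_part a b c) = sl_part (dpow_deriv a) (dpow_deriv b) (dpow_deriv c)"
  "dp_deriv (dp_coeff f) = dp_coeff (dpow_deriv f)"
  by (auto simp: u_part_def sl_part_def dp_deriv_def coeff_deriv)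

text \<open>
  The coordinate map is a homomorphism, so that every identity of the Frank algebra can be checked
  over the differential ring of divided power series.
\<close>

lemma frank_of_bracket:
  assumes "X \<in> trunc_coords n" "Y \<in> trunc_coords n"
  shows "frank_bracket n s lam (frank_of X) (frank_of Y) = frank_of (dpow.frank_br X Y)"
proof -
  obtain p1 p2 a b c f where X: "X = (p1, p2, a, b, c, f)" by (cases X)
  obtain q1 q2 a' b' c' g where Y: "Y = (q1, q2, a', b', c', g)" by (cases Y)
  have t: "p1 \<in> trunc n" "p2 \<in> trunc n" "a \<in> trunc n" "b \<in> trunc n" "c \<in> trunc n" "f \<in> trunc n"
    "q1 \<in> trunc n" "q2 \<in> trunc n" "a' \<in> trunc n" "b' \<in> trunc n" "c' \<in> trunc n" "g \<in> trunc n"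
    using assms by (auto simp: X Y trunc_coords_def)
  note d = t[THEN trunc_closed(6)]
  show ?thesis
    using t d
    by (simp add: X Y part_deriv u_part_scale sl_part_u_part sl_part_scale sl_part_commutator u_part_phi u_part_lam
        dp_mult_coeff[OF char3] part_ops dpow.D_simps)
       (simp add: algebra_simps)
qed

lemma frank_br_closed:
  assumes "X \<in> trunc_coords n" "Y \<in> trunc_coords n"
  shows "dpow.frank_br X Y \<in> trunc_coords n"
  using assms by (cases X; cases Y) (simp add: trunc_coords_def trunc_closed trunc_mult[OF char3])

lemma frank_of_bij: "bij_betw frank_of (trunc_coords n) (frank_carrier n s)"
proof (rule bij_betwI)
  let ?g = "\<lambda>(p, A, f). (Dpow (\<lambda>i. lam (p i) v), Dpow (\<lambda>i. lam u (p i)),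
    Dpow (\<lambda>i. lam (A i u) v), Dpow (\<lambda>i. lam (A i v) v), Dpow (\<lambda>i. lam u (A i u)), Dpow f)"
  have sl0: "0 \<in> sl s" using mat_in_sl[of 0 0 0] by (simp add: mat_0)
  show "frank_of \<in> trunc_coords n \<rightarrow> frank_carrier n s"
    by (auto simp: trunc_coords_def trunc_def frank_carrier_def dp_space_def u_part_def sl_part_def mat_in_sl mat_0)
  show "?g \<in> frank_carrier n s \<rightarrow> trunc_coords n"
    by (auto simp: trunc_coords_def trunc_def frank_carrier_def dp_space_def)
  show "?g (frank_of X) = X" for X
    by (cases X) (simp add: u_part_def sl_part_def mat_entries dp_coeff_inverse)
  show "frank_of (?g F) = F" if "F \<in> frank_carrier n s" for F
  proof -
    obtain p A f where F: "F = (p, A, f)" by (cases F)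
    have "A i \<in> sl s" for i
      using that sl0 by (cases "i < 3 ^ n") (auto simp: F frank_carrier_def dp_space_def)
    then show ?thesis
      by (auto simp: F u_part_def sl_part_def fun_eq_iff expand[symmetric] sl_eq_sl_mat[symmetric])
  qed
qed

lemma frank_of_add: "frank_of (X + Y) = frank_of X + frank_of Y"
  by (cases X; cases Y) (simp add: part_ops)

fun coords_scale :: "'k \<Rightarrow> 'k coords \<Rightarrow> 'k coords" where
  "coords_scale k (p, q, a, b, c, f) = (dpow_const k * p, dpow_const k * q, dpow_const k * a,
     dpow_const k * b, dpow_const k * c, dpow_const k * f)"

lemma part_scale:
  "fun_scale s k (u_part p q) = u_part (dpow_const k * p) (dpow_const k * q)"
  "fun_scale (fun_scale s) k (sl_part a b c) = sl_part (dpow_const k * a) (dpow_const k * b) (dpow_const k * c)"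
  "fun_scale (*) k (dp_coeff f) = dp_coeff (dpow_const k * f)"
  by (auto simp: u_part_def sl_part_def fun_eq_iff coeff_const_mult scale_right_distrib mat_scale[symmetric])
     (auto simp: fun_scale_def scale_right_distrib)

lemma frank_of_scale: "frank_of (coords_scale k X) = frank_scale s k (frank_of X)"
  by (cases X) (simp add: frank_scale_def prod_scale_def part_scale)

declare frank_of.simps [simp del]

lemma frank_br_coords_scale:
  "dpow.frank_br (coords_scale k X) Y = coords_scale k (dpow.frank_br X Y)" "dpow.frank_br X (coords_scale k Y) = coords_scale k (dpow.frank_br X Y)"
  by (cases X; cases Y; simp add: dpow.D_simps dpow_deriv_const algebra_simps)+

lemma trunc_coords_closed:
  "0 \<in> trunc_coords n" "X \<in> trunc_coords n \<Longrightarrow> Y \<in> trunc_coords n \<Longrightarrow> X + Y \<in> trunc_coords n"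
  "X \<in> trunc_coords n \<Longrightarrow> coords_scale k X \<in> trunc_coords n" "X \<in> trunc_coords n \<Longrightarrow> dpow.ad_e X \<in> trunc_coords n"
  by (auto simp: trunc_coords_def zero_prod_def trunc_closed)

lemma frank_of_0: "frank_of 0 = 0"
  using frank_of_add[of 0 0] by simp

lemma car_frank: "frank_carrier n s = frank_of ` trunc_coords n"
  using frank_of_bij by (simp add: bij_betw_def)

lemma vs_frank: "vector_space (frank_scale s :: 'k \<Rightarrow> ('k, 'u) frank \<Rightarrow> ('k, 'u) frank)"
  unfolding frank_scale_def
  by (intro vector_space_prod_scale vector_space_fun_scale vs vs_field)

lemma subspace_frank: "module.subspace (frank_scale s) (frank_carrier n s)"
proof -
  interpret F: vector_space "frank_scale s :: 'k \<Rightarrow> ('k, 'u) frank \<Rightarrow> ('k, 'u) frank" by (rule vs_frank)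
  have "0 \<in> frank_of ` trunc_coords n" using frank_of_0 trunc_coords_closed(1) by (metis imageI)
  then show ?thesis
    unfolding F.subspace_def car_frank
    by (auto simp: frank_of_add[symmetric] frank_of_scale[symmetric] trunc_coords_closed)
qed

lemma dp_space_span:
  "module.span (fun_scale (*)) (dp_basis ` {..<3 ^ n}) = (dp_space n UNIV :: (nat \<Rightarrow> 'k) set)"
proof
  interpret F: vector_space "fun_scale (*) :: 'k \<Rightarrow> (nat \<Rightarrow> 'k) \<Rightarrow> nat \<Rightarrow> 'k"
    by (intro vector_space_fun_scale vs_field)
  show "F.span (dp_basis ` {..<3 ^ n}) \<subseteq> dp_space n UNIV"
  proof (rule F.span_minimal)
    show "dp_basis ` {..<3 ^ n} \<subseteq> (dp_space n UNIV :: (nat \<Rightarrow> 'k) set)"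
      by (auto simp: dp_basis_def dp_space_def)
    show "F.subspace (dp_space n UNIV)"
      by (auto simp: F.subspace_def dp_space_def fun_scale_def)
  qed
  show "dp_space n UNIV \<subseteq> F.span (dp_basis ` {..<3 ^ n})"
  proof
    fix f :: "nat \<Rightarrow> 'k" assume f: "f \<in> dp_space n UNIV"
    have "f = (\<Sum>i<3 ^ n. fun_scale (*) (f i) (dp_basis i))"
    proof
      fix k
      have "(\<Sum>i<3 ^ n. fun_scale (*) (f i) (dp_basis i)) k = (\<Sum>i<3 ^ n. if i = k then f k else 0)"
        unfolding sum_fun_apply by (rule sum.cong) (auto simp: fun_scale_def dp_basis_def)
      then show "f k = (\<Sum>i<3 ^ n. fun_scale (*) (f i) (dp_basis i)) k"
        using f by (auto simp: dp_space_def)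
    qed
    also have "\<dots> \<in> F.span (dp_basis ` {..<3 ^ n})"
      by (intro F.span_sum F.span_scale F.span_base) auto
    finally show "f \<in> F.span (dp_basis ` {..<3 ^ n})" .
  qed
qed

definition coord_embed :: "nat \<Rightarrow> 'k dpow \<Rightarrow> 'k coords" where
  "coord_embed j f = (if j = 0 then f else 0, if j = 1 then f else 0, if j = 2 then f else 0,
     if j = 3 then f else 0, if j = 4 then f else 0, if j = 5 then f else 0)"

lemma frank_finite_span:
  "\<exists>B. finite B \<and> B \<subseteq> frank_carrier n s \<and> module.span (frank_scale s) B = frank_carrier n s"
proof -
  interpret F: vector_space "frank_scale s :: 'k \<Rightarrow> ('k, 'u) frank \<Rightarrow> ('k, 'u) frank" by (rule vs_frank)
  define h where "h = (\<lambda>j f. frank_of (coord_embed j (Dpow f)))"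
  let ?b = "dp_basis ` {..<3 ^ n} :: (nat \<Rightarrow> 'k) set"
  define B where "B = (\<Union>j<6. h j ` ?b)"
  have h: "linmap (fun_scale (*)) (dp_space n UNIV) (frank_scale s) (frank_carrier n s) (h j)" for j
    unfolding linmap_def
  proof (intro conjI ballI allI)
    fix f g :: "nat \<Rightarrow> 'k" and c assume f: "f \<in> dp_space n UNIV"
    then have "Dpow f \<in> trunc n" by (simp add: trunc_def)
    then have "coord_embed j (Dpow f) \<in> trunc_coords n" by (simp add: coord_embed_def trunc_coords_def trunc_closed)
    then show "h j f \<in> frank_carrier n s" by (simp add: car_frank h_def)
    have "Dpow (f + g) = Dpow f + Dpow g" "Dpow (fun_scale (*) c f) = dpow_const c * Dpow f"
      by (auto intro!: dpow_eqI simp: coeff_ring_ops(3) coeff_const_mult fun_scale_def)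
    then show "h j (f + g) = h j f + h j g" "h j (fun_scale (*) c f) = frank_scale s c (h j f)"
      by (simp_all add: h_def coord_embed_def frank_of_add[symmetric] frank_of_scale[symmetric])
  qed
  have "finite B" by (simp add: B_def)
  have "?b \<subseteq> dp_space n UNIV" by (auto simp: dp_basis_def dp_space_def)
  then have sub: "B \<subseteq> frank_carrier n s"
    using linmap_mem[OF h] by (auto simp: B_def)
  have "frank_carrier n s \<subseteq> F.span B"
  proof
    fix x assume "x \<in> frank_carrier n s"
    then obtain p q a b c f where t: "(p, q, a, b, c, f) \<in> trunc_coords n" and x: "x = frank_of (p, q, a, b, c, f)"
      by (auto simp: car_frank)
    have hj: "h j (dp_coeff g) \<in> F.span B" if "g \<in> trunc n" "j < 6" for g j
    proof -
      have "h j (dp_coeff g) \<in> F.span (h j ` ?b)"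
        using linmap_image_span[OF vector_space_fun_scale[OF vs_field] vs_frank h dp_space_span \<open>?b \<subseteq> _\<close>, of j]
          that(1) by (auto simp: trunc_def)
      also have "\<dots> \<subseteq> F.span B" using that(2) by (intro F.span_mono) (auto simp: B_def)
      finally show ?thesis .
    qed
    have "x = h 0 (dp_coeff p) + h 1 (dp_coeff q) + h 2 (dp_coeff a) + h 3 (dp_coeff b) + h 4 (dp_coeff c) + h 5 (dp_coeff f)"
      by (simp add: x h_def dp_coeff_inverse frank_of_add[symmetric] coord_embed_def)
    also have "\<dots> \<in> F.span B"
      using t by (intro F.span_add hj) (auto simp: trunc_coords_def)
    finally show "x \<in> F.span B" .
  qed
  then have "F.span B = frank_carrier n s"
    using F.span_minimal[OF sub subspace_frank] by (rule subset_antisym[rotated])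
  with \<open>finite B\<close> sub show ?thesis by (intro exI[of _ B]) simp
qed

lemma nilpotent_eq_sl_mat:
  assumes "e \<in> sl s" "e u = 0" "e v = u"
  shows "e = sl_mat 0 1 0"
  using assms by (intro mat_eqI) auto

lemma frank_of_e: "(0, dp_tensor (fun_scale s) (sl_mat 0 1 0) (dp_basis 0), 0) = frank_of (0, 0, 0, 1, 0, 0)"
  by (auto simp: frank_of.simps u_part_def sl_part_def coeff_ring_ops(1,2) dp_tensor_def dp_basis_def fun_eq_iff sl_mat_def fun_scale_def)

abbreviation frank_alg :: "nat \<Rightarrow> ('k, ('k, 'u) frank) alg_rep" where
  "frank_alg n \<equiv> frank n s lam (sl_mat 0 1 0)"

lemma frank_alg_simps:
  "scl (frank_alg n) = frank_scale s" "car (frank_alg n) = frank_of ` trunc_coords n"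
  "X \<in> trunc_coords n \<Longrightarrow> der (frank_alg n) (frank_of X) = frank_of (dpow.ad_e X)"
  "X \<in> trunc_coords n \<Longrightarrow> Y \<in> trunc_coords n \<Longrightarrow> mul (frank_alg n) (frank_of X) (frank_of Y) = frank_of (dpow.frank_br X Y)"
proof -
  have "(0, 0, 0, 1, 0, 0) \<in> trunc_coords n" by (simp add: trunc_coords_def trunc_closed)
  then show "X \<in> trunc_coords n \<Longrightarrow> der (frank_alg n) (frank_of X) = frank_of (dpow.ad_e X)"
    unfolding frank_def frank_of_e by (simp add: frank_of_bracket dpow.frank_br_e)
qed (simp_all add: frank_def car_frank frank_of_bracket)

lemma linmap_frank_of:
  assumes "\<And>X. X \<in> trunc_coords n \<Longrightarrow> g (frank_of X) = frank_of (h X) \<and> h X \<in> trunc_coords n"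
    and "\<And>X Y. h (X + Y) = h X + h Y" "\<And>k X. h (coords_scale k X) = coords_scale k (h X)"
  shows "linmap (frank_scale s) (frank_of ` trunc_coords n) (frank_scale s) (frank_of ` trunc_coords n) g"
  unfolding linmap_def using assms
  by (auto simp: frank_of_add[symmetric] frank_of_scale[symmetric] trunc_coords_closed)

lemma ad_e_linear: "dpow.ad_e (X + Y) = dpow.ad_e X + dpow.ad_e Y" "dpow.ad_e (coords_scale k X) = coords_scale k (dpow.ad_e X)"
  by (cases X; cases Y; simp)+

lemma lie_alg_rep_frank: "lie_alg_rep (frank_alg n)"
  unfolding lie_alg_rep_def alpha3_rep_def frank_alg_simps(1,2)
proof (intro conjI)
  show "vector_space (frank_scale s :: 'k \<Rightarrow> ('k, 'u) frank \<Rightarrow> _)" by (rule vs_frank)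
  show "module.subspace (frank_scale s) (frank_of ` trunc_coords n)"
    using subspace_frank by (simp add: car_frank)
  show "\<exists>B. finite B \<and> B \<subseteq> frank_of ` trunc_coords n \<and> module.span (frank_scale s) B = frank_of ` trunc_coords n"
    using frank_finite_span by (simp add: car_frank)
  show "linmap (frank_scale s) (frank_of ` trunc_coords n) (frank_scale s) (frank_of ` trunc_coords n) (der (frank_alg n))"
    by (rule linmap_frank_of[where h = dpow.ad_e]) (simp_all add: frank_alg_simps(3) trunc_coords_closed ad_e_linear)
  show "\<forall>x\<in>frank_of ` trunc_coords n. der (frank_alg n) (der (frank_alg n) (der (frank_alg n) x)) = 0"
  proof
    fix x assume "x \<in> frank_of ` trunc_coords n"
    then obtain X where "X \<in> trunc_coords n" "x = frank_of X" by blast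
    then have "der (frank_alg n) (der (frank_alg n) (der (frank_alg n) x)) = frank_of (dpow.ad_e (dpow.ad_e (dpow.ad_e X)))"
      by (simp add: frank_alg_simps(3) trunc_coords_closed)
    also have "dpow.ad_e (dpow.ad_e (dpow.ad_e X)) = 0" by (cases X) (simp add: zero_prod_def)
    finally show "der (frank_alg n) (der (frank_alg n) (der (frank_alg n) x)) = 0"
      by (simp only: frank_of_0)
  qed
  show "\<forall>x\<in>frank_of ` trunc_coords n. linmap (frank_scale s) (frank_of ` trunc_coords n) (frank_scale s) (frank_of ` trunc_coords n) (mul (frank_alg n) x)"
  proof
    fix x assume "x \<in> frank_of ` trunc_coords n"
    then obtain X where X: "X \<in> trunc_coords n" "x = frank_of X" by blast
    show "linmap (frank_scale s) (frank_of ` trunc_coords n) (frank_scale s) (frank_of ` trunc_coords n) (mul (frank_alg n) x)"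
      by (rule linmap_frank_of[where h = "dpow.frank_br X"])
        (simp_all add: X frank_alg_simps(4) frank_br_closed dpow.frank_br_add frank_br_coords_scale)
  qed
  show "\<forall>y\<in>frank_of ` trunc_coords n. linmap (frank_scale s) (frank_of ` trunc_coords n) (frank_scale s) (frank_of ` trunc_coords n) (\<lambda>x. mul (frank_alg n) x y)"
  proof
    fix y assume "y \<in> frank_of ` trunc_coords n"
    then obtain Y where Y: "Y \<in> trunc_coords n" "y = frank_of Y" by blast
    show "linmap (frank_scale s) (frank_of ` trunc_coords n) (frank_scale s) (frank_of ` trunc_coords n) (\<lambda>x. mul (frank_alg n) x y)"
      by (rule linmap_frank_of[where h = "\<lambda>X. dpow.frank_br X Y"])
        (simp_all add: Y frank_alg_simps(4) frank_br_closed dpow.frank_br_add frank_br_coords_scale)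
  qed
  show "\<forall>x\<in>frank_of ` trunc_coords n. mul (frank_alg n) x x = 0"
    by (auto simp: frank_alg_simps(4) dpow.frank_br_alternating frank_of_0)
  show "\<forall>x\<in>frank_of ` trunc_coords n. \<forall>y\<in>frank_of ` trunc_coords n. \<forall>z\<in>frank_of ` trunc_coords n.
        mul (frank_alg n) x (mul (frank_alg n) y z) + mul (frank_alg n) y (mul (frank_alg n) z x)
        + mul (frank_alg n) z (mul (frank_alg n) x y) = 0"
    by (auto simp: frank_alg_simps(4) frank_br_closed frank_of_add[symmetric] dpow.frank_br_jacobi frank_of_0)
  show "\<forall>x\<in>frank_of ` trunc_coords n. \<forall>y\<in>frank_of ` trunc_coords n.
      der (frank_alg n) (mul (frank_alg n) x y) = mul (frank_alg n) (der (frank_alg n) x) y + mul (frank_alg n) x (der (frank_alg n) y)"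
    by (auto simp: frank_alg_simps(3,4) frank_br_closed trunc_coords_closed frank_of_add[symmetric] dpow.ad_e_derivation)
qed

end

section \<open>The contact superalgebra in characteristic 3\<close>

fun sfun_of :: "'a dpow \<times> 'a dpow \<Rightarrow> 'a sfun" where
  "sfun_of (f, g) = (dp_coeff f, dp_coeff g)"

fun pair_scale :: "'a::comm_ring_1 \<Rightarrow> 'a dpow \<times> 'a dpow \<Rightarrow> 'a dpow \<times> 'a dpow" where
  "pair_scale k (f, g) = (dpow_const k * f, dpow_const k * g)"

definition trunc_pair :: "nat \<Rightarrow> ('a::zero dpow \<times> 'a dpow) set" where
  "trunc_pair n = trunc n \<times> trunc n"

lemma trunc_pair_closed:
  "0 \<in> trunc_pair n" "F \<in> trunc_pair n \<Longrightarrow> G \<in> trunc_pair n \<Longrightarrow> F + G \<in> trunc_pair n"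
  "F \<in> trunc_pair n \<Longrightarrow> G \<in> trunc_pair n \<Longrightarrow> F - G \<in> trunc_pair n" "F \<in> trunc_pair n \<Longrightarrow> pair_scale k F \<in> trunc_pair n"
  "(f, g) \<in> trunc_pair n \<longleftrightarrow> f \<in> trunc n \<and> g \<in> trunc n"
  for F G :: "'a::comm_ring_1 dpow \<times> 'a dpow"
  by (auto simp: trunc_pair_def zero_prod_def trunc_closed)

lemma sfuns_eq: "sfuns n = sfun_of ` trunc_pair n"
proof -
  have "\<exists>F. dp_coeff F \<in> dp_space n UNIV \<and> f = dp_coeff F" if "f \<in> dp_space n UNIV" for f :: "nat \<Rightarrow> 'a"
    using that by (intro exI[of _ "Dpow f"]) simp
  then show ?thesis unfolding sfuns_def trunc_pair_def trunc_def by (auto simp: image_iff)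
qed

lemma sfun_of_ops: "sfun_of (F + G) = sfun_of F + sfun_of G" "sfun_of (F - G) = sfun_of F - sfun_of G" "sfun_of 0 = 0"
  "sfun_of (pair_scale k F) = sfun_scale k (sfun_of F)"
  for F G :: "'a::field dpow \<times> 'a dpow"
proof -
  show "sfun_of (F + G) = sfun_of F + sfun_of G" "sfun_of (F - G) = sfun_of F - sfun_of G"
    by (cases F; cases G; simp add: coeff_ring_ops(3,4) fun_eq_iff)+
  show "sfun_of 0 = 0"
    by (simp add: zero_prod_def coeff_ring_ops(1) zero_fun_def)
  show "sfun_of (pair_scale k F) = sfun_scale k (sfun_of F)"
    by (cases F) (simp add: sfun_scale_def prod_scale_def fun_scale_def coeff_const_mult fun_eq_iff)
qed

lemma sfun_of_inject: "sfun_of F = sfun_of G \<longleftrightarrow> F = G"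
  by (cases F; cases G) (simp add: dp_coeff_inject)

text \<open>
  The parameter \<open>k_type\<close> names the field, which does not occur in \<open>n\<close>.
\<close>

locale contact_char3 =
  fixes n :: nat and k_type :: "'k::field itself"
  assumes char3: "CHAR('k) = 3" and n_pos: "n \<ge> 1"
begin

sublocale dpow: differential_ring3 "dpow_deriv :: 'k dpow \<Rightarrow> 'k dpow"
  using char3 by (rule differential_ring3_dpow)

definition DK :: "'k dpow \<times> 'k dpow \<Rightarrow> 'k sfun \<Rightarrow> 'k sfun" where
  "DK F = D_K n (sfun_of F)"

lemma sfun_mult_sfun_of:
  assumes "(f, g) \<in> trunc_pair n" "(f', g') \<in> trunc_pair n"
  shows "sfun_mult n (dp_coeff f, dp_coeff g) (dp_coeff f', dp_coeff g') = sfun_of (f * f', f * g' + g * f' :: 'k dpow)"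
  using assms by (simp add: trunc_pair_closed dp_mult_coeff[OF char3] coeff_ring_ops fun_eq_iff)

lemma twice: "x + x = - x" for x :: "'k dpow"
  using dpow.triple(1)[of x] by (simp add: eq_neg_iff_add_eq_0)

lemma DK_apply:
  assumes "F \<in> trunc_pair n" "H \<in> trunc_pair n"
  shows "DK F (sfun_of H) = sfun_of (dpow.contact_op F H)"
proof -
  obtain f g h k where F: "F = (f, g)" and H: "H = (h, k)" by (cases F, cases H)
  have t: "f \<in> trunc n" "g \<in> trunc n" "h \<in> trunc n" "k \<in> trunc n"
    using assms by (auto simp: F H trunc_pair_closed)
  have "sfun_of H \<in> sfuns n" using assms by (simp add: sfuns_eq)
  moreover have "dp_coeff f + dp_coeff f = dp_coeff (- f)"
    by (simp only: twice[symmetric] coeff_ring_ops(3) plus_fun_def)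
  ultimately have "DK F (sfun_of H) = sfun_mult n (dp_coeff (- f), dp_coeff g) (dp_coeff (dpow_deriv h), dp_coeff (dpow_deriv k))
      + sfun_mult n (dp_coeff g, dp_coeff (dpow_deriv f)) (dp_coeff k, dp_coeff 0)"
    by (simp add: F H DK_def D_K_def superder_def restrict_sfuns_def d_x_def d_theta_def dpow_deriv_def
        coeff_ring_ops(1) zero_fun_def)
  also have "\<dots> = sfun_of (- f * dpow_deriv h, - f * dpow_deriv k + g * dpow_deriv h) + sfun_of (g * k, dpow_deriv f * k)"
    using t by (simp add: sfun_mult_sfun_of trunc_pair_closed trunc_closed del: sfun_mult.simps)
  also have "\<dots> = sfun_of (dpow.contact_op F H)"
    by (simp only: sfun_of_ops(1)[symmetric] F H dpow.contact_op.simps add_Pair) (simp add: algebra_simps)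
  finally show ?thesis .
qed

declare sfun_of.simps [simp del]

lemma DK_outside: "x \<notin> sfuns n \<Longrightarrow> DK F x = 0"
  by (simp add: DK_def D_K_def superder_def restrict_sfuns_def)

text \<open>
  Endomorphisms are represented by functions that vanish outside of \<^const>\<open>sfuns\<close>, so an equation
  between them also has to be checked outside of it.
\<close>

lemma DK_eqI:
  assumes "F \<in> trunc_pair n" "\<And>H. H \<in> trunc_pair n \<Longrightarrow> T (sfun_of H) = sfun_of (dpow.contact_op F H)" "\<And>x. x \<notin> sfuns n \<Longrightarrow> T x = 0"
  shows "T = DK F"
proof
  show "T x = DK F x" for x
    using assms by (cases "x \<in> sfuns n") (auto simp: sfuns_eq DK_apply DK_outside[unfolded sfuns_eq])
qed

lemma contact_op_closed: "F \<in> trunc_pair n \<Longrightarrow> H \<in> trunc_pair n \<Longrightarrow> dpow.contact_op F H \<in> trunc_pair n"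
  by (cases F; cases H) (simp add: trunc_pair_closed trunc_closed trunc_mult[OF char3])

lemma contact_br_closed: "F \<in> trunc_pair n \<Longrightarrow> G \<in> trunc_pair n \<Longrightarrow> dpow.contact_br F G \<in> trunc_pair n"
  by (cases F; cases G) (simp add: trunc_pair_closed trunc_closed trunc_mult[OF char3])

lemma DK_add: "F \<in> trunc_pair n \<Longrightarrow> G \<in> trunc_pair n \<Longrightarrow> DK F + DK G = DK (F + G)"
  by (rule DK_eqI) (simp_all add: trunc_pair_closed DK_apply DK_outside dpow.contact_op_add sfun_of_ops)

lemma contact_op_scale: "dpow.contact_op (pair_scale k F) H = pair_scale k (dpow.contact_op F H)"
  by (cases F; cases H) (simp add: dpow.D_simps dpow_deriv_const algebra_simps)

lemma contact_br_scale: "dpow.contact_br (pair_scale k F) G = pair_scale k (dpow.contact_br F G)" "dpow.contact_br F (pair_scale k G) = pair_scale k (dpow.contact_br F G)"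
  by (cases F; cases G; simp add: dpow.D_simps dpow_deriv_const algebra_simps)+

lemma vs_sfun: "vector_space (sfun_scale :: 'k \<Rightarrow> _)"
proof -
  have "vector_space ((*) :: 'k \<Rightarrow> 'k \<Rightarrow> 'k)" by unfold_locales (auto simp: algebra_simps)
  then show ?thesis
    unfolding sfun_scale_def by (intro vector_space_prod_scale vector_space_fun_scale)
qed

lemma DK_scale: "F \<in> trunc_pair n \<Longrightarrow> fun_scale sfun_scale k (DK F) = DK (pair_scale k F)"
proof -
  interpret S: vector_space "sfun_scale :: 'k \<Rightarrow> _" by (rule vs_sfun)
  show "F \<in> trunc_pair n \<Longrightarrow> fun_scale sfun_scale k (DK F) = DK (pair_scale k F)"
    by (rule DK_eqI) (simp_all add: fun_scale_def trunc_pair_closed DK_apply DK_outside contact_op_scale sfun_of_ops)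
qed

lemma DK_0: "DK 0 = 0"
  by (rule DK_eqI[symmetric]) (simp_all add: trunc_pair_closed dpow.contact_op_0 sfun_of_ops)

lemma comps_DK:
  assumes "(f, g) \<in> trunc_pair n"
  shows "even_comp n (DK (f, g)) = DK (f, 0)" "odd_comp n (DK (f, g)) = DK (0, g)"
proof -
  have t: "(f, 0) \<in> trunc_pair n" "(0, g) \<in> trunc_pair n" using assms by (auto simp: trunc_pair_closed trunc_closed)
  have *: "DK (f, g) (dp_coeff h, 0) = sfun_of (dpow.contact_op (f, g) (h, 0))" "DK (f, g) (0, dp_coeff k) = sfun_of (dpow.contact_op (f, g) (0, k))"
    if "(h, k) \<in> trunc_pair n" for h k
    using DK_apply[OF assms, of "(h, 0)"] DK_apply[OF assms, of "(0, k)"] that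
    by (simp_all add: trunc_pair_closed trunc_closed coeff_ring_ops(1) zero_fun_def sfun_of.simps)
  show "even_comp n (DK (f, g)) = DK (f, 0)"
  proof (rule DK_eqI[OF t(1)])
    fix H :: "'k dpow \<times> 'k dpow" assume H: "H \<in> trunc_pair n"
    then have "sfun_of H \<in> sfuns n" by (simp add: sfuns_eq)
    with H show "even_comp n (DK (f, g)) (sfun_of H) = sfun_of (dpow.contact_op (f, 0) H)"
      by (cases H) (simp add: even_comp_def restrict_sfuns_def * sfun_of.simps dpow.D_simps)
  qed (simp add: even_comp_def restrict_sfuns_def)
  show "odd_comp n (DK (f, g)) = DK (0, g)"
  proof (rule DK_eqI[OF t(2)])
    fix H :: "'k dpow \<times> 'k dpow" assume H: "H \<in> trunc_pair n"
    then have "sfun_of H \<in> sfuns n" by (simp add: sfuns_eq)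
    with H show "odd_comp n (DK (f, g)) (sfun_of H) = sfun_of (dpow.contact_op (0, g) H)"
      by (cases H) (simp add: odd_comp_def restrict_sfuns_def * sfun_of.simps dpow.D_simps)
  qed (simp add: odd_comp_def restrict_sfuns_def)
qed

lemma supercomm_DK:
  assumes "F \<in> trunc_pair n" "G \<in> trunc_pair n"
  shows "supercomm n (DK F) (DK G) = DK (dpow.contact_br F G)"
proof (rule DK_eqI)
  obtain f g f' g' where F: "F = (f, g)" and G: "G = (f', g')" by (cases F, cases G)
  have t: "(f, 0) \<in> trunc_pair n" "(0, g) \<in> trunc_pair n" "(f', 0) \<in> trunc_pair n" "(0, g') \<in> trunc_pair n"
    "(f, g) \<in> trunc_pair n" "(f', g') \<in> trunc_pair n"
    using assms by (auto simp: F G trunc_pair_closed trunc_closed)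
  show "supercomm n (DK F) (DK G) (sfun_of H) = sfun_of (dpow.contact_op (dpow.contact_br F G) H)" if H: "H \<in> trunc_pair n" for H
    unfolding F G dpow.contact_op_supercomm[symmetric]
    using t H by (simp add: supercomm_def comps_DK DK_apply contact_op_closed sfun_of_ops del: dpow.contact_op.simps)
  show "supercomm n (DK F) (DK G) x = 0" if "x \<notin> sfuns n" for x
  proof -
    have "DK F' 0 = 0" if "F' \<in> trunc_pair n" for F'
      using DK_apply[OF that, of 0] by (simp add: trunc_pair_closed dpow.contact_op_0 sfun_of_ops)
    then show ?thesis
      using that t by (simp add: supercomm_def F G comps_DK DK_outside)
  qed
qed (use assms in \<open>simp add: contact_br_closed\<close>)

text \<open>
  Apply \<open>D\<^sub>K(f + g\<theta>)\<close> to the function \<open>x\<^sup>(\<^sup>1\<^sup>)\<close>, which is available because \<open>n \<ge> 1\<close>: the result is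
  \<open>2f + g\<theta>\<close>.
\<close>

lemma DK_inj: "inj_on DK (trunc_pair n)"
proof (rule inj_onI)
  fix F G :: "'k dpow \<times> 'k dpow" assume FG: "F \<in> trunc_pair n" "G \<in> trunc_pair n" "DK F = DK G"
  obtain f g f' g' where F: "F = (f, g)" and G: "G = (f', g')" by (cases F, cases G)
  define X :: "'k dpow" where "X = Dpow (dp_basis 1)"
  have "(3::nat) ^ 1 \<le> 3 ^ n" using n_pos by (intro power_increasing) auto
  then have X: "(X, 0) \<in> trunc_pair n"
    by (auto simp: X_def trunc_pair_closed trunc_def dp_space_def dp_basis_def coeff_ring_ops(1))
  have "dpow_deriv X = 1"
    by (rule dpow_eqI) (simp add: X_def coeff_deriv dp_basis_def coeff_ring_ops)
  moreover have "dpow.contact_op F (X, 0) = dpow.contact_op G (X, 0)"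
    using DK_apply[OF FG(1) X] DK_apply[OF FG(2) X] FG(3) by (simp add: sfun_of_inject)
  ultimately show "F = G" by (simp add: F G dpow.D_zero)
qed

text \<open>
  By \<open>supercomm_DK\<close> the image of \<open>D\<^sub>K\<close> is a subalgebra, hence it is the subalgebra that it generates.
\<close>

lemma contact_carrier_eq: "contact_carrier n = DK ` trunc_pair n"
proof -
  have im: "DK ` trunc_pair n = D_K n ` sfuns n" by (simp add: sfuns_eq image_image DK_def)
  interpret V: vector_space "fun_scale sfun_scale :: 'k \<Rightarrow> ('k sfun \<Rightarrow> 'k sfun) \<Rightarrow> _"
    by (intro vector_space_fun_scale vs_sfun)
  have "witt_subalgebra n (DK ` trunc_pair n)"
    unfolding witt_subalgebra_def
  proof (intro conjI ballI)
    show "DK ` trunc_pair n \<subseteq> witt_super n"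
    proof
      fix T assume "T \<in> DK ` trunc_pair n"
      then obtain f g where fg: "(f, g) \<in> trunc_pair n" "T = DK (f, g)" by auto
      have "T = superder n (sfun_of (f + f, g)) (sfun_of (g, dpow_deriv f))"
        by (simp only: fg(2) DK_def D_K_def dpow_deriv_def coeff_ring_ops(3) plus_fun_def sfun_of.simps
            fst_conv snd_conv coeff_Dpow)
      moreover have "sfun_of (f + f, g) \<in> sfuns n" "sfun_of (g, dpow_deriv f) \<in> sfuns n"
        using fg(1) trunc_closed(3)[of f n f] unfolding sfuns_eq
        by (auto simp: trunc_pair_closed(5) trunc_closed(6) intro!: imageI)
      ultimately show "T \<in> witt_super n" unfolding witt_super_def by blast
    qed
    have "0 \<in> DK ` trunc_pair n" using DK_0 trunc_pair_closed(1) by (metis imageI)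
    then show "V.subspace (DK ` trunc_pair n)"
      by (auto simp: V.subspace_def DK_add DK_scale trunc_pair_closed(1-4))
    show "supercomm n T T' \<in> DK ` trunc_pair n" if "T \<in> DK ` trunc_pair n" "T' \<in> DK ` trunc_pair n" for T T'
      using that by (auto simp: supercomm_DK contact_br_closed simp del: dpow.contact_br.simps)
  qed
  then show ?thesis
    unfolding contact_carrier_def im[symmetric] by (intro antisym hull_minimal hull_subset) auto
qed

lemma DK_eq_iff: "F \<in> trunc_pair n \<Longrightarrow> G \<in> trunc_pair n \<Longrightarrow> DK F = DK G \<longleftrightarrow> F = G"
  using DK_inj by (auto dest: inj_onD)

lemma contact_parts:
  "evn (contact n) = (\<lambda>f. DK (f, 0)) ` trunc n" "odd_part (contact n) = (\<lambda>g. DK (0, g)) ` trunc n"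
proof -
  have *: "odd_comp n (DK (f, g)) = 0 \<longleftrightarrow> g = 0" "even_comp n (DK (f, g)) = 0 \<longleftrightarrow> f = 0"
    if "(f, g) \<in> trunc_pair n" for f g
    using that DK_eq_iff[of "(0, g)" "(0, 0)"] DK_eq_iff[of "(f, 0)" "(0, 0)"] DK_0
    by (simp_all add: comps_DK trunc_pair_closed trunc_closed zero_prod_def)
  show "evn (contact n) = (\<lambda>f. DK (f, 0)) ` trunc n" "odd_part (contact n) = (\<lambda>g. DK (0, g)) ` trunc n"
    by (auto simp: contact_def contact_carrier_eq * trunc_pair_closed trunc_closed image_iff)
qed

lemma contact_scar: "scar (contact n) = DK ` trunc_pair n"
proof
  show "scar (contact n) \<subseteq> DK ` trunc_pair n"
    by (auto simp: scar_def contact_parts DK_add trunc_pair_closed trunc_closed)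
  show "DK ` trunc_pair n \<subseteq> scar (contact n)"
  proof
    fix T assume "T \<in> DK ` trunc_pair n"
    then obtain f g where fg: "(f, g) \<in> trunc_pair n" "T = DK (f, g)" by auto
    then have "T = DK (f, 0) + DK (0, g)" by (simp add: DK_add trunc_pair_closed trunc_closed)
    then show "T \<in> scar (contact n)"
      using fg by (auto simp: scar_def contact_parts trunc_pair_closed)
  qed
qed

lemma contact_simps: "sscl (contact n) = fun_scale sfun_scale" "smul (contact n) = supercomm n"
  by (simp_all add: contact_def)

lemma superalgebra_contact: "superalgebra (contact n :: ('k, _) superalg)"
proof -
  interpret V: vector_space "fun_scale sfun_scale :: 'k \<Rightarrow> ('k sfun \<Rightarrow> 'k sfun) \<Rightarrow> _"
    by (intro vector_space_fun_scale vs_sfun)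
  have z: "DK (0, 0) = 0" using DK_0 by (simp add: zero_prod_def)
  have t0: "(0, 0) \<in> trunc_pair n" by (simp add: trunc_pair_closed trunc_closed)
  have sub: "V.subspace (evn (contact n))" "V.subspace (odd_part (contact n))"
  proof -
    have "(0 :: 'k sfun \<Rightarrow> 'k sfun) \<in> evn (contact n)" "(0 :: 'k sfun \<Rightarrow> 'k sfun) \<in> odd_part (contact n)"
      unfolding contact_parts using z trunc_closed(1) by (metis imageI)+
    then show "V.subspace (evn (contact n))" "V.subspace (odd_part (contact n))"
      unfolding V.subspace_def contact_parts
      by (auto simp: DK_add DK_scale trunc_pair_closed trunc_closed)
  qed
  have lin: "linmap (fun_scale sfun_scale) (DK ` trunc_pair n) (fun_scale sfun_scale) (DK ` trunc_pair n) h"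
    if "\<And>F. F \<in> trunc_pair n \<Longrightarrow> h (DK F) = DK (hh F) \<and> hh F \<in> trunc_pair n"
      "\<And>F G. hh (F + G) = hh F + hh G" "\<And>k F. hh (pair_scale k F) = pair_scale k (hh F)" for h hh
    unfolding linmap_def using that by (auto simp: DK_add DK_scale trunc_pair_closed(2,4))
  have lin1: "linmap (fun_scale sfun_scale) (DK ` trunc_pair n) (fun_scale sfun_scale) (DK ` trunc_pair n) (supercomm n T)"
    and lin2: "linmap (fun_scale sfun_scale) (DK ` trunc_pair n) (fun_scale sfun_scale) (DK ` trunc_pair n) (\<lambda>T'. supercomm n T' T)"
    if "T \<in> DK ` trunc_pair n" for T
  proof -
    from that obtain F where F: "F \<in> trunc_pair n" "T = DK F" by blast
    show "linmap (fun_scale sfun_scale) (DK ` trunc_pair n) (fun_scale sfun_scale) (DK ` trunc_pair n) (supercomm n T)"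
      by (rule lin[of _ "dpow.contact_br F"]) (simp_all add: F supercomm_DK contact_br_closed dpow.contact_br_add contact_br_scale)
    show "linmap (fun_scale sfun_scale) (DK ` trunc_pair n) (fun_scale sfun_scale) (DK ` trunc_pair n) (\<lambda>T'. supercomm n T' T)"
      by (rule lin[of _ "\<lambda>G. dpow.contact_br G F"]) (simp_all add: F supercomm_DK contact_br_closed dpow.contact_br_add contact_br_scale)
  qed
  have disjoint: "evn (contact n) \<inter> odd_part (contact n) = {0 :: 'k sfun \<Rightarrow> 'k sfun}"
  proof -
    have "DK (f, 0) = 0" if "f \<in> trunc n" "g \<in> trunc n" "DK (f, 0) = DK (0, g)" for f g
      using that DK_eq_iff[of "(f, 0)" "(0, g)"] z by (simp add: trunc_pair_closed trunc_closed)
    then have "evn (contact n) \<inter> odd_part (contact n) \<subseteq> {0 :: 'k sfun \<Rightarrow> 'k sfun}"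
      unfolding contact_parts by auto
    then show ?thesis using V.subspace_0[OF sub(1)] V.subspace_0[OF sub(2)] by blast
  qed
  have grading: "supercomm n (DK (f, 0)) (DK (f', 0)) \<in> evn (contact n)"
    "supercomm n (DK (f, 0)) (DK (0, g)) \<in> odd_part (contact n)"
    "supercomm n (DK (0, g)) (DK (f, 0)) \<in> odd_part (contact n)"
    "supercomm n (DK (0, g)) (DK (0, g')) \<in> evn (contact n)"
    if "f \<in> trunc n" "f' \<in> trunc n" "g \<in> trunc n" "g' \<in> trunc n" for f f' g g'
    using that
    by (auto simp: contact_parts supercomm_DK trunc_pair_closed trunc_closed trunc_mult[OF char3] dpow.D_simps)
  show ?thesis
    unfolding superalgebra_def contact_simps contact_scar
  proof (intro conjI)
    show "vector_space (fun_scale sfun_scale :: 'k \<Rightarrow> ('k sfun \<Rightarrow> 'k sfun) \<Rightarrow> _)"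
      by (rule V.vector_space_axioms)
  qed (use sub lin1 lin2 disjoint grading[unfolded contact_parts] in \<open>auto simp: contact_parts\<close>)
qed

end

section \<open>The contact superalgebra as a semisimplification\<close>

lemma negligible_zero:
  assumes "vector_space s" "module.subspace s M"
  shows "negligible J2 (tensor2 s M) (\<lambda>_. 0)"
proof -
  interpret vector_space s by fact
  interpret P: vector_space "prod_scale s s" using assms(1,1) by (rule vector_space_prod_scale)
  have "0 \<in> M" using assms(2) by (rule subspace_0)
  moreover have "lin_trace (prod_scale s s) V (\<lambda>_. 0) = 0" for V
    by (simp add: lin_trace_def P.representation_zero)
  ultimately show ?thesis
    by (auto simp: negligible_def rep_hom_def tensor2_def linmap_def zero_prod_def prod_scale_def comp_def)
qed

context symplectic_basis
begin

text \<open>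
  The block \<open>(1)\<close> is spanned by \<open>Id \<otimes> W\<close>, the blocks \<open>(2)\<close> by \<open>u \<otimes> g\<close> and \<open>v \<otimes> g'\<close>, and the blocks \<open>(3)\<close>
  by the strictly lower triangular matrices, which span \<open>L2\<close>, and their images under \<open>d\<close> and \<open>d\<^sup>2\<close>.
  With these choices all products agree on the nose, so the negligible morphism in the
  even-odd product is \<open>0\<close>.
\<close>

lemma is_semisimplification_contact:
  assumes "n \<ge> 1"
  shows "is_semisimplification (frank_alg n) (contact n)"
proof -
  interpret C: contact_char3 n "TYPE('k)"
    using char3 assms by unfold_locales
  let ?A = "frank_alg n" and ?S = "contact n :: ('k, 'k sfun \<Rightarrow> 'k sfun) superalg"
  define \<iota> where "\<iota> = (\<lambda>c. frank_of (0, 0, 0, 0, c, 0))"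
  define L2 where "L2 = \<iota> ` trunc n"
  define D where "D = rep_sum (tensor1 (sscl ?S) (evn ?S))
                (rep_sum (tensor2 (sscl ?S) (odd_part ?S)) (tensor3 (scl ?A) L2))"
  \<comment> \<open>Both the sum of blocks \<open>D\<close> and the Frank algebra are parametrised by sextuples over \<open>\<O>\<close>,
      through \<open>P\<close> and \<open>Q\<close>; the decomposition \<open>J\<close> takes \<open>P X\<close> to \<open>Q X\<close>. The permutation \<open>q\<close> places
      \<open>c1, c2, c3\<close> at the entries \<open>c, a, b\<close> of a matrix, which is the order in which \<open>d\<close> moves
      them. Its sign is the factor of \<open>D\<^sub>K(f) = 2f\<partial> + \<dots> = -f\<partial> + \<dots>\<close>.\<close>
  define P where "P = (\<lambda>(f, g, g', c1, c2, c3). (C.DK (f, 0), (C.DK (0, g), C.DK (0, g')), (\<iota> c1, \<iota> c2, \<iota> c3)))"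
  define q :: "'k coords \<Rightarrow> 'k coords" where "q = (\<lambda>(f, g, g', c1, c2, c3). (g, g', c2, c3, c1, - f))"
  define Q where "Q = (\<lambda>X. frank_of (q X))"
  define J where "J = (\<lambda>z. Q (inv_into (trunc_coords n) P z))"
  interpret V: vector_space "frank_scale s :: 'k \<Rightarrow> ('k, 'u) frank \<Rightarrow> _" by (rule vs_frank)
  have Dsel: "scl D = prod_scale (fun_scale sfun_scale) (prod_scale (prod_scale (fun_scale sfun_scale) (fun_scale sfun_scale))
      (prod_scale (frank_scale s) (prod_scale (frank_scale s) (frank_scale s))))"
    "car D = evn ?S \<times> (odd_part ?S \<times> odd_part ?S) \<times> (L2 \<times> L2 \<times> L2)"
    "der D (a, (x, y), (r, r', r'')) = (0, (y, 0), (0, r, r'))" for a x y r r' r''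
    by (simp_all add: D_def rep_sum_def tensor1_def tensor2_def tensor3_def C.contact_simps frank_alg_simps)
  have z: "C.DK (0, 0) = 0" "\<iota> 0 = 0"
    using C.DK_0 frank_of_0 by (simp_all add: \<iota>_def zero_prod_def)
  have frank_inj: "frank_of X = frank_of Y \<longleftrightarrow> X = Y" if "X \<in> trunc_coords n" "Y \<in> trunc_coords n" for X Y
    using frank_of_bij that unfolding bij_betw_def by (auto dest: inj_onD)
  have iota: "\<iota> c + \<iota> c' = \<iota> (c + c')" "frank_scale s k (\<iota> c) = \<iota> (dpow_const k * c)" for c c' k
    by (simp_all add: \<iota>_def frank_of_add[symmetric] frank_of_scale[symmetric])
  have carD: "car D = P ` trunc_coords n"
  proof
    show "P ` trunc_coords n \<subseteq> car D"
      by (auto simp: Dsel P_def L2_def C.contact_parts trunc_coords_def)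
    show "car D \<subseteq> P ` trunc_coords n"
    proof
      fix z assume "z \<in> car D"
      then obtain f g g' c1 c2 c3 where t: "f \<in> trunc n" "g \<in> trunc n" "g' \<in> trunc n"
          "c1 \<in> trunc n" "c2 \<in> trunc n" "c3 \<in> trunc n"
        and z: "z = (C.DK (f, 0), (C.DK (0, g), C.DK (0, g')), (\<iota> c1, \<iota> c2, \<iota> c3))"
        by (auto simp: Dsel L2_def C.contact_parts)
      have "z = P (f, g, g', c1, c2, c3)" by (simp add: z P_def)
      then show "z \<in> P ` trunc_coords n" using t by (auto simp: trunc_coords_def)
    qed
  qed
  have P_inj: "inj_on P (trunc_coords n)"
    by (rule inj_onI)
      (auto simp: P_def \<iota>_def trunc_coords_def C.DK_eq_iff trunc_pair_closed trunc_closed frank_inj[unfolded trunc_coords_def])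
  have P_add: "P (X + Y) = P X + P Y" if "X \<in> trunc_coords n" "Y \<in> trunc_coords n" for X Y
    using that by (cases X; cases Y) (auto simp: P_def trunc_coords_def C.DK_add trunc_pair_closed trunc_closed iota)
  have P_scale: "P (coords_scale k X) = scl D k (P X)" if "X \<in> trunc_coords n" for X k
    using that by (cases X) (auto simp: P_def Dsel prod_scale_def trunc_coords_def C.DK_scale trunc_pair_closed trunc_closed iota)
  have P_der: "der D (P (f, g, g', c1, c2, c3)) = P (0, g', 0, 0, c1, c2)" for f g g' c1 c2 c3
    by (simp add: P_def Dsel z)
  have q_closed: "q X \<in> trunc_coords n \<longleftrightarrow> X \<in> trunc_coords n" for X
    by (cases X) (auto simp: q_def trunc_coords_def dest: trunc_closed(5) intro: trunc_closed(5))
  have q_lin: "q (X + Y) = q X + q Y" "q (coords_scale k X) = coords_scale k (q X)" for X Y k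
    by (cases X; cases Y; simp add: q_def)+
  have q_bij: "bij_betw q (trunc_coords n) (trunc_coords n)"
    by (rule bij_betwI[where g = "\<lambda>(p, p', a, b, c, f). (- f, p, p', c, a, b)"])
       (auto simp: q_def trunc_coords_def trunc_closed)
  have Q_bij: "bij_betw Q (trunc_coords n) (car ?A)"
    unfolding Q_def frank_alg_simps car_frank[symmetric]
    using bij_betw_trans[OF q_bij frank_of_bij] by (simp add: comp_def)
  have JP: "J (P X) = Q X" if "X \<in> trunc_coords n" for X
    using that P_inj by (simp add: J_def)
  have J_bij: "bij_betw J (car D) (car ?A)"
  proof -
    have "bij_betw (inv_into (trunc_coords n) P) (car D) (trunc_coords n)"
      using P_inj by (simp add: carD bij_betw_inv_into inj_on_imp_bij_betw)
    from bij_betw_trans[OF this Q_bij] show ?thesis by (simp add: J_def comp_def)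
  qed
  have inv_J: "inv_into (car D) J (Q X) = P X" if "X \<in> trunc_coords n" for X
    using J_bij that inv_into_f_f[of J "car D" "P X"] JP[OF that] by (auto simp: bij_betw_def carD)
  have iso: "rep_iso D ?A J"
    unfolding rep_iso_def rep_hom_def
  proof (intro conjI J_bij ballI)
    show "linmap (scl D) (car D) (scl ?A) (car ?A) J"
      unfolding linmap_def carD
    proof (intro conjI ballI allI)
      fix x y k assume "x \<in> P ` trunc_coords n" "y \<in> P ` trunc_coords n"
      then obtain X Y where X: "X \<in> trunc_coords n" "x = P X" and Y: "Y \<in> trunc_coords n" "y = P Y" by blast
      show "J x \<in> car ?A" using X Q_bij by (auto simp: JP bij_betw_def)
      show "J (x + y) = J x + J y"
        using X Y by (simp add: P_add[symmetric] JP trunc_coords_closed Q_def q_lin frank_of_add)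
      show "J (scl D k x) = scl ?A k (J x)"
        using X by (simp add: P_scale[symmetric] JP trunc_coords_closed Q_def q_lin frank_of_scale frank_alg_simps)
    qed
    fix x assume "x \<in> car D"
    then obtain f g g' c1 c2 c3 where X: "(f, g, g', c1, c2, c3) \<in> trunc_coords n" "x = P (f, g, g', c1, c2, c3)"
      by (auto simp: carD)
    have X': "(0, g', 0, 0, c1, c2) \<in> trunc_coords n" "(g, g', c2, c3, c1, - f) \<in> trunc_coords n"
      using X by (auto simp: trunc_coords_def trunc_closed)
    show "J (der D x) = der ?A (J x)"
      using X X' by (simp add: P_der JP Q_def q_def frank_alg_simps)
  qed
  have L2: "module.subspace (scl ?A) L2"
  proof -
    have "0 \<in> L2" using z(2) trunc_closed(1) unfolding L2_def by (metis imageI)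
    then show ?thesis by (auto simp: frank_alg_simps V.subspace_def L2_def iota trunc_closed)
  qed
  define pr where "pr = inv_into (car D) J"
  have J_parts: "J (C.DK (f, 0), 0, 0) = frank_of (0, 0, 0, 0, 0, - f)" if "f \<in> trunc n" for f
    using JP[of "(f, 0, 0, 0, 0, 0)"] that by (simp add: P_def z Q_def q_def zero_prod_def trunc_coords_def trunc_closed)
  have J_parts2: "J (0, (C.DK (0, g), C.DK (0, g')), 0) = frank_of (g, g', 0, 0, 0, 0)"
    if "g \<in> trunc n" "g' \<in> trunc n" for g g'
    using JP[of "(0, g, g', 0, 0, 0)"] that by (simp add: P_def z Q_def q_def zero_prod_def trunc_coords_def trunc_closed)
  have pr: "pr (frank_of (g, g', 0, 0, 0, f)) = (C.DK (- f, 0), (C.DK (0, g), C.DK (0, g')), 0)"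
    if "f \<in> trunc n" "g \<in> trunc n" "g' \<in> trunc n" for f g g'
    using inv_J[of "(- f, g, g', 0, 0, 0)"] that
    by (simp add: pr_def P_def z Q_def q_def zero_prod_def trunc_coords_def trunc_closed)
  have pure2: "pure2 (fun_scale sfun_scale) w (C.DK (0, g)) =
      (C.DK (0, dpow_const (fst w) * g), C.DK (0, dpow_const (snd w) * g))" if "g \<in> trunc n" for w :: "'k \<times> 'k" and g
    using that by (simp add: pure2_def C.DK_scale trunc_pair_closed trunc_closed)
  have J2: "J (0, pure2 (fun_scale sfun_scale) w (C.DK (0, g)), 0) =
      frank_of (dpow_const (fst w) * g, dpow_const (snd w) * g, 0, 0, 0, 0)" if "g \<in> trunc n" for w g
    using that by (simp add: pure2 J_parts2 trunc_closed)
  have const: "dpow_const 1 = (1 :: 'k dpow)" "dpow_const 0 = (0 :: 'k dpow)"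
    by (auto intro!: dpow_eqI simp: dpow_const_def coeff_ring_ops(1,2))
  have "semisimplification_via ?A ?S L2 J"
    unfolding semisimplification_via_def Let_def D_def[symmetric] pr_def[symmetric]
    unfolding C.contact_simps
  proof (intro conjI ballI L2 iso)
    fix T T' assume "T \<in> evn ?S" "T' \<in> evn ?S"
    then obtain f f' where t: "f \<in> trunc n" "T = C.DK (f, 0)" "f' \<in> trunc n" "T' = C.DK (f', 0)"
      by (auto simp: C.contact_parts)
    then show "supercomm n T T' = fst (pr (mul ?A (J (T, 0, 0)) (J (T', 0, 0))))"
      by (simp add: J_parts frank_alg_simps trunc_coords_def trunc_closed trunc_mult[OF char3] pr
          C.supercomm_DK trunc_pair_closed dpow.D_simps)
  next
    fix T x assume "T \<in> evn ?S" "x \<in> odd_part ?S"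
    then obtain f g where t: "f \<in> trunc n" "T = C.DK (f, 0)" "g \<in> trunc n" "x = C.DK (0, g)"
      by (auto simp: C.contact_parts)
    show "negligible J2 (tensor2 (fun_scale sfun_scale) (odd_part ?S))
      (\<lambda>z. fst (snd (pr (mul ?A (J (T, 0, 0)) (J (0, pure2 (fun_scale sfun_scale) z x, 0)))))
         - pure2 (fun_scale sfun_scale) z (supercomm n T x))"
    proof -
      have "fst (snd (pr (mul ?A (J (T, 0, 0)) (J (0, pure2 (fun_scale sfun_scale) w x, 0)))))
          = pure2 (fun_scale sfun_scale) w (supercomm n T x)" for w
      proof -
        let ?b = "\<lambda>k. - dpow_deriv (f * (dpow_const k * g))"
        have "mul ?A (J (T, 0, 0)) (J (0, pure2 (fun_scale sfun_scale) w x, 0)) =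
            frank_of (?b (fst w), ?b (snd w), 0, 0, 0, 0)"
          using t by (simp add: J_parts J2 frank_alg_simps trunc_coords_def trunc_closed dpow.D_simps)
        moreover have "supercomm n T x = C.DK (0, - dpow_deriv (f * g))"
          using t by (simp add: C.supercomm_DK trunc_pair_closed trunc_closed dpow.D_simps)
        moreover have "?b k = dpow_const k * - dpow_deriv (f * g)" for k
          by (simp add: dpow.D_simps dpow_deriv_const algebra_simps)
        ultimately show ?thesis
          using t by (simp add: pr pure2 trunc_closed trunc_mult[OF char3])
      qed
      moreover have "negligible J2 (tensor2 (fun_scale sfun_scale) (odd_part ?S)) (\<lambda>_. 0)"
        using C.superalgebra_contact by (intro negligible_zero) (auto simp: superalgebra_def C.contact_simps)
      ultimately show ?thesis by simp
    qed
    show "supercomm n x T = - supercomm n T x"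
    proof -
      have "supercomm n x T + supercomm n T x = C.DK 0"
        using t by (simp add: C.supercomm_DK C.DK_add trunc_pair_closed trunc_closed trunc_mult[OF char3]
            dpow.D_simps zero_prod_def)
      then show ?thesis using C.DK_0 by (simp add: eq_neg_iff_add_eq_0)
    qed
  next
    fix x y assume "x \<in> odd_part ?S" "y \<in> odd_part ?S"
    then obtain g g' where t: "g \<in> trunc n" "x = C.DK (0, g)" "g' \<in> trunc n" "y = C.DK (0, g')"
      by (auto simp: C.contact_parts)
    show "supercomm n x y = fst (pr (mul ?A (J (0, pure2 (fun_scale sfun_scale) J2_u x, 0)) (J (0, pure2 (fun_scale sfun_scale) J2_v y, 0))
       - mul ?A (J (0, pure2 (fun_scale sfun_scale) J2_v x, 0)) (J (0, pure2 (fun_scale sfun_scale) J2_u y, 0))))"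
    proof -
      have ops: "frank_of X - frank_of Y = frank_of (X - Y)" for X Y
        using frank_of_add[of "X - Y" Y] by simp
      have "mul ?A (frank_of (g, 0, 0, 0, 0, 0)) (frank_of (0, g', 0, 0, 0, 0))
          - mul ?A (frank_of (0, g, 0, 0, 0, 0)) (frank_of (g', 0, 0, 0, 0, 0))
          = frank_of (0, 0, 0, 0, 0, g * g' + g * g')"
        using t by (simp add: frank_alg_simps trunc_coords_def trunc_closed dpow.D_simps ops)
      also have "g * g' + g * g' = - (g * g')" by (rule C.twice)
      finally show ?thesis
        using t by (simp add: J2 J2_u_def J2_v_def const pr trunc_closed trunc_mult[OF char3]
            C.supercomm_DK trunc_pair_closed dpow.D_simps)
    qed
  qed
  then show ?thesis
    unfolding is_semisimplification_def using C.superalgebra_contact by blast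
qed

end

theorem proposition2p4:
  fixes n :: nat
    and scale :: "'k::field \<Rightarrow> 'u::ab_group_add \<Rightarrow> 'u"
    and lam :: "'u \<Rightarrow> 'u \<Rightarrow> 'k"
    and u v :: 'u
    and e :: "'u \<Rightarrow> 'u"
  assumes "CHAR('k) = 3"
    and "n \<ge> 1"
    and "symplectic_plane scale lam"
    and "u \<noteq> v" and "\<not> module.dependent scale {u, v}" and "module.span scale {u, v} = UNIV"
    and "lam u v = 1"
    and "e \<in> sl scale" and "e u = 0" and "e v = u"
  shows "lie_alg_rep (frank n scale lam e)
    \<and> is_semisimplification (frank n scale lam e) (contact n)
    \<and> (\<forall>S :: ('k, 's::ab_group_add) superalg.
         is_semisimplification (frank n scale lam e) S \<longrightarrow> superalg_isomorphic S (contact n))"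
proof -
  interpret symplectic_basis scale lam u v
    using assms(1,3,6,7) by unfold_locales
  have e: "e = sl_mat 0 1 0" using assms(8-10) by (rule nilpotent_eq_sl_mat)
  interpret A: derivation_algebra "frank_alg n"
    by unfold_locales (rule lie_alg_rep_frank)
  note contact = is_semisimplification_contact[OF assms(2)]
  have "superalg_isomorphic S (contact n)" if "is_semisimplification (frank_alg n) S"
    for S :: "('k, 's) superalg"
    using that contact A.semisimplification_subquotient_model[OF two_neq_0] A.subquotient_model_unique
    unfolding is_semisimplification_def by metis
  then show ?thesis
    unfolding e using lie_alg_rep_frank contact by blast
qed

end
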